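(* Let $I=[-R_1,R_1]$, $J=[-R_2,R_2]$, and let $\lambda_n$ be the eigenvalues of $T_{I,J}$. Then the trace of $T_{I,J}$ satisfies $$\sum_n\lambda_n\sim\pi R_1^2+\pi R_2^2,\qquad R_1,R_2\to\infty.$$
   Context: The Fourier transform is $\hat f(t)=\int_{\mathbb{R}} f(x)e^{-2\pi i t x}\,dx$. The Fourier symmetric Sobolev space $\mathcal{H}$ is the Hilbert space of functions $f$ on $\mathbb{R}$ with $$\|f\|_{\mathcal{H}}^2=\int_{\mathbb{R}}|f(x)|^2(1+x^2)\,dx+\int_{\mathbb{R}}|\hat f(\xi)|^2(1+\xi^2)\,d\xi<\infty,$$ with inner product $\langle f,g\rangle_{\mathcal{H}}=\int_{\mathbb{R}} f\overline{g}(1+x^2)\,dx+\int_{\mathbb{R}}\hat f\,\overline{\hat g}(1+\xi^2)\,d\xi$. It is a reproducing kernel Hilbert space; $K_t\in\mathcal{H}$ denotes its reproducing kernel at $t\in\mathbb{R}$, i.e. $f(t)=\langle f,K_t\rangle_{\mathcal{H}}$ for all $f\in\mathcal{H}$. For measurable $I,J\subset\mathbb{R}$, the operator $T_{I,J}:\mathcal{H}\to\mathcal{H}$ is defined by $$T_{I,J}f(t)=\int_I f(x)\overline{K_t(x)}(1+x^2)\,dx+\int_J\hat f(x)\overline{\widehat{K_t}(x)}(1+x^2)\,dx.$$ Eigenvalues are counted with multiplicity. $f\sim g$ means that the quotient $f/g$ tends to $1$ in the indicated limit. *)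

theory Defs
  imports "HOL-Analysis.Analysis" "HOL-Library.Function_Algebras"
    "HOL-Library.Landau_Symbols"
begin

definition fourier :: "(real \<Rightarrow> complex) \<Rightarrow> real \<Rightarrow> complex" where
  "fourier f t = (LINT x|lborel. f x * exp (- 2 * complex_of_real pi * \<i> * of_real t * of_real x))"

text \<open>
  The Fourier symmetric Sobolev space. Finiteness of the first integral makes \<open>f\<close> integrable, so
  \<open>fourier f\<close> is an absolutely convergent integral; finiteness of the second one makes
  \<open>fourier f\<close> integrable, so \<open>f\<close> agrees almost everywhere with exactly one continuous function.
  Elements are taken to be these continuous representatives, which gives point evaluation a meaning.
\<close>
definition FSobolev :: "(real \<Rightarrow> complex) set" where
  "FSobolev = {f. continuous_on UNIV f
     \<and> integrable lborel (\<lambda>x. (cmod (f x))\<^sup>2 * (1 + x\<^sup>2))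
     \<and> integrable lborel (\<lambda>\<xi>. (cmod (fourier f \<xi>))\<^sup>2 * (1 + \<xi>\<^sup>2))}"

definition FS_inner :: "(real \<Rightarrow> complex) \<Rightarrow> (real \<Rightarrow> complex) \<Rightarrow> complex" where
  "FS_inner f g =
     (LINT x|lborel. f x * cnj (g x) * of_real (1 + x\<^sup>2))
     + (LINT \<xi>|lborel. fourier f \<xi> * cnj (fourier g \<xi>) * of_real (1 + \<xi>\<^sup>2))"

definition FS_kernel :: "real \<Rightarrow> real \<Rightarrow> complex" where
  "FS_kernel t = (THE k. k \<in> FSobolev \<and> (\<forall>f\<in>FSobolev. f t = FS_inner f k))"

definition loc_op :: "real set \<Rightarrow> real set \<Rightarrow> (real \<Rightarrow> complex) \<Rightarrow> (real \<Rightarrow> complex)" where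
  "loc_op I J f = (\<lambda>t.
     (LINT x:I|lborel. f x * cnj (FS_kernel t x) * of_real (1 + x\<^sup>2))
     + (LINT x:J|lborel. fourier f x * cnj (fourier (FS_kernel t) x) * of_real (1 + x\<^sup>2)))"

definition fscale :: "complex \<Rightarrow> (real \<Rightarrow> complex) \<Rightarrow> (real \<Rightarrow> complex)" where
  "fscale c f = (\<lambda>x. c * f x)"

interpretation fun_space: vector_space fscale
  by unfold_locales (auto simp: fscale_def fun_eq_iff algebra_simps)

definition eigenspace ::
    "((real \<Rightarrow> complex) \<Rightarrow> (real \<Rightarrow> complex)) \<Rightarrow> complex \<Rightarrow> (real \<Rightarrow> complex) set" where
  "eigenspace T \<mu> = {f \<in> FSobolev. T f = fscale \<mu> f}"

definition eigenvalues :: "((real \<Rightarrow> complex) \<Rightarrow> (real \<Rightarrow> complex)) \<Rightarrow> complex set" where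
  "eigenvalues T = {\<mu>. \<exists>f\<in>eigenspace T \<mu>. f \<noteq> 0}"

definition fin_dim :: "(real \<Rightarrow> complex) set \<Rightarrow> bool" where
  "fin_dim V \<longleftrightarrow> (\<exists>B. finite B \<and> V \<subseteq> fun_space.span B)"

text \<open>
  The complex dimension of the eigenspace. The library convention makes it 0 when that dimension is
  infinite, so it is the multiplicity only for eigenvalues whose eigenspace satisfies \<open>fin_dim\<close>;
  for the eigenvalue 0 the value is irrelevant in a sum of eigenvalues.
\<close>
definition multiplicity_of :: "((real \<Rightarrow> complex) \<Rightarrow> (real \<Rightarrow> complex)) \<Rightarrow> complex \<Rightarrow> nat" where
  "multiplicity_of T \<mu> = fun_space.dim (eigenspace T \<mu>)"

end

theory Submission
  imports Defs "HOL-Complex_Analysis.Great_Picard" "HOL-Probability.Probability" "HOL-Real_Asymp.Real_Asymp"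
begin

text \<open>
  The norm of the space is the quadratic form of the harmonic oscillator \<open>2 + x\<^sup>2 - D\<^sup>2 / (4 * pi\<^sup>2)\<close>, so
  the reproducing kernel is its Green function, which is the integral of Mehler's heat kernel over the time \<open>\<tau>\<close>. In the
  variable \<open>v\<^sup>2 = tanh (\<tau> / 2)\<close> it becomes an integral of Gaussians over \<open>0 < v < 1\<close> with a bounded weight,
  and on the diagonal \<open>x * K x x\<close> tends to \<open>pi\<close>. On the Fourier side the equation of the Green function is the
  integral of a total \<open>v\<close>-derivative; the reproducing property follows by Fourier inversion and Parseval.

  The operator satisfies \<open>\<langle>T f, g\<rangle> = \<integral> \<langle>f, k x\<rangle> \<langle>k x, g\<rangle> dM x\<close> for a norm-continuous family \<open>k\<close> over a compact set
  (the kernels \<open>K x\<close> for \<open>x \<in> I\<close> and their inverse Fourier transforms for \<open>x \<in> J\<close>). By Arzela--Ascoli it is compact,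
  and by Bessel's inequality the sum of its eigenvalues is at most \<open>\<integral> \<parallel>k x\<parallel>\<^sup>2 dM x\<close>. Equality holds because the component \<open>r\<close> of
  \<open>k x\<close> orthogonal to the eigenvectors with eigenvalue at least \<open>\<epsilon>\<close> has \<open>\<integral> \<bar>\<langle>r, k y\<rangle>\<bar>\<^sup>2 dM y\<close> of order \<open>\<epsilon>\<close>, while
  \<open>\<langle>r, k y\<rangle>\<close> is equicontinuous in \<open>y\<close> with value \<open>\<parallel>r\<parallel>\<^sup>2\<close> at \<open>y = x\<close>, so \<open>\<parallel>r\<parallel>\<close> tends to 0. Completeness of the space is never used. Since the Fourier transform is unitary on the
  space, the trace is \<open>\<integral> K x x * (1 + x\<^sup>2)\<close> over \<open>I\<close> plus the same over \<open>J\<close>, each asymptotic to \<open>pi * R\<^sup>2\<close>.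
\<close>

text \<open>The operator H = x^2 - D^2 / (4 * pi^2) has eigenvalues (2 * n + 1) / (2 * pi), so at
  time pi * \<tau> its heat kernel is Mehler's, \<open>mehler_gauss\<close> divided by sqrt (sinh
  \<tau>), and the summand 2 of the oscillator contributes exp (- 2 * pi * \<tau>): this is the
  exponent \<open>2 * pi\<close> of \<open>mehler_exp\<close>. With sinh \<tau> = 2 * v^2 / (1 -
  v^4) and d\<tau>/dv = 4 * v / (1 - v^4), the short-time singularity of the prefactor cancels
  against the Jacobian and leaves the constant 2 * sqrt 2 * pi. On the diagonal the exponent is
  exactly - 2 * pi * x^2 * v^2, so for large x only the weight near v = 0 counts, and 2 * sqrt 2 *
  pi times the half-line integral 1 / (2 * sqrt 2) of exp (- 2 * pi * s^2) is the limit pi.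
  Integrating x^2 * pi / |x| over [-R, R] gives pi * R^2. The delicate half of the trace formula is
  the lower bound: no eigenbasis of the whole space is constructed, so spectral truncations are
  compared with each single k x, and limits of T are realised explicitly as superpositions of
  kernels.\<close>

section \<open>Semi-inner product spaces of functions\<close>

text \<open>Only semidefiniteness is asked for, so that one Cauchy--Schwarz inequality serves both
  \<open>FS_inner\<close> and, in \<open>nsq_T\<close>, the form \<open>ip (T f) g\<close>, which
  may vanish on nonzero vectors.\<close>

locale complex_semi_inner =
  fixes V :: "(real \<Rightarrow> complex) set" and ip :: "(real \<Rightarrow> complex) \<Rightarrow> (real \<Rightarrow> complex) \<Rightarrow> complex"
  assumes V: "fun_space.subspace V"
    and ip_add: "\<And>f g h. f \<in> V \<Longrightarrow> g \<in> V \<Longrightarrow> h \<in> V \<Longrightarrow> ip (f + g) h = ip f h + ip g h"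
    and ip_scale: "\<And>c f h. f \<in> V \<Longrightarrow> h \<in> V \<Longrightarrow> ip (fscale c f) h = c * ip f h"
    and ip_cnj: "\<And>f g. f \<in> V \<Longrightarrow> g \<in> V \<Longrightarrow> ip f g = cnj (ip g f)"
    and ip_ge0: "\<And>f. f \<in> V \<Longrightarrow> 0 \<le> Re (ip f f)"
begin

definition nsq :: "(real \<Rightarrow> complex) \<Rightarrow> real" where "nsq f = Re (ip f f)"
definition nrm :: "(real \<Rightarrow> complex) \<Rightarrow> real" where "nrm f = sqrt (nsq f)"

lemma V_0[simp]: "0 \<in> V" and V_add[simp]: "f \<in> V \<Longrightarrow> g \<in> V \<Longrightarrow> f + g \<in> V"
  and V_scale[simp]: "f \<in> V \<Longrightarrow> fscale c f \<in> V" and V_diff[simp]: "f \<in> V \<Longrightarrow> g \<in> V \<Longrightarrow> f - g \<in> V"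
  using V fun_space.subspace_0 fun_space.subspace_add fun_space.subspace_scale fun_space.subspace_diff by blast+

lemma V_sum[simp]: "(\<And>b. b \<in> B \<Longrightarrow> \<phi> b \<in> V) \<Longrightarrow> (\<Sum>b\<in>B. \<phi> b) \<in> V"
  using V fun_space.subspace_sum by blast

lemma nsq_ge0: "f \<in> V \<Longrightarrow> 0 \<le> nsq f"
  unfolding nsq_def by (rule ip_ge0)

lemma nrm_ge0: "f \<in> V \<Longrightarrow> 0 \<le> nrm f"
  by (simp add: nrm_def nsq_ge0)

lemma nrm_sq: "f \<in> V \<Longrightarrow> (nrm f)\<^sup>2 = nsq f"
  by (simp add: nrm_def nsq_ge0)

lemma ip_self: "f \<in> V \<Longrightarrow> ip f f = complex_of_real (nsq f)"
  using ip_cnj[of f f] by (simp add: nsq_def complex_eq_iff)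

lemma ip_0_left[simp]: "h \<in> V \<Longrightarrow> ip 0 h = 0"
  using ip_scale[of 0 h 0] by simp

lemma ip_diff: assumes "f \<in> V" "g \<in> V" "h \<in> V" shows "ip (f - g) h = ip f h - ip g h"
  using ip_add[of "f - g" g h] assms by simp

lemma ip_add_right: assumes "f \<in> V" "g \<in> V" "h \<in> V" shows "ip h (f + g) = ip h f + ip h g"
  using assms ip_add[of f g h] by (simp add: ip_cnj[of h])

lemma ip_diff_right: assumes "f \<in> V" "g \<in> V" "h \<in> V" shows "ip h (f - g) = ip h f - ip h g"
  using assms ip_diff[of f g h] by (simp add: ip_cnj[of h])

lemma ip_scale_right: assumes "f \<in> V" "h \<in> V" shows "ip h (fscale c f) = cnj c * ip h f"
  using assms ip_scale[of f h c] by (simp add: ip_cnj[of h])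

lemma ip_0_right[simp]: "h \<in> V \<Longrightarrow> ip h 0 = 0"
  using ip_cnj[of h 0] by simp

lemma ip_sum: assumes "\<And>b. b \<in> B \<Longrightarrow> \<phi> b \<in> V" "h \<in> V"
  shows "ip (\<Sum>b\<in>B. \<phi> b) h = (\<Sum>b\<in>B. ip (\<phi> b) h)"
proof (cases "finite B")
  case True then show ?thesis using assms(1)
    by (induction B rule: finite_induct) (auto simp: assms(2) ip_add)
qed (simp add: assms)

lemma nsq_scale: "f \<in> V \<Longrightarrow> nsq (fscale c f) = (cmod c)\<^sup>2 * nsq f"
proof -
  assume f: "f \<in> V"
  have "ip (fscale c f) (fscale c f) = (c * cnj c) * ip f f"
    using f by (simp add: ip_scale ip_scale_right)
  also have "\<dots> = complex_of_real ((cmod c)\<^sup>2 * nsq f)"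
    using f by (simp only: ip_self of_real_mult complex_norm_square)
  finally show ?thesis by (simp add: nsq_def)
qed

lemma nsq_add: assumes "f \<in> V" "g \<in> V" shows "nsq (f + g) = nsq f + 2 * Re (ip f g) + nsq g"
  using assms ip_cnj[of g f] by (simp add: nsq_def ip_add ip_add_right)

lemma nsq_diff: assumes "f \<in> V" "g \<in> V" shows "nsq (f - g) = nsq f - 2 * Re (ip f g) + nsq g"
  using assms ip_cnj[of g f] by (simp add: nsq_def ip_diff ip_diff_right)

lemma cauchy_schwarz_sq: assumes f: "f \<in> V" and g: "g \<in> V"
  shows "(cmod (ip f g))\<^sup>2 \<le> nsq f * nsq g"
proof -
  define c where "c = ip f g"
  \<comment> \<open>Scaling g by s times \<open>ip f g\<close> with s real makes the cross term
    real, so no choice of phase is needed.\<close>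
  have key: "0 \<le> nsq f - 2 * s * (cmod c)\<^sup>2 + s\<^sup>2 * (cmod c)\<^sup>2 * nsq g" for s :: real
  proof -
    have "0 \<le> nsq (f - fscale (of_real s * c) g)" using f g by (simp add: nsq_ge0)
    also have "\<dots> = nsq f - 2 * Re (cnj (of_real s * c) * c) + (cmod (of_real s * c))\<^sup>2 * nsq g"
      using f g by (simp add: nsq_diff nsq_scale ip_scale_right c_def)
    also have "cnj (of_real s * c) * c = of_real (s * (cmod c)\<^sup>2)"
      by (simp only: of_real_mult complex_norm_square) (simp add: mult_ac)
    finally show ?thesis by (simp add: norm_mult power_mult_distrib algebra_simps)
  qed
  show ?thesis
  proof (cases "nsq g = 0")
    case True
    have "(cmod c)\<^sup>2 = 0"
    proof (rule ccontr)
      assume n: "(cmod c)\<^sup>2 \<noteq> 0"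
      \<comment> \<open>For \<open>nsq g = 0\<close> the expression in \<open>key\<close> is affine
        in s; this value of s makes it equal to -1.\<close>
      have "2 * ((nsq f + 1) / (2 * (cmod c)\<^sup>2)) * (cmod c)\<^sup>2 = nsq f + 1" using n by (simp add: field_simps)
      then show False using key[of "(nsq f + 1) / (2 * (cmod c)\<^sup>2)"] True by (simp add: )
    qed
    then show ?thesis using True c_def by simp
  next
    case False
    then have p: "nsq g > 0" using nsq_ge0[OF g] by simp
    have "0 \<le> nsq f - (cmod c)\<^sup>2 / nsq g" using key[of "1 / nsq g"] p by (simp add: field_simps power2_eq_square)
    then show ?thesis using p by (simp add: field_simps c_def)
  qed
qed

lemma cauchy_schwarz: assumes f: "f \<in> V" and g: "g \<in> V" shows "cmod (ip f g) \<le> nrm f * nrm g"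
  by (rule power2_le_imp_le) (use cauchy_schwarz_sq[OF f g] f g in \<open>simp_all add: power_mult_distrib nrm_sq nrm_ge0\<close>)

lemma nrm_add: assumes f: "f \<in> V" and g: "g \<in> V" shows "nrm (f + g) \<le> nrm f + nrm g"
proof (rule power2_le_imp_le)
  have "Re (ip f g) \<le> nrm f * nrm g" using cauchy_schwarz[OF f g] complex_Re_le_cmod[of "ip f g"] by linarith
  then show "(nrm (f + g))\<^sup>2 \<le> (nrm f + nrm g)\<^sup>2"
    using f g by (simp add: nrm_sq power2_sum nsq_add)
qed (use f g in \<open>simp add: nrm_ge0\<close>)

lemma nrm_scale: "f \<in> V \<Longrightarrow> nrm (fscale c f) = cmod c * nrm f"
  by (simp add: nrm_def nsq_scale real_sqrt_mult)

lemma nrm_diff_commute: "f \<in> V \<Longrightarrow> g \<in> V \<Longrightarrow> nrm (f - g) = nrm (g - f)"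
  using ip_cnj[of f g] by (simp add: nrm_def nsq_diff)

section \<open>Finite orthonormal systems and projections\<close>

definition orthonormal :: "(real \<Rightarrow> complex) set \<Rightarrow> bool" where
  "orthonormal B \<longleftrightarrow> finite B \<and> B \<subseteq> V \<and> (\<forall>e\<in>B. \<forall>e'\<in>B. ip e e' = (if e = e' then 1 else 0))"

definition proj :: "(real \<Rightarrow> complex) set \<Rightarrow> (real \<Rightarrow> complex) \<Rightarrow> (real \<Rightarrow> complex)" where
  "proj B f = (\<Sum>e\<in>B. fscale (ip f e) e)"

lemma onsD: assumes "orthonormal B" shows "finite B" "\<And>e. e \<in> B \<Longrightarrow> e \<in> V"
  "\<And>e e'. e \<in> B \<Longrightarrow> e' \<in> B \<Longrightarrow> ip e e' = (if e = e' then 1 else 0)"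
  using assms unfolding orthonormal_def by auto

lemma proj_V: assumes "orthonormal B" "f \<in> V" shows "proj B f \<in> V"
  unfolding proj_def using onsD[OF assms(1)] assms(2) by simp

lemma ip_proj: assumes B: "orthonormal B" and f: "f \<in> V" and e: "e \<in> B" shows "ip (proj B f) e = ip f e"
proof -
  have "ip (proj B f) e = (\<Sum>e'\<in>B. ip f e' * ip e' e)"
    unfolding proj_def using onsD[OF B] e by (subst ip_sum) (auto simp: ip_scale)
  also have "\<dots> = (\<Sum>e'\<in>B. if e' = e then ip f e else 0)"
    using onsD[OF B] e by (intro sum.cong) auto
  also have "\<dots> = ip f e" using onsD(1)[OF B] e by simp
  finally show ?thesis .
qed

lemma proj_orth: assumes B: "orthonormal B" and f: "f \<in> V" and e: "e \<in> B" shows "ip (f - proj B f) e = 0"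
  using ip_proj[OF assms] proj_V[OF B f] onsD[OF B] e f by (simp add: ip_diff)

lemma ip_orth_proj: assumes B: "orthonormal B" and f: "f \<in> V" and g: "g \<in> V" and "\<And>e. e \<in> B \<Longrightarrow> ip g e = 0"
  shows "ip g (proj B f) = 0"
proof -
  have "ip (proj B f) g = (\<Sum>e\<in>B. ip f e * ip e g)"
    unfolding proj_def using onsD[OF B] g by (subst ip_sum) (auto simp: ip_scale)
  also have "\<dots> = 0"
    using assms(4) onsD(2)[OF B] g ip_cnj[of _ g] by (intro sum.neutral) auto
  finally show ?thesis using ip_cnj[of g "proj B f"] proj_V[OF B f] g by simp
qed

text \<open>The residual is orthogonal to the projection, so pairing it with f is pairing it with
  itself. The first identity yields Bessel's inequality; the second one lets
  \<open>residual_tendsto_0\<close> read off the size of the residual of k x from its value at k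
  x.\<close>

lemma nsq_proj_residual: assumes B: "orthonormal B" and f: "f \<in> V"
  shows "nsq (f - proj B f) = nsq f - (\<Sum>e\<in>B. (cmod (ip f e))\<^sup>2)"
    and "ip (f - proj B f) f = complex_of_real (nsq (f - proj B f))"
proof -
  let ?r = "f - proj B f"
  have r: "?r \<in> V" using proj_V[OF B f] f by simp
  have o: "ip ?r (proj B f) = 0" by (rule ip_orth_proj[OF B f r proj_orth[OF B f]])
  have "ip ?r ?r = ip ?r f" using o r f proj_V[OF B f] by (simp add: ip_diff_right)
  then show 2: "ip ?r f = complex_of_real (nsq ?r)" using ip_self[OF r] by simp
  have "ip (proj B f) f = (\<Sum>e\<in>B. ip f e * ip e f)"
    unfolding proj_def using onsD[OF B] f by (subst ip_sum) (auto simp: ip_scale)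
  also have "\<dots> = (\<Sum>e\<in>B. complex_of_real ((cmod (ip f e))\<^sup>2))"
  proof (rule sum.cong[OF refl])
    fix e assume "e \<in> B"
    then have "ip e f = cnj (ip f e)" using onsD(2)[OF B] f ip_cnj by blast
    then show "ip f e * ip e f = complex_of_real ((cmod (ip f e))\<^sup>2)"
      by (simp only: complex_norm_square)
  qed
  finally have "ip ?r f = complex_of_real (nsq f - (\<Sum>e\<in>B. (cmod (ip f e))\<^sup>2))"
    using f proj_V[OF B f] by (simp add: ip_diff ip_self)
  then show "nsq ?r = nsq f - (\<Sum>e\<in>B. (cmod (ip f e))\<^sup>2)" using 2 by (metis of_real_eq_iff)
qed

lemma bessel: assumes "orthonormal B" and "f \<in> V" shows "(\<Sum>e\<in>B. (cmod (ip f e))\<^sup>2) \<le> nsq f"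
  using nsq_proj_residual(1)[OF assms] nsq_ge0[of "f - proj B f"] proj_V[OF assms] assms by simp

lemma orthonormal_independent: assumes B: "orthonormal B" shows "fun_space.independent B"
proof
  assume "fun_space.dependent B"
  then obtain u v where v: "v \<in> B" "u v \<noteq> 0" and s: "(\<Sum>v\<in>B. fscale (u v) v) = 0"
    using fun_space.dependent_finite[OF onsD(1)[OF B]] by auto
  have "0 = ip (\<Sum>v\<in>B. fscale (u v) v) v" using s v onsD(2)[OF B] by simp
  also have "\<dots> = (\<Sum>e\<in>B. u e * ip e v)"
    using onsD[OF B] v by (subst ip_sum) (auto simp: ip_scale)
  also have "\<dots> = (\<Sum>e\<in>B. if e = v then u v else 0)"
    using onsD[OF B] v by (intro sum.cong) auto
  also have "\<dots> = u v" using onsD(1)[OF B] v by simp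
  finally show False using v by simp
qed

lemma proj_in_span: "proj B f \<in> fun_space.span B"
  unfolding proj_def by (intro fun_space.span_sum fun_space.span_scale fun_space.span_base)

lemma orthonormal_insert: assumes B: "orthonormal B" and h: "h \<in> V" "nsq h = 1" "\<And>e. e \<in> B \<Longrightarrow> ip h e = 0"
  shows "orthonormal (insert h B)" "h \<notin> B"
proof -
  have "ip e h = 0" if "e \<in> B" for e using that onsD(2)[OF B] h ip_cnj[of e h] by simp
  then show "orthonormal (insert h B)" using B h ip_self[of h] unfolding orthonormal_def by auto
  show "h \<notin> B" using h ip_self[of h] by auto
qed

end

section \<open>Operators given by a continuous frame\<close>

text \<open>T is given only weakly, by \<open>T_ip\<close>. The assumption \<open>supp\<close> turns
  a small integral of a continuous function into smallness at a point, and \<open>synth\<close>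
  provides weak integrals of the family k against continuous coefficients, in the role that Riesz
  representation plays on a Hilbert space.\<close>

locale compact_frame = complex_semi_inner V ip + finite_measure M
  for V ip and M :: "'b::euclidean_space measure" +
  fixes S :: "'b set" and k :: "'b \<Rightarrow> real \<Rightarrow> complex" and T :: "(real \<Rightarrow> complex) \<Rightarrow> real \<Rightarrow> complex"
  assumes ip_eq0: "\<And>f. f \<in> V \<Longrightarrow> ip f f = 0 \<Longrightarrow> f = 0"
    and S: "compact S" and space_M: "space M = S" and sets_M: "sets M = sets (restrict_space borel S)"
    and supp: "\<And>x \<delta>. x \<in> S \<Longrightarrow> 0 < \<delta> \<Longrightarrow> measure M (S \<inter> ball x \<delta>) > 0"
    and k_V[simp]: "\<And>x. x \<in> S \<Longrightarrow> k x \<in> V"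
    and k_cont: "\<And>x \<epsilon>. x \<in> S \<Longrightarrow> 0 < \<epsilon> \<Longrightarrow> \<exists>\<delta>>0. \<forall>y\<in>S. dist y x < \<delta> \<longrightarrow> nrm (k y - k x) < \<epsilon>"
    and T_V[simp]: "\<And>f. f \<in> V \<Longrightarrow> T f \<in> V"
    and T_ip: "\<And>f g. f \<in> V \<Longrightarrow> g \<in> V \<Longrightarrow> ip (T f) g = (LINT x|M. ip f (k x) * cnj (ip g (k x)))"
    and synth: "\<And>u. continuous_on S u \<Longrightarrow> \<exists>s\<in>V. \<forall>g\<in>V. ip s g = (LINT x|M. u x * cnj (ip g (k x)))"
begin

definition espace :: "complex \<Rightarrow> (real \<Rightarrow> complex) set" where "espace \<mu> = {f \<in> V. T f = fscale \<mu> f}"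
definition quad :: "(real \<Rightarrow> complex) \<Rightarrow> real" where "quad f = Re (ip (T f) f)"

lemma nsq_eq0: "f \<in> V \<Longrightarrow> nsq f = 0 \<Longrightarrow> f = 0"
  using ip_self ip_eq0 by simp

lemma ip_ext: assumes "f \<in> V" "g \<in> V" "\<And>h. h \<in> V \<Longrightarrow> ip f h = ip g h" shows "f = g"
proof -
  have "ip (f - g) (f - g) = 0" using assms by (simp add: ip_diff)
  then have "f - g = 0" by (intro ip_eq0) (use assms in auto)
  then show ?thesis by simp
qed

lemma cont_ip: assumes f: "f \<in> V" shows "continuous_on S (\<lambda>x. ip f (k x))"
  unfolding continuous_on_iff
proof (intro ballI allI impI)
  fix x e assume x: "x \<in> S" and e: "0 < (e::real)"
  have p: "e / (nrm f + 1) > 0" using e nrm_ge0[OF f] by (simp add: add_nonneg_pos)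
  obtain d where d: "d > 0" "\<And>y. y \<in> S \<Longrightarrow> dist y x < d \<Longrightarrow> nrm (k y - k x) < e / (nrm f + 1)"
    using k_cont[OF x p] by auto
  show "\<exists>d>0. \<forall>x'\<in>S. dist x' x < d \<longrightarrow> dist (ip f (k x')) (ip f (k x)) < e"
  proof (intro exI[of _ d] conjI ballI impI d(1))
    fix y assume y: "y \<in> S" "dist y x < d"
    have "dist (ip f (k y)) (ip f (k x)) = cmod (ip f (k y - k x))"
      using f x y by (simp add: ip_diff_right dist_norm)
    also have "\<dots> \<le> nrm f * nrm (k y - k x)" using f x y by (intro cauchy_schwarz) auto
    also have "\<dots> \<le> (nrm f + 1) * nrm (k y - k x)"
      using x y by (intro mult_right_mono nrm_ge0) auto
    also have "\<dots> < (nrm f + 1) * (e / (nrm f + 1))"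
      using d(2)[OF y] nrm_ge0[OF f] by (intro mult_strict_left_mono) auto
    also have "\<dots> = e" using nrm_ge0[OF f] by simp
    finally show "dist (ip f (k y)) (ip f (k x)) < e" .
  qed
qed

lemma cont_nrm_k: "continuous_on S (\<lambda>x. nrm (k x))"
  unfolding continuous_on_iff
proof (intro ballI allI impI)
  fix x e assume x: "x \<in> S" and e: "0 < (e::real)"
  obtain d where d: "d > 0" "\<And>y. y \<in> S \<Longrightarrow> dist y x < d \<Longrightarrow> nrm (k y - k x) < e"
    using k_cont[OF x e] by auto
  show "\<exists>d>0. \<forall>x'\<in>S. dist x' x < d \<longrightarrow> dist (nrm (k x')) (nrm (k x)) < e"
  proof (intro exI[of _ d] conjI ballI impI d(1))
    fix y assume y: "y \<in> S" "dist y x < d"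
    have "nrm (k y) \<le> nrm (k y - k x) + nrm (k x)"
      using nrm_add[of "k y - k x" "k x"] x y by simp
    moreover have "nrm (k x) \<le> nrm (k y - k x) + nrm (k y)"
      using nrm_add[of "k x - k y" "k y"] x y nrm_diff_commute[of "k x" "k y"] by simp
    ultimately show "dist (nrm (k y)) (nrm (k x)) < e" using d(2)[OF y] by (simp add: dist_real_def)
  qed
qed

lemma nrm_k_bound: "\<exists>C\<ge>0. \<forall>x\<in>S. nrm (k x) \<le> C"
proof -
  have "bounded ((\<lambda>x. nrm (k x)) ` S)"
    by (intro compact_imp_bounded compact_continuous_image cont_nrm_k S)
  then obtain a where "\<forall>x\<in>S. \<bar>nrm (k x)\<bar> \<le> a" unfolding bounded_iff by auto
  then have "\<forall>x\<in>S. nrm (k x) \<le> max a 0" by fastforce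
  then show ?thesis by (intro exI[of _ "max a 0"]) auto
qed

lemma cont_nsq_k: "continuous_on S (\<lambda>x. nsq (k x))"
proof -
  have "continuous_on S (\<lambda>x. (nrm (k x))\<^sup>2)" by (intro continuous_intros cont_nrm_k)
  then show ?thesis by (rule continuous_on_eq) (simp add: nrm_sq)
qed

lemma integrable_cont: fixes f :: "'b \<Rightarrow> 'c::{banach,second_countable_topology}"
  assumes f: "continuous_on S f" shows "integrable M f"
proof -
  have m: "f \<in> borel_measurable M"
    using borel_measurable_continuous_on_restrict[OF f] by (simp add: measurable_cong_sets[OF sets_M refl])
  have "bounded (f ` S)" by (intro compact_imp_bounded compact_continuous_image f S)
  then obtain B where B: "\<forall>x\<in>S. norm (f x) \<le> B" unfolding bounded_iff by auto
  show ?thesis by (rule integrable_const_bound[OF AE_I2 m]) (use B space_M in auto)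
qed

lemma T_selfadj: assumes f: "f \<in> V" and g: "g \<in> V" shows "ip (T f) g = ip f (T g)"
proof -
  have "ip (T f) g = cnj (ip (T g) f)"
    unfolding T_ip[OF f g] T_ip[OF g f] by (subst Bochner_Integration.integral_cnj[symmetric]) (simp add: mult.commute)
  then show ?thesis using ip_cnj[of f "T g"] f g by simp
qed

text \<open>Linearity is a consequence of self-adjointness: with T moved to the other argument, both
  sides pair equally with every h, and \<open>ip_ext\<close> separates.\<close>

lemma T_lin: assumes f: "f \<in> V" and g: "g \<in> V"
  shows "T (f + g) = T f + T g" "T (fscale c f) = fscale c (T f)" "T (f - g) = T f - T g"
proof -
  show "T (f + g) = T f + T g" by (rule ip_ext) (use f g in \<open>auto simp: T_selfadj ip_add\<close>)
  show "T (fscale c f) = fscale c (T f)" by (rule ip_ext) (use f g in \<open>auto simp: T_selfadj ip_scale\<close>)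
  show "T (f - g) = T f - T g" by (rule ip_ext) (use f g in \<open>auto simp: T_selfadj ip_diff\<close>)
qed

lemma quad_eq: assumes f: "f \<in> V" shows "quad f = (LINT x|M. (cmod (ip f (k x)))\<^sup>2)"
proof -
  have "ip (T f) f = (LINT x|M. complex_of_real ((cmod (ip f (k x)))\<^sup>2))"
    unfolding T_ip[OF f f] by (simp only: complex_norm_square)
  also have "\<dots> = complex_of_real (LINT x|M. (cmod (ip f (k x)))\<^sup>2)" by (rule integral_complex_of_real)
  finally show ?thesis by (simp add: quad_def)
qed

lemma quad_ge0: "f \<in> V \<Longrightarrow> 0 \<le> quad f"
  by (simp add: quad_eq)

definition kernel_trace :: real where "kernel_trace = (LINT x|M. nsq (k x))"

text \<open>Bessel's inequality for the vector k x, integrated over x.\<close>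

lemma trace_bound: assumes B: "orthonormal B" shows "(\<Sum>e\<in>B. quad e) \<le> kernel_trace"
proof -
  have i: "integrable M (\<lambda>x. (cmod (ip e (k x)))\<^sup>2)" if "e \<in> B" for e
    using onsD(2)[OF B that] by (intro integrable_cont continuous_intros cont_ip)
  have "(\<Sum>e\<in>B. quad e) = (\<Sum>e\<in>B. (LINT x|M. (cmod (ip e (k x)))\<^sup>2))"
    using onsD(2)[OF B] by (intro sum.cong) (auto simp: quad_eq)
  also have "\<dots> = (LINT x|M. (\<Sum>e\<in>B. (cmod (ip e (k x)))\<^sup>2))"
    using i by (rule Bochner_Integration.integral_sum[symmetric])
  also have "\<dots> \<le> kernel_trace" unfolding kernel_trace_def
  proof (rule integral_mono)
    show "integrable M (\<lambda>x. \<Sum>e\<in>B. (cmod (ip e (k x)))\<^sup>2)" using i by simp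
    show "integrable M (\<lambda>x. nsq (k x))" by (rule integrable_cont[OF cont_nsq_k])
    fix x assume "x \<in> space M"
    then have x: "x \<in> S" using space_M by simp
    have "(\<Sum>e\<in>B. (cmod (ip e (k x)))\<^sup>2) = (\<Sum>e\<in>B. (cmod (ip (k x) e))\<^sup>2)"
      using onsD(2)[OF B] x ip_cnj[of _ "k x"] by (intro sum.cong) auto
    also have "\<dots> \<le> nsq (k x)" by (rule bessel[OF B]) (use x in auto)
    finally show "(\<Sum>e\<in>B. (cmod (ip e (k x)))\<^sup>2) \<le> nsq (k x)" .
  qed
  finally show ?thesis .
qed

lemma normalize: assumes f: "f \<in> V" "f \<noteq> 0"
  shows "nsq (fscale (of_real (1 / nrm f)) f) = 1" "nrm f > 0"
proof -
  have "nsq f \<noteq> 0" using nsq_eq0 f by blast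
  then have p: "nsq f > 0" using nsq_ge0[OF f(1)] by simp
  then show "nrm f > 0" by (simp add: nrm_def)
  then show "nsq (fscale (of_real (1 / nrm f)) f) = 1"
    using p nrm_sq[OF f(1)] f by (simp add: nsq_scale norm_divide power_divide)
qed

lemma quad_scale: "f \<in> V \<Longrightarrow> quad (fscale c f) = (cmod c)\<^sup>2 * quad f"
proof -
  assume f: "f \<in> V"
  have "ip (T (fscale c f)) (fscale c f) = (c * cnj c) * ip (T f) f"
    using f by (simp add: T_lin(2)[OF f f] ip_scale ip_scale_right)
  also have "c * cnj c = complex_of_real ((cmod c)\<^sup>2)" by (simp only: complex_norm_square)
  finally show ?thesis by (simp add: quad_def)
qed

lemma kernel_trace_ge0: "0 \<le> kernel_trace"
  using trace_bound[of "{}"] by (simp add: orthonormal_def)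

text \<open>The normalised f alone is an orthonormal system, so \<open>trace_bound\<close> already
  contains the boundedness of T.\<close>

lemma quad_le: assumes f: "f \<in> V" shows "quad f \<le> kernel_trace * nsq f"
proof (cases "f = 0")
  case True then show ?thesis using kernel_trace_ge0 by (simp add: quad_def nsq_def)
next
  case False
  let ?e = "fscale (of_real (1 / nrm f)) f"
  have "orthonormal {?e}" using normalize[OF f False] f ip_self[of ?e] by (auto simp: orthonormal_def)
  then have "quad ?e \<le> kernel_trace" using trace_bound[of "{?e}"] by simp
  then have "(1 / nrm f)\<^sup>2 * quad f \<le> kernel_trace" using f by (simp add: quad_scale norm_divide power_divide)
  then have "quad f / nsq f \<le> kernel_trace" using nrm_sq[OF f] by (simp add: power_divide)
  moreover have "0 < nsq f" using normalize(2)[OF f False] by (simp add: nrm_def)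
  ultimately show ?thesis by (simp add: pos_divide_le_eq)
qed

text \<open>Makes Cauchy--Schwarz available for the positive form \<open>\<lambda>f g. ip (T f) g\<close>.\<close>
lemma complex_semi_inner_T: "complex_semi_inner V (\<lambda>f g. ip (T f) g)"
proof
  show "fun_space.subspace V" by (rule V)
  show "ip (T (f + g)) h = ip (T f) h + ip (T g) h" if "f \<in> V" "g \<in> V" "h \<in> V" for f g h
    using that by (simp add: T_lin ip_add)
  show "ip (T (fscale c f)) h = c * ip (T f) h" if "f \<in> V" "h \<in> V" for c f h
    using that by (simp add: T_lin(2)[OF that] ip_scale)
  show "ip (T f) g = cnj (ip (T g) f)" if "f \<in> V" "g \<in> V" for f g
    using that by (simp add: T_selfadj ip_cnj[of f])
  show "0 \<le> Re (ip (T f) f)" if "f \<in> V" for f using quad_ge0[OF that] by (simp add: quad_def)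
qed

text \<open>Cauchy--Schwarz for the form \<open>ip (T f) g\<close>, applied to f and T f, bounds the
  fourth power of the norm of T f by \<open>quad f * quad (T f)\<close>. With m the supremum of the
  quadratic form this shows that near-maximisers are approximate eigenvectors.\<close>

lemma nsq_T: assumes f: "f \<in> V" and m: "quad (T f) \<le> m * nsq (T f)"
  shows "nsq (T f) \<le> m * quad f"
proof (cases "nsq (T f) = 0")
  case True
  then have "T f = 0" using f nsq_eq0 by simp
  then show ?thesis using True f by (simp add: quad_def)
next
  case False
  then have p: "nsq (T f) > 0" using nsq_ge0[of "T f"] f by simp
  have "(cmod (ip (T f) (T f)))\<^sup>2 \<le> quad f * quad (T f)"
    using complex_semi_inner.cauchy_schwarz_sq[OF complex_semi_inner_T, of f "T f"] f by (simp add: complex_semi_inner.nsq_def[OF complex_semi_inner_T] quad_def)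
  also have "\<dots> \<le> quad f * (m * nsq (T f))" by (intro mult_left_mono m quad_ge0 f)
  finally have "nsq (T f) * nsq (T f) \<le> (m * quad f) * nsq (T f)"
    using f by (simp add: ip_self power2_eq_square mult_ac)
  then show ?thesis using p by simp
qed

text \<open>The functions x \<mapsto> \<open>ip (f n) (k x)\<close> are uniformly bounded and
  equicontinuous, so a subsequence converges uniformly to some u, and the vector that
  \<open>synth\<close> attaches to u is the norm limit of T along it: the squared norm of the
  difference g is the integral of the small factor \<open>ip (f (r n)) (k x) - u x\<close> against
  the conjugate of \<open>ip g (k x)\<close>, which is at most C times the norm of g.\<close>

lemma compact_T: assumes f: "\<And>n::nat. f n \<in> V" and b: "\<And>n. nsq (f n) \<le> 1"
  shows "\<exists>g\<in>V. \<exists>r. strict_mono r \<and> (\<lambda>n. nrm (T (f (r n)) - g)) \<longlonglongrightarrow> 0"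
proof -
  obtain C where C: "C \<ge> 0" "\<And>x. x \<in> S \<Longrightarrow> nrm (k x) \<le> C" using nrm_k_bound by auto
  have b': "nrm (f n) \<le> 1" for n using b[of n] by (simp add: nrm_def)
  have bd: "cmod (ip (f n) h) \<le> nrm h" if "h \<in> V" for n h
    using cauchy_schwarz[OF f that, of n] mult_right_mono[OF b' nrm_ge0[OF that], of n] by simp
  obtain u and r :: "nat \<Rightarrow> nat" where u: "continuous_on S u" and r: "strict_mono r"
    and ur: "\<And>e. 0 < e \<Longrightarrow> \<exists>N. \<forall>n x. n \<ge> N \<and> x \<in> S \<longrightarrow> norm (ip (f (r n)) (k x) - u x) < e"
  proof (rule Arzela_Ascoli[OF S, of "\<lambda>n x. ip (f n) (k x)" C])
    show "cmod (ip (f n) (k x)) \<le> C" if "x \<in> S" for n x using bd[of "k x" n] C(2)[OF that] that by simp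
    show "\<exists>d>0. \<forall>n y. y \<in> S \<and> norm (x - y) < d \<longrightarrow> cmod (ip (f n) (k x) - ip (f n) (k y)) < e"
      if x: "x \<in> S" and e: "0 < e" for x e
    proof -
      obtain d where d: "d > 0" "\<And>y. y \<in> S \<Longrightarrow> dist y x < d \<Longrightarrow> nrm (k y - k x) < e"
        using k_cont[OF x e] by auto
      have "cmod (ip (f n) (k x) - ip (f n) (k y)) < e" if y: "y \<in> S" "norm (x - y) < d" for n y
      proof -
        have "cmod (ip (f n) (k x) - ip (f n) (k y)) = cmod (ip (f n) (k x - k y))"
          using x y f by (simp add: ip_diff_right)
        also have "\<dots> \<le> nrm (k x - k y)" by (rule bd) (use x y in simp)
        also have "\<dots> < e" using d(2)[of y] x y nrm_diff_commute[of "k x" "k y"]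
          by (simp add: dist_norm norm_minus_commute)
        finally show ?thesis .
      qed
      then show ?thesis using d(1) by blast
    qed
  qed (blast intro: that)
  obtain s where s: "s \<in> V" "\<And>g. g \<in> V \<Longrightarrow> ip s g = (LINT x|M. u x * cnj (ip g (k x)))" using synth[OF u] by auto
  define m where "m = measure M S"
  have lim: "(\<lambda>n. nrm (T (f (r n)) - s)) \<longlonglongrightarrow> 0"
  proof (rule LIMSEQ_I)
    fix e :: real assume e: "0 < e"
    \<comment> \<open>Chosen so that \<open>e' * (C * m) < e\<close>; the added 1 covers the case
      \<open>C * m = 0\<close>.\<close>
    define e' where "e' = e / (C * m + 1)"
    have m0: "0 \<le> C * m" using C(1) by (simp add: m_def)
    have e': "e' > 0" using e m0 by (simp add: e'_def add_nonneg_pos)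
    obtain N where N: "\<And>n x. n \<ge> N \<Longrightarrow> x \<in> S \<Longrightarrow> cmod (ip (f (r n)) (k x) - u x) < e'"
      using ur[OF e'] by blast
    have "nrm (T (f (r n)) - s) < e" if n: "n \<ge> N" for n
    proof -
      let ?g = "T (f (r n)) - s"
      have g: "?g \<in> V" using f s by simp
      have ic: "integrable M (\<lambda>x. ip (f (r n)) (k x) * cnj (ip ?g (k x)))"
               "integrable M (\<lambda>x. u x * cnj (ip ?g (k x)))"
        using f g u by (auto intro!: integrable_cont continuous_intros cont_ip)
      have "ip ?g ?g = (LINT x|M. ip (f (r n)) (k x) * cnj (ip ?g (k x))) - (LINT x|M. u x * cnj (ip ?g (k x)))"
        using f s g by (subst ip_diff) (auto simp: T_ip)
      also have "\<dots> = (LINT x|M. (ip (f (r n)) (k x) - u x) * cnj (ip ?g (k x)))"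
        using ic by (simp add: left_diff_distrib)
      finally have "nsq ?g = cmod (LINT x|M. (ip (f (r n)) (k x) - u x) * cnj (ip ?g (k x)))"
        using ip_self[OF g] nsq_ge0[OF g] by (metis abs_of_nonneg norm_of_real)
      also have "\<dots> \<le> (LINT x|M. e' * (nrm ?g * C))"
      proof (rule Bochner_Integration.integral_norm_bound_integral)
        show "integrable M (\<lambda>x. (ip (f (r n)) (k x) - u x) * cnj (ip ?g (k x)))"
          using f g u by (auto intro!: integrable_cont continuous_intros cont_ip)
        fix x assume "x \<in> space M"
        then have x: "x \<in> S" using space_M by simp
        have "cmod (ip ?g (k x)) \<le> nrm ?g * C"
          using cauchy_schwarz[OF g, of "k x"] x C(2)[OF x] nrm_ge0[OF g]
          by (smt (verit) k_V mult_left_mono)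
        then show "cmod ((ip (f (r n)) (k x) - u x) * cnj (ip ?g (k x))) \<le> e' * (nrm ?g * C)"
          unfolding norm_mult complex_mod_cnj
          using N[OF n x] e' by (intro mult_mono) auto
      qed simp
      also have "\<dots> = e' * (C * m) * nrm ?g" by (simp add: space_M m_def)
      finally have *: "nrm ?g * nrm ?g \<le> e' * (C * m) * nrm ?g"
        using nrm_sq[OF g] by (simp add: power2_eq_square)
      have "nrm ?g \<le> e' * (C * m)"
      proof (cases "nrm ?g = 0")
        case True then show ?thesis using e' m0 by simp
      next
        case False then have "nrm ?g > 0" using nrm_ge0[OF g] by simp
        then show ?thesis using * by simp
      qed
      also have "\<dots> < e" using e m0 by (simp add: e'_def field_simps add_nonneg_pos)
      finally show ?thesis .
    qed
    then show "\<exists>no. \<forall>n\<ge>no. norm (nrm (T (f (r n)) - s) - 0) < e"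
      using nrm_ge0 f s by (intro exI[of _ N]) (auto simp: abs_of_nonneg)
  qed
  show ?thesis using s(1) r lim by blast
qed

end

section \<open>Spectral decomposition\<close>

context compact_frame
begin

text \<open>The Rayleigh quotient is maximised on the orthogonal complement W of F. Its supremum m
  exceeds \<epsilon> because of f, and compactness makes it attained: a maximising sequence consists
  of approximate eigenvectors, and m > 0 lets convergence of its image under T be pulled back to the
  sequence.\<close>

lemma eigenvector_exists:
  assumes F: "orthonormal F" "\<And>e. e \<in> F \<Longrightarrow> \<exists>c. T e = fscale c e" and \<epsilon>: "0 \<le> \<epsilon>"
    and f: "f \<in> V" "\<And>e. e \<in> F \<Longrightarrow> ip f e = 0" "quad f > \<epsilon> * nsq f"
  shows "\<exists>h\<in>V. \<exists>m>\<epsilon>. (\<forall>e\<in>F. ip h e = 0) \<and> nsq h = 1 \<and> T h = fscale (of_real m) h"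
proof -
  define W where "W = {g \<in> V. \<forall>e\<in>F. ip g e = 0}"
  have WV: "g \<in> V" if "g \<in> W" for g using that by (simp add: W_def)
  have eV: "e \<in> V" if "e \<in> F" for e using onsD(2)[OF F(1) that] .
  \<comment> \<open>W is invariant because F consists of eigenvectors and T is self-adjoint.\<close>
  have TW: "T g \<in> W" if g: "g \<in> W" for g
    unfolding W_def
  proof (intro CollectI conjI ballI)
    show "T g \<in> V" using WV[OF g] by simp
    fix e assume e: "e \<in> F"
    obtain c where c: "T e = fscale c e" using F(2)[OF e] by auto
    have "ip (T g) e = ip g (T e)" using WV[OF g] eV[OF e] by (rule T_selfadj)
    also have "\<dots> = 0" using c g e WV[OF g] eV[OF e] by (simp add: ip_scale_right W_def)
    finally show "ip (T g) e = 0" .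
  qed
  have f0: "f \<noteq> 0"
    using f(3) by (auto simp: quad_def nsq_def)
  define Q where "Q = quad ` {g \<in> W. nsq g = 1}"
  define g0 where "g0 = fscale (of_real (1 / nrm f)) f"
  have g0: "g0 \<in> W" "nsq g0 = 1"
    using normalize(1)[OF f(1) f0] f by (auto simp: W_def g0_def ip_scale eV)
  have qg0: "quad g0 > \<epsilon>"
  proof -
    have "quad g0 = quad f / nsq f" unfolding g0_def using f nrm_sq[OF f(1)] by (simp add: quad_scale norm_divide power_divide)
    moreover have "nsq f > 0" using normalize(2)[OF f(1) f0] nrm_sq[OF f(1)] by (metis zero_less_power)
    ultimately show ?thesis using f(3) by (simp add: pos_less_divide_eq)
  qed
  have Qne: "Q \<noteq> {}" using g0 by (auto simp: Q_def)
  have Qb: "bdd_above Q" 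
  proof (rule bdd_aboveI[of _ kernel_trace])
    fix y assume "y \<in> Q"
    then obtain g where "g \<in> W" "nsq g = 1" "y = quad g" by (auto simp: Q_def)
    then show "y \<le> kernel_trace" using quad_le[of g] WV[of g] by simp
  qed
  define m where "m = Sup Q"
  have m: "m > \<epsilon>" using cSup_upper[OF _ Qb, of "quad g0"] qg0 g0 by (auto simp: Q_def m_def)
  have m0: "m > 0" using m \<epsilon> by simp
  have qW: "quad g \<le> m * nsq g" if g: "g \<in> W" for g
  proof (cases "g = 0")
    case True then show ?thesis by (simp add: quad_def nsq_def)
  next
    case False
    let ?g = "fscale (of_real (1 / nrm g)) g"
    have gV: "g \<in> V" using WV g by simp
    have "?g \<in> W" using g gV by (auto simp: W_def ip_scale eV)
    then have "quad ?g \<le> m" unfolding m_def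
      using normalize(1)[OF gV False] by (intro cSup_upper[OF _ Qb]) (auto simp: Q_def)
    then have "quad g / nsq g \<le> m" using nrm_sq[OF gV] gV by (simp add: quad_scale norm_divide power_divide)
    moreover have "0 < nsq g" using normalize(2)[OF gV False] by (simp add: nrm_def)
    ultimately show ?thesis by (simp add: pos_divide_le_eq)
  qed
  have "\<exists>g\<in>W. nsq g = 1 \<and> m - 1 / real (Suc n) < quad g" for n
  proof -
    have "m - 1 / real (Suc n) < Sup Q" by (simp add: m_def)
    then show ?thesis unfolding less_cSup_iff[OF Qne Qb] by (auto simp: Q_def)
  qed
  then obtain g where g: "\<And>n. g n \<in> W" "\<And>n. nsq (g n) = 1" "\<And>n. m - 1 / real (Suc n) < quad (g n)"
    by metis
  have gV[simp]: "g n \<in> V" for n using g WV by simp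
  obtain h0 r where h0: "h0 \<in> V" and r: "strict_mono r" and lim: "(\<lambda>n. nrm (T (g (r n)) - h0)) \<longlonglongrightarrow> 0"
    using compact_T[of g] g by auto
  \<comment> \<open>For a unit vector g the square expands to
    \<open>nsq (T g) - 2 * m * quad g + m\<^sup>2\<close>; by \<open>nsq_T\<close> the first term is
    at most \<open>m * quad g\<close>, which leaves \<open>m * (m - quad g)\<close>.\<close>
  have resid: "nsq (T (g n) - fscale (of_real m) (g n)) \<le> m * (1 / real (Suc n))" for n
  proof -
    have "nsq (T (g n) - fscale (of_real m) (g n)) = nsq (T (g n)) - 2 * (m * quad (g n)) + m\<^sup>2"
      using g(2)[of n] by (simp add: nsq_diff nsq_scale ip_scale_right quad_def)
    also have "\<dots> \<le> m * quad (g n) - 2 * (m * quad (g n)) + m\<^sup>2"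
      using nsq_T[OF gV qW[OF TW[OF g(1)]], of n] by simp
    also have "\<dots> = m * (m - quad (g n))" by (simp add: power2_eq_square algebra_simps)
    also have "\<dots> \<le> m * (1 / real (Suc n))" using g(3)[of n] m0 by (intro mult_left_mono) auto
    finally show ?thesis .
  qed
  have r1: "(\<lambda>n. nrm (T (g n) - fscale (of_real m) (g n))) \<longlonglongrightarrow> 0"
  proof (rule tendsto_sandwich[OF _ _ tendsto_const])
    show "\<forall>\<^sub>F n in sequentially. 0 \<le> nrm (T (g n) - fscale (of_real m) (g n))"
      by (intro always_eventually allI nrm_ge0) simp
    show "\<forall>\<^sub>F n in sequentially. nrm (T (g n) - fscale (of_real m) (g n)) \<le> sqrt (m * (1 / real (Suc n)))"
      unfolding nrm_def using resid by (intro always_eventually allI real_sqrt_le_mono) 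
    have "(\<lambda>n. sqrt (m * (1 / real (Suc n)))) \<longlonglongrightarrow> sqrt (m * 0)"
      by (intro tendsto_intros LIMSEQ_Suc[OF lim_1_over_n])
    then show "(\<lambda>n. sqrt (m * (1 / real (Suc n)))) \<longlonglongrightarrow> 0" by simp
  qed
  \<comment> \<open>T g tends to h0 along the subsequence while T g - m g tends to 0, so h0 / m is
    the only possible limit of g.\<close>
  define h where "h = fscale (of_real (1/m)) h0"
  have hV[simp]: "h \<in> V" using h0 by (simp add: h_def)
  have mh: "h0 = fscale (of_real m) h" using m0 by (simp add: h_def fscale_def fun_eq_iff)
  have lim_h: "(\<lambda>n. nrm (g (r n) - h)) \<longlonglongrightarrow> 0"
  proof (rule tendsto_sandwich[OF _ _ tendsto_const])
    show "\<forall>\<^sub>F n in sequentially. 0 \<le> nrm (g (r n) - h)" by (intro always_eventually allI nrm_ge0) simp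
    let ?b = "\<lambda>n. (1/m) * (nrm (T (g (r n)) - h0) + nrm (T (g (r n)) - fscale (of_real m) (g (r n))))"
    show "\<forall>\<^sub>F n in sequentially. nrm (g (r n) - h) \<le> ?b n"
    proof (intro always_eventually allI)
      fix n
      let ?a = "fscale (of_real m) (g (r n)) - T (g (r n))" and ?c = "T (g (r n)) - h0"
      have "g (r n) - h = fscale (of_real (1/m)) (?a + ?c)"
        using m0 by (simp add: h_def fscale_def fun_eq_iff field_simps)
      then have "nrm (g (r n) - h) = (1/m) * nrm (?a + ?c)"
        using h0 m0 by (simp add: nrm_scale norm_divide)
      also have "\<dots> \<le> (1/m) * (nrm ?a + nrm ?c)" using m0 h0 by (intro mult_left_mono nrm_add) auto
      finally show "nrm (g (r n) - h) \<le> ?b n" 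
        using nrm_diff_commute[of "T (g (r n))" "fscale (of_real m) (g (r n))"] by (simp add: add.commute)
    qed
    have "?b \<longlonglongrightarrow> (1/m) * (0 + 0)"
      using LIMSEQ_subseq_LIMSEQ[OF r1 r] by (intro tendsto_intros lim) (simp add: o_def)
    then show "?b \<longlonglongrightarrow> 0" by simp
  qed
  have ip_lim: "(\<lambda>n. ip (g (r n)) w) \<longlonglongrightarrow> ip h w" if w: "w \<in> V" for w
  proof (rule Lim_null_comparison[THEN LIM_zero_cancel])
    show "\<forall>\<^sub>F n in sequentially. norm (ip (g (r n)) w - ip h w) \<le> nrm (g (r n) - h) * nrm w"
      using w by (intro always_eventually allI) (simp add: ip_diff[symmetric] cauchy_schwarz)
    show "(\<lambda>n. nrm (g (r n) - h) * nrm w) \<longlonglongrightarrow> 0" using tendsto_mult_left_zero[OF lim_h] .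
  qed
  have ip_lim2: "(\<lambda>n. ip (T (g (r n))) w) \<longlonglongrightarrow> ip h0 w" if w: "w \<in> V" for w
  proof (rule Lim_null_comparison[THEN LIM_zero_cancel])
    show "\<forall>\<^sub>F n in sequentially. norm (ip (T (g (r n))) w - ip h0 w) \<le> nrm (T (g (r n)) - h0) * nrm w"
      using w h0 by (intro always_eventually allI) (simp add: ip_diff[symmetric] cauchy_schwarz)
    show "(\<lambda>n. nrm (T (g (r n)) - h0) * nrm w) \<longlonglongrightarrow> 0" using tendsto_mult_left_zero[OF lim] .
  qed
  \<comment> \<open>T h is identified weakly: self-adjointness moves T to the test vector w, where
    convergence of the sequence itself suffices.\<close>
  have Th: "T h = h0"
  proof (rule ip_ext)
    fix w assume w: "w \<in> V"
    have "(\<lambda>n. ip (T (g (r n))) w) \<longlonglongrightarrow> ip (T h) w"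
      using ip_lim[of "T w"] w by (simp add: T_selfadj)
    then show "ip (T h) w = ip h0 w" using ip_lim2[OF w] LIMSEQ_unique by blast
  qed (use h0 in auto)
  have "ip h e = 0" if e: "e \<in> F" for e
  proof -
    have "(\<lambda>n. ip (g (r n)) e) = (\<lambda>n. 0)" using g(1) e by (auto simp: W_def)
    then show ?thesis using ip_lim[OF eV[OF e]] LIMSEQ_unique[of "\<lambda>n. 0::complex"] by (metis tendsto_const)
  qed
  moreover have "nsq h = 1"
  proof -
    have "\<bar>nrm h - 1\<bar> \<le> nrm (g (r n) - h)" for n
    proof -
      have 1: "nrm (g (r n)) = 1" using g(2) by (simp add: nrm_def)
      have "nrm h \<le> nrm (h - g (r n)) + nrm (g (r n))" using nrm_add[of "h - g (r n)" "g (r n)"] by simp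
      moreover have "nrm (g (r n)) \<le> nrm (g (r n) - h) + nrm h" using nrm_add[of "g (r n) - h" h] by simp
      ultimately show ?thesis using nrm_diff_commute[of h "g (r n)"] 1 by simp
    qed
    then have "\<bar>nrm h - 1\<bar> \<le> 0" using lim_h LIMSEQ_le_const by blast
    then show ?thesis using nrm_sq[of h] by simp
  qed
  ultimately show ?thesis using Th mh m hV by (intro bexI[of _ h] exI[of _ m]) auto
qed

lemma espace_sub: "fun_space.subspace (espace \<mu>)"
proof -
  have "0 \<in> espace \<mu>" using T_lin(2)[of 0 0 0] by (simp add: espace_def)
  moreover have "x + y \<in> espace \<mu>" if "x \<in> espace \<mu>" "y \<in> espace \<mu>" for x y
    using that T_lin(1)[of x y] by (auto simp: espace_def fun_space.scale_right_distrib)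
  moreover have "fscale c x \<in> espace \<mu>" if "x \<in> espace \<mu>" for c x
    using that T_lin(2)[of x x] by (auto simp: espace_def mult.commute)
  ultimately show ?thesis by (auto simp: fun_space.subspace_def)
qed

lemma espace_real: assumes "f \<in> espace \<mu>" "f \<noteq> 0" shows "\<mu> = of_real (Re \<mu>)" "Re \<mu> \<ge> 0" "quad f = Re \<mu> * nsq f"
proof -
  have f: "f \<in> V" "T f = fscale \<mu> f" using assms by (auto simp: espace_def)
  have p: "nsq f > 0" using normalize(2)[OF f(1) assms(2)] by (simp add: nrm_def)
  have 1: "ip (T f) f = \<mu> * of_real (nsq f)" using f by (simp add: ip_scale ip_self)
  have "ip f (T f) = cnj \<mu> * of_real (nsq f)" using f by (simp add: ip_scale_right ip_self)
  then have 2: "ip (T f) f = cnj \<mu> * of_real (nsq f)" using T_selfadj[OF f(1) f(1)] by simp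
  have "\<mu> = cnj \<mu>" using 1 2 p by simp
  then show "\<mu> = of_real (Re \<mu>)" by (simp add: complex_eq_iff)
  show *: "quad f = Re \<mu> * nsq f" using 1 by (simp add: quad_def)
  show "Re \<mu> \<ge> 0" using quad_ge0[OF f(1)] p unfolding * by (simp add: zero_le_mult_iff)
qed

lemma espace_orth: assumes "f \<in> espace \<mu>" "g \<in> espace \<nu>" "\<mu> \<noteq> \<nu>" shows "ip f g = 0"
proof (cases "g = 0")
  case True then show ?thesis using assms by (simp add: espace_def)
next
  case False
  then have n: "cnj \<nu> = \<nu>" using espace_real(1)[OF assms(2)] by (metis complex_cnj_complex_of_real)
  have f: "f \<in> V" "T f = fscale \<mu> f" and g: "g \<in> V" "T g = fscale \<nu> g" using assms by (auto simp: espace_def)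
  have "\<mu> * ip f g = \<nu> * ip f g" using T_selfadj[OF f(1) g(1)] f g n by (simp add: ip_scale ip_scale_right)
  then show ?thesis using assms by simp
qed

lemma espace_orthonormal_quad: assumes "orthonormal B" "B \<subseteq> espace \<mu>" shows "(\<Sum>e\<in>B. quad e) = real (card B) * Re \<mu>"
proof -
  have "quad e = Re \<mu>" if e: "e \<in> B" for e
  proof -
    have "nsq e = 1" using onsD(3)[OF assms(1) e e] by (simp add: nsq_def)
    moreover from this have "e \<noteq> 0" by (auto simp: nsq_def)
    ultimately show ?thesis using espace_real(3)[of e \<mu>] assms e by auto
  qed
  then show ?thesis by simp
qed

text \<open>An orthonormal system in the eigenspace has at most
  \<open>kernel_trace / Re \<mu>\<close> members, so one of maximal size exists; it spans, since a
  nonzero residual could be normalised and added. Hence for \<mu> \<noteq> 0 the number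
  \<open>fun_space.dim\<close> is a genuine dimension and not the default value for infinite
  dimension.\<close>

lemma espace_basis: assumes \<mu>: "\<mu> \<noteq> 0"
  shows "\<exists>B. orthonormal B \<and> B \<subseteq> espace \<mu> \<and> espace \<mu> \<subseteq> fun_space.span B \<and> card B = fun_space.dim (espace \<mu>)"
proof (cases "\<exists>f\<in>espace \<mu>. f \<noteq> 0")
  case False
  have "espace \<mu> \<subseteq> fun_space.span {}" using False by auto
  moreover have "fun_space.dim (espace \<mu>) = 0" using calculation by (simp add: fun_space.dim_eq_card_independent fun_space.dim_unique[of "{}"] fun_space.independent_empty)
  ultimately show ?thesis by (intro exI[of _ "{}"]) (auto simp: orthonormal_def)
next
  case True
  then obtain f where "f \<in> espace \<mu>" "f \<noteq> 0" by auto
  then have p: "Re \<mu> > 0" using espace_real[of f \<mu>] \<mu> by (metis less_eq_real_def of_real_0)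
  define P where "P n \<longleftrightarrow> (\<exists>B. orthonormal B \<and> B \<subseteq> espace \<mu> \<and> card B = n)" for n
  have b: "n \<le> nat \<lceil>kernel_trace / Re \<mu>\<rceil>" if Pn: "P n" for n
  proof -
    obtain B where "orthonormal B" "B \<subseteq> espace \<mu>" "card B = n" using Pn P_def by auto
    then have "real n * Re \<mu> \<le> kernel_trace" using trace_bound[of B] espace_orthonormal_quad[of B] by simp
    then have "real n \<le> kernel_trace / Re \<mu>" using p by (simp add: field_simps)
    then show ?thesis by linarith
  qed
  have "P 0" unfolding P_def by (intro exI[of _ "{}"]) (auto simp: orthonormal_def)
  then obtain n where n: "P n" "\<And>m. P m \<Longrightarrow> m \<le> n" using Nat.ex_has_greatest_nat[of P 0] b by metis
  obtain B where B: "orthonormal B" "B \<subseteq> espace \<mu>" "card B = n" using n(1) P_def by auto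
  have span: "espace \<mu> \<subseteq> fun_space.span B"
  proof
    fix g assume g: "g \<in> espace \<mu>"
    then have gV: "g \<in> V" by (simp add: espace_def)
    have pE: "proj B g \<in> espace \<mu>" unfolding proj_def using B(2)
      by (intro fun_space.subspace_sum[OF espace_sub] fun_space.subspace_scale[OF espace_sub]) auto
    then have rE: "g - proj B g \<in> espace \<mu>" using g fun_space.subspace_diff[OF espace_sub] by blast
    have rV: "g - proj B g \<in> V" using rE by (simp add: espace_def)
    have "g - proj B g = 0"
    proof (rule ccontr)
      assume ne: "g - proj B g \<noteq> 0"
      let ?e = "fscale (of_real (1 / nrm (g - proj B g))) (g - proj B g)"
      have eE: "?e \<in> espace \<mu>" by (rule fun_space.subspace_scale[OF espace_sub rE])
      have eV: "?e \<in> V" using eE by (simp add: espace_def)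
      have o: "ip ?e e = 0" if "e \<in> B" for e
        using proj_orth[OF B(1) gV that] rV onsD(2)[OF B(1) that] by (simp add: ip_scale)
      note i = orthonormal_insert[OF B(1) eV normalize(1)[OF rV ne] o]
      have "P (Suc n)" unfolding P_def
        using i B eE onsD(1)[OF B(1)] by (intro exI[of _ "insert ?e B"]) auto
      then show False using n(2) by fastforce
    qed
    then have "g = proj B g" by simp
    then show "g \<in> fun_space.span B" using proj_in_span by metis
  qed
  have "fun_space.dim (espace \<mu>) = n" by (rule fun_space.dim_unique[OF B(2) span orthonormal_independent[OF B(1)] B(3)])
  then show ?thesis using B span by auto
qed

end

section \<open>The trace formula\<close>

context compact_frame
begin

lemma span_orth: assumes B: "orthonormal B" and h: "h \<in> V" "h \<in> fun_space.span B" "\<And>e. e \<in> B \<Longrightarrow> ip h e = 0"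
  shows "h = 0"
proof -
  obtain u where u: "h = (\<Sum>v\<in>B. fscale (u v) v)"
    using h(2) unfolding fun_space.span_finite[OF onsD(1)[OF B]] by auto
  have "ip h h = (\<Sum>v\<in>B. u v * ip v h)"
    by (subst (1) u, subst ip_sum) (use onsD(2)[OF B] h(1) in \<open>auto simp: ip_scale\<close>)
  also have "\<dots> = 0" using h onsD(2)[OF B] ip_cnj[of _ h] by (intro sum.neutral) auto
  finally show ?thesis by (rule ip_eq0[OF h(1)])
qed

definition spec :: "complex set" where "spec = {\<mu>. \<exists>f\<in>espace \<mu>. f \<noteq> 0}"
definition eigenbasis :: "complex \<Rightarrow> (real \<Rightarrow> complex) set" where
  "eigenbasis \<mu> = (SOME B. orthonormal B \<and> B \<subseteq> espace \<mu> \<and> espace \<mu> \<subseteq> fun_space.span B \<and> card B = fun_space.dim (espace \<mu>))"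
definition weighted_mult :: "complex \<Rightarrow> real" where "weighted_mult \<mu> = real (fun_space.dim (espace \<mu>)) * Re \<mu>"

lemma eigenbasis: assumes "\<mu> \<noteq> 0"
  shows "orthonormal (eigenbasis \<mu>)" "eigenbasis \<mu> \<subseteq> espace \<mu>" "espace \<mu> \<subseteq> fun_space.span (eigenbasis \<mu>)" "card (eigenbasis \<mu>) = fun_space.dim (espace \<mu>)"
  using someI_ex[OF espace_basis[OF assms]] unfolding eigenbasis_def[symmetric] by auto

lemma spec_real: assumes "\<mu> \<in> spec" shows "\<mu> = of_real (Re \<mu>)" "Re \<mu> \<ge> 0"
  using espace_real assms unfolding spec_def by blast+

text \<open>Eigenspaces of different eigenvalues are orthogonal, so bases of finitely many of them
  stay orthonormal and disjoint when united; a common vector would have squared norm both 0 and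
  1.\<close>

lemma spectral_basis_orthonormal: assumes "finite L" "0 \<notin> L"
  shows "orthonormal (\<Union>\<mu>\<in>L. eigenbasis \<mu>)" "(\<Sum>e\<in>(\<Union>\<mu>\<in>L. eigenbasis \<mu>). quad e) = (\<Sum>\<mu>\<in>L. weighted_mult \<mu>)"
proof -
  have n: "\<mu> \<noteq> 0" if "\<mu> \<in> L" for \<mu> using assms that by metis
  have o: "ip e e' = 0" if "e \<in> eigenbasis \<mu>" "e' \<in> eigenbasis \<nu>" "\<mu> \<in> L" "\<nu> \<in> L" "\<mu> \<noteq> \<nu>" for e e' \<mu> \<nu>
    using eigenbasis(2)[OF n] that espace_orth by blast
  have one: "ip e e = 1" if "e \<in> eigenbasis \<mu>" "\<mu> \<in> L" for e \<mu>
    using onsD(3)[OF eigenbasis(1)[OF n[OF that(2)]] that(1) that(1)] by simp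
  have ip01: "ip e e' = (if e = e' then 1 else 0)" if e: "e \<in> eigenbasis \<mu>" "e' \<in> eigenbasis \<nu>" "\<mu> \<in> L" "\<nu> \<in> L" for e e' \<mu> \<nu>
  proof (cases "\<mu> = \<nu>")
    case True then show ?thesis using onsD(3)[OF eigenbasis(1)[OF n]] e by blast
  next
    case False
    then show ?thesis using o[OF e False] one[OF e(1,3)] by auto
  qed
  have sub: "eigenbasis \<mu> \<subseteq> V" "finite (eigenbasis \<mu>)" if "\<mu> \<in> L" for \<mu>
    using onsD(1,2)[OF eigenbasis(1)[OF n[OF that]]] by auto
  show "orthonormal (\<Union>\<mu>\<in>L. eigenbasis \<mu>)"
    unfolding orthonormal_def
  proof (intro conjI ballI)
    show "finite (\<Union>\<mu>\<in>L. eigenbasis \<mu>)" "(\<Union>\<mu>\<in>L. eigenbasis \<mu>) \<subseteq> V" using sub assms(1) by auto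
    show "ip e e' = (if e = e' then 1 else 0)" if "e \<in> (\<Union>\<mu>\<in>L. eigenbasis \<mu>)" "e' \<in> (\<Union>\<mu>\<in>L. eigenbasis \<mu>)" for e e'
      using ip01 that by blast
  qed
  have "(\<Sum>e\<in>(\<Union>\<mu>\<in>L. eigenbasis \<mu>). quad e) = (\<Sum>\<mu>\<in>L. \<Sum>e\<in>eigenbasis \<mu>. quad e)"
  proof (rule sum.UNION_disjoint)
    show "\<forall>i\<in>L. \<forall>j\<in>L. i \<noteq> j \<longrightarrow> eigenbasis i \<inter> eigenbasis j = {}"
      using o one by (metis disjoint_iff zero_neq_one)
  qed (use assms sub in auto)
  also have "\<dots> = (\<Sum>\<mu>\<in>L. weighted_mult \<mu>)"
    using espace_orthonormal_quad[OF eigenbasis(1,2)] n eigenbasis(4) by (intro sum.cong) (auto simp: weighted_mult_def)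
  finally show "(\<Sum>e\<in>(\<Union>\<mu>\<in>L. eigenbasis \<mu>). quad e) = (\<Sum>\<mu>\<in>L. weighted_mult \<mu>)" .
qed

lemma weighted_mult_bound: assumes "finite L" shows "(\<Sum>\<mu>\<in>L. weighted_mult \<mu>) \<le> kernel_trace"
proof -
  \<comment> \<open>The eigenvalue 0 contributes 0 whatever value \<open>fun_space.dim\<close> takes
    on its eigenspace.\<close>
  have "(\<Sum>\<mu>\<in>L. weighted_mult \<mu>) = (\<Sum>\<mu>\<in>L - {0}. weighted_mult \<mu>)"
    using assms by (intro sum.mono_neutral_right) (auto simp: weighted_mult_def)
  also have "\<dots> \<le> kernel_trace" using spectral_basis_orthonormal[of "L - {0}"] trace_bound assms by (metis Diff_iff finite_Diff insertI1)
  finally show ?thesis .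
qed

lemma weighted_mult_ge0: "\<mu> \<in> spec \<Longrightarrow> 0 \<le> weighted_mult \<mu>"
  using spec_real by (simp add: weighted_mult_def)

lemma weighted_mult_ge: assumes "\<mu> \<in> spec" "Re \<mu> > 0" shows "Re \<mu> \<le> weighted_mult \<mu>"
proof -
  have n: "\<mu> \<noteq> 0" using assms by auto
  have "eigenbasis \<mu> \<noteq> {}" using assms(1) eigenbasis(3)[OF n] by (auto simp: spec_def)
  then have "card (eigenbasis \<mu>) \<ge> 1" using onsD(1)[OF eigenbasis(1)[OF n]] by (simp add: card_gt_0_iff Suc_leI)
  then have "1 \<le> real (fun_space.dim (espace \<mu>))" using eigenbasis(4)[OF n] by simp
  then show ?thesis unfolding weighted_mult_def using mult_right_mono[of 1 _ "Re \<mu>"] assms by simp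
qed

definition upper_spec :: "real \<Rightarrow> complex set" where "upper_spec \<epsilon> = {\<mu>\<in>spec. \<epsilon> \<le> Re \<mu>}"
definition spectral_basis :: "real \<Rightarrow> (real \<Rightarrow> complex) set" where "spectral_basis \<epsilon> = (\<Union>\<mu>\<in>upper_spec \<epsilon>. eigenbasis \<mu>)"

text \<open>Each such eigenvalue contributes at least \<epsilon> to a sum bounded by
  \<open>kernel_trace\<close>, which limits their number.\<close>

lemma finite_upper_spec: assumes \<epsilon>: "\<epsilon> > 0" shows "finite (upper_spec \<epsilon>)"
proof -
  have "card F \<le> nat \<lceil>kernel_trace / \<epsilon>\<rceil>" if F: "F \<subseteq> upper_spec \<epsilon>" "finite F" for F
  proof -
    have "real (card F) * \<epsilon> \<le> (\<Sum>\<mu>\<in>F. weighted_mult \<mu>)"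
    proof -
      have "\<epsilon> \<le> weighted_mult \<mu>" if "\<mu> \<in> F" for \<mu> using weighted_mult_ge[of \<mu>] that F(1) \<epsilon> by (auto simp: upper_spec_def)
      then have "(\<Sum>\<mu>\<in>F. \<epsilon>) \<le> (\<Sum>\<mu>\<in>F. weighted_mult \<mu>)" by (rule sum_mono)
      then show ?thesis by simp
    qed
    also have "\<dots> \<le> kernel_trace" by (rule weighted_mult_bound[OF F(2)])
    finally have "real (card F) \<le> kernel_trace / \<epsilon>" using \<epsilon> by (simp add: field_simps)
    then show ?thesis by linarith
  qed
  then show ?thesis using finite_if_finite_subsets_card_bdd by blast
qed

lemma upper_spec_0: "\<epsilon> > 0 \<Longrightarrow> 0 \<notin> upper_spec \<epsilon>"
  by (simp add: upper_spec_def)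

lemma spectral_basis_on: assumes "\<epsilon> > 0" shows "orthonormal (spectral_basis \<epsilon>)" "(\<Sum>e\<in>spectral_basis \<epsilon>. quad e) = (\<Sum>\<mu>\<in>upper_spec \<epsilon>. weighted_mult \<mu>)"
  using spectral_basis_orthonormal[OF finite_upper_spec upper_spec_0] assms by (simp_all add: spectral_basis_def)

text \<open>Otherwise \<open>eigenvector_exists\<close> yields a unit eigenvector h with eigenvalue
  above \<epsilon>, orthogonal to \<open>spectral_basis \<epsilon>\<close>. That eigenvalue lies in
  \<open>upper_spec \<epsilon>\<close>, so h is also in the span of this basis, hence 0.\<close>

lemma quad_orth: assumes \<epsilon>: "\<epsilon> > 0" and f: "f \<in> V" "\<And>e. e \<in> spectral_basis \<epsilon> \<Longrightarrow> ip f e = 0"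
  shows "quad f \<le> \<epsilon> * nsq f"
proof (rule ccontr)
  assume n: "\<not> quad f \<le> \<epsilon> * nsq f"
  have ev: "\<exists>c. T e = fscale c e" if "e \<in> spectral_basis \<epsilon>" for e
  proof -
    obtain \<mu> where "\<mu> \<in> upper_spec \<epsilon>" "e \<in> eigenbasis \<mu>" using \<open>e \<in> spectral_basis \<epsilon>\<close> by (auto simp: spectral_basis_def)
    then have "e \<in> espace \<mu>" using eigenbasis(2)[of \<mu>] upper_spec_0[OF \<epsilon>] by auto
    then show ?thesis by (auto simp: espace_def)
  qed
  obtain h m where h: "h \<in> V" "m > \<epsilon>" "\<And>e. e \<in> spectral_basis \<epsilon> \<Longrightarrow> ip h e = 0" "nsq h = 1" "T h = fscale (of_real m) h"
    using eigenvector_exists[OF spectral_basis_on(1)[OF \<epsilon>] ev less_imp_le[OF \<epsilon>] f] n by (auto simp: not_le)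
  have hE: "h \<in> espace (of_real m)" using h by (simp add: espace_def)
  have h0: "h \<noteq> 0" using h(4) by (auto simp: nsq_def)
  have m: "complex_of_real m \<in> upper_spec \<epsilon>" using hE h0 h(2) by (auto simp: upper_spec_def spec_def)
  have m0: "complex_of_real m \<noteq> 0" using h(2) \<epsilon> by simp
  have "h = 0"
  proof (rule span_orth[OF eigenbasis(1)[OF m0] h(1)])
    show "h \<in> fun_space.span (eigenbasis (complex_of_real m))" using eigenbasis(3)[OF m0] hE by auto
    show "ip h e = 0" if "e \<in> eigenbasis (complex_of_real m)" for e using h(3) m that by (auto simp: spectral_basis_def)
  qed
  then show False using h0 by simp
qed

text \<open>If the residual r had squared norm at least e, then |\<open>ip r (k y)\<close>| would be
  at least e / 2 for all y in a ball around x whose radius does not depend on n, so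
  \<open>quad r\<close> would stay above a positive constant; but \<open>quad_orth\<close> forces it
  below \<open>nsq (k x) / (n + 1)\<close>.\<close>

lemma residual_tendsto_0:
  assumes x: "x \<in> S"
  shows "(\<lambda>n. nsq (k x - proj (spectral_basis (1 / real (Suc n))) (k x))) \<longlonglongrightarrow> 0"
proof (rule LIMSEQ_I)
  fix e :: real assume e: "0 < e"
  define r where "r n = k x - proj (spectral_basis (1 / real (Suc n))) (k x)" for n
  have o: "orthonormal (spectral_basis (1 / real (Suc n)))" for n by (rule spectral_basis_on) simp
  have rV[simp]: "r n \<in> V" for n using proj_V[OF o] x by (simp add: r_def)
  define D where "D = nsq (k x)"
  have rD: "nsq (r n) \<le> D" for n
    using nsq_proj_residual(1)[OF o, of "k x" n] x by (simp add: r_def D_def sum_nonneg)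
  have D0: "D \<ge> 0" using nsq_ge0 x by (simp add: D_def)
  have qr: "quad (r n) \<le> D / real (Suc n)" for n
  proof -
    have "quad (r n) \<le> 1 / real (Suc n) * nsq (r n)"
    proof (rule quad_orth)
      show "ip (r n) e = 0" if "e \<in> spectral_basis (1 / real (Suc n))" for e
        unfolding r_def by (rule proj_orth[OF o k_V[OF x] that])
    qed simp_all
    also have "\<dots> \<le> 1 / real (Suc n) * D" by (intro mult_left_mono rD) simp
    finally show ?thesis by simp
  qed
  \<comment> \<open>The norm of r is at most that of k x, so this \<eta> keeps
    \<open>ip r (k y - k x)\<close> within e / 2; the added 1 avoids division by 0.\<close>
  define \<eta> where "\<eta> = e / (2 * (nrm (k x) + 1))"
  have n1: "0 < nrm (k x) + 1" using nrm_ge0[of "k x"] x by simp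
  have half: "a * (e / (2 * a)) = e / 2" if "0 < a" for a :: real using that by simp
  have "\<eta> > 0" using e n1 by (simp add: \<eta>_def)
  then obtain \<delta> where \<delta>: "\<delta> > 0" "\<And>y. y \<in> S \<Longrightarrow> dist y x < \<delta> \<Longrightarrow> nrm (k y - k x) < \<eta>"
    using k_cont[OF x] by blast
  define A where "A = S \<inter> ball x \<delta>"
  have A: "A \<in> sets M" unfolding sets_M A_def sets_restrict_space by auto
  define c where "c = measure M A"
  have c: "c > 0" using supp[OF x \<delta>(1)] by (simp add: c_def A_def)
  have low: "(e/2)\<^sup>2 * c \<le> quad (r n)" if d: "e \<le> nsq (r n)" for n
  proof -
    have "(e/2)\<^sup>2 * c = (LINT y|M. (e/2)\<^sup>2 * indicator A y)"
      using A sets.sets_into_space[OF A] by (simp add: c_def Int_absorb2)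
    also have "\<dots> \<le> (LINT y|M. (cmod (ip (r n) (k y)))\<^sup>2)"
    proof (rule integral_mono)
      show "integrable M (\<lambda>y. (e/2)\<^sup>2 * indicator A y :: real)"
        by (intro integrable_mult_right integrable_real_indicator A) (simp add: less_top[symmetric])
      show "integrable M (\<lambda>y. (cmod (ip (r n) (k y)))\<^sup>2)" by (intro integrable_cont continuous_intros cont_ip) simp
      fix y assume "y \<in> space M"
      show "(e/2)\<^sup>2 * indicator A y \<le> (cmod (ip (r n) (k y)))\<^sup>2"
      proof (cases "y \<in> A")
        case True
        then have y: "y \<in> S" "dist y x < \<delta>" by (auto simp: A_def dist_commute)
        have rr: "ip (r n) (k x) = of_real (nsq (r n))"
          using nsq_proj_residual(2)[OF o, of "k x"] x by (simp add: r_def)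
        have rn: "nrm (r n) \<le> nrm (k x)" using rD[of n] by (simp add: nrm_def D_def)
        have "cmod (ip (r n) (k y - k x)) \<le> nrm (r n) * nrm (k y - k x)"
          using x y by (intro cauchy_schwarz) auto
        also have "\<dots> \<le> (nrm (k x) + 1) * \<eta>"
          using rn \<delta>(2)[OF y] nrm_ge0[of "r n"] nrm_ge0[of "k y - k x"] x y
          by (intro mult_mono) auto
        also have "\<dots> = e / 2" unfolding \<eta>_def by (rule half[OF n1])
        finally have 1: "cmod (ip (r n) (k y - k x)) \<le> e / 2" .
        have "nsq (r n) = cmod (ip (r n) (k x))" using rr nsq_ge0[of "r n"] by simp
        also have "\<dots> = cmod (ip (r n) (k y) - ip (r n) (k y - k x))" using x y by (simp add: ip_diff_right)
        also have "\<dots> \<le> cmod (ip (r n) (k y)) + cmod (ip (r n) (k y - k x))" by (rule norm_triangle_ineq4)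
        finally have "e / 2 \<le> cmod (ip (r n) (k y))" using 1 d by simp
        then show ?thesis using True e by (simp add: power_mono)
      qed simp
    qed
    finally show ?thesis by (simp add: quad_eq)
  qed
  have "(\<lambda>n. D / real (Suc n)) \<longlonglongrightarrow> 0"
    using LIMSEQ_Suc[OF lim_const_over_n[of D]] by simp
  moreover have "0 < (e/2)\<^sup>2 * c" using e c by simp
  ultimately have "\<forall>\<^sub>F n in sequentially. D / real (Suc n) < (e/2)\<^sup>2 * c" by (rule order_tendstoD(2))
  then obtain N where N: "\<And>n. n \<ge> N \<Longrightarrow> D / real (Suc n) < (e/2)\<^sup>2 * c"
    unfolding eventually_sequentially by auto
  have "norm (nsq (r n) - 0) < e" if "n \<ge> N" for n
  proof -
    have "\<not> e \<le> nsq (r n)" using low[of n] qr[of n] N[OF that] by linarith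
    then show ?thesis using nsq_ge0[of "r n"] by simp
  qed
  then show "\<exists>no. \<forall>n\<ge>no. norm (nsq (k x - proj (spectral_basis (1 / real (Suc n))) (k x)) - 0) < e"
    unfolding r_def by blast
qed

text \<open>A truncated trace is the integral of \<open>nsq (k x)\<close> minus the squared norm of
  the residual. The integrand lies between 0 and \<open>nsq (k x)\<close>, so pointwise convergence
  passes to the integrals by domination.\<close>

lemma partial_traces_tendsto: "(\<lambda>n. \<Sum>\<mu>\<in>upper_spec (1 / real (Suc n)). weighted_mult \<mu>) \<longlonglongrightarrow> kernel_trace"
proof -
  let ?spectral_basis = "\<lambda>n. spectral_basis (1 / real (Suc n))"
  have o: "orthonormal (?spectral_basis n)" for n by (rule spectral_basis_on) simp
  have i: "integrable M (\<lambda>x. (cmod (ip e (k x)))\<^sup>2)" if "e \<in> ?spectral_basis n" for e n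
    using onsD(2)[OF o that] by (intro integrable_cont continuous_intros cont_ip)
  let ?A = "\<lambda>n x. \<Sum>e\<in>?spectral_basis n. (cmod (ip e (k x)))\<^sup>2"
  have A: "?A n x = nsq (k x) - nsq (k x - proj (?spectral_basis n) (k x))" if x: "x \<in> S" for n x
  proof -
    have "?A n x = (\<Sum>e\<in>?spectral_basis n. (cmod (ip (k x) e))\<^sup>2)"
      using onsD(2)[OF o] x ip_cnj[of _ "k x"] by (intro sum.cong) auto
    then show ?thesis using nsq_proj_residual(1)[OF o, of "k x"] x by simp
  qed
  have eq: "(\<Sum>\<mu>\<in>upper_spec (1 / real (Suc n)). weighted_mult \<mu>) = (LINT x|M. ?A n x)" for n
  proof -
    have "(\<Sum>\<mu>\<in>upper_spec (1 / real (Suc n)). weighted_mult \<mu>) = (\<Sum>e\<in>?spectral_basis n. quad e)"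
      using spectral_basis_on(2)[of "1 / real (Suc n)"] by simp
    also have "\<dots> = (\<Sum>e\<in>?spectral_basis n. (LINT x|M. (cmod (ip e (k x)))\<^sup>2))"
      using onsD(2)[OF o] by (intro sum.cong) (auto simp: quad_eq)
    also have "\<dots> = (LINT x|M. ?A n x)" using i by (rule Bochner_Integration.integral_sum[symmetric])
    finally show ?thesis .
  qed
  have "(\<lambda>n. LINT x|M. ?A n x) \<longlonglongrightarrow> kernel_trace" unfolding kernel_trace_def
  proof (rule integral_dominated_convergence[where w = "\<lambda>x. nsq (k x)"])
    show iw: "integrable M (\<lambda>x. nsq (k x))" by (rule integrable_cont[OF cont_nsq_k])
    show "(\<lambda>x. nsq (k x)) \<in> borel_measurable M" using iw by simp
    show "?A n \<in> borel_measurable M" for n using i by (intro borel_measurable_sum) auto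
    show "AE x in M. norm (?A n x) \<le> nsq (k x)" for n
    proof (rule AE_I2)
      fix x assume "x \<in> space M"
      then have x: "x \<in> S" using space_M by simp
      have "0 \<le> ?A n x" by (simp add: sum_nonneg)
      then show "norm (?A n x) \<le> nsq (k x)"
        using A[OF x, of n] nsq_ge0[of "k x - proj (?spectral_basis n) (k x)"] proj_V[OF o] x by simp
    qed
    show "AE x in M. (\<lambda>n. ?A n x) \<longlonglongrightarrow> nsq (k x)"
    proof (rule AE_I2)
      fix x assume "x \<in> space M"
      then have x: "x \<in> S" using space_M by simp
      have "(\<lambda>n. nsq (k x) - nsq (k x - proj (?spectral_basis n) (k x))) \<longlonglongrightarrow> nsq (k x) - 0"
        by (intro tendsto_intros residual_tendsto_0 x)
      then show "(\<lambda>n. ?A n x) \<longlonglongrightarrow> nsq (k x)" using A[OF x] by simp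
    qed
  qed
  then show ?thesis unfolding eq .
qed

text \<open>All terms are nonnegative, so one sequence of truncations decides the unordered sum: any
  finite set of eigenvalues containing a truncation has its sum between the truncated trace and
  \<open>kernel_trace\<close>.\<close>

lemma trace_formula_real: "(weighted_mult has_sum kernel_trace) spec"
  unfolding has_sum_def
proof (rule tendstoI)
  fix e :: real assume e: "e > 0"
  have "\<forall>\<^sub>F n in sequentially. dist (\<Sum>\<mu>\<in>upper_spec (1 / real (Suc n)). weighted_mult \<mu>) kernel_trace < e"
    by (rule tendstoD[OF partial_traces_tendsto e])
  then obtain n where n: "dist (\<Sum>\<mu>\<in>upper_spec (1 / real (Suc n)). weighted_mult \<mu>) kernel_trace < e" by (auto simp: eventually_sequentially)
  let ?L = "upper_spec (1 / real (Suc n))"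
  have L: "finite ?L" "?L \<subseteq> spec" using finite_upper_spec by (auto simp: upper_spec_def)
  show "\<forall>\<^sub>F F in finite_subsets_at_top spec. dist (sum weighted_mult F) kernel_trace < e"
    unfolding eventually_finite_subsets_at_top
  proof (intro exI[of _ ?L] conjI L allI impI)
    fix Y assume Y: "finite Y \<and> ?L \<subseteq> Y \<and> Y \<subseteq> spec"
    have "sum weighted_mult ?L \<le> sum weighted_mult Y" using Y weighted_mult_ge0 by (intro sum_mono2) auto
    moreover have "sum weighted_mult Y \<le> kernel_trace" using weighted_mult_bound Y by blast
    ultimately show "dist (sum weighted_mult Y) kernel_trace < e" using n by (simp add: dist_real_def)
  qed
qed

theorem trace_formula:
  "((\<lambda>\<mu>. of_nat (fun_space.dim (espace \<mu>)) * \<mu>) has_sum complex_of_real kernel_trace) {\<mu>. \<exists>f\<in>espace \<mu>. f \<noteq> 0}"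
proof -
  have "((\<lambda>\<mu>. complex_of_real (weighted_mult \<mu>)) has_sum complex_of_real kernel_trace) spec"
    by (rule has_sum_of_real[OF trace_formula_real])
  moreover have "complex_of_real (weighted_mult \<mu>) = of_nat (fun_space.dim (espace \<mu>)) * \<mu>" if "\<mu> \<in> spec" for \<mu>
    using spec_real(1)[OF that] by (metis weighted_mult_def of_real_mult of_real_of_nat_eq)
  ultimately show ?thesis using has_sum_cong unfolding spec_def[symmetric] by (metis (no_types, lifting))
qed

theorem fin_dim_espace: "\<mu> \<noteq> 0 \<Longrightarrow> fin_dim (espace \<mu>)"
  unfolding fin_dim_def using eigenbasis(1,3) onsD(1) by blast

end

section \<open>Gaussians and the Fourier transform\<close>

definition echar :: "real \<Rightarrow> real \<Rightarrow> complex" where "echar t x = cis (- 2 * pi * t * x)"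

lemma fourier_echar: "fourier f t = (LINT x|lborel. f x * echar t x)"
  by (simp add: fourier_def echar_def cis_conv_exp mult_ac)

lemma norm_echar[simp]: "cmod (echar t x) = 1"
  by (simp add: echar_def)

lemma echar_add: "echar t (x + y) = echar t x * echar t y"
  by (simp add: echar_def cis_mult algebra_simps)

lemma echar_0[simp]: "echar t 0 = 1" "echar 0 x = 1"
  by (simp_all add: echar_def)

lemma echar_commute: "echar t x = echar x t"
  by (simp add: echar_def mult_ac)

lemma cnj_echar: "cnj (echar t x) = echar (- t) x" "cnj (echar t x) = echar t (- x)"
  by (simp_all add: echar_def cis_cnj)

lemma continuous_echar[continuous_intros]:
  "continuous_on A f \<Longrightarrow> continuous_on A g \<Longrightarrow> continuous_on A (\<lambda>x. echar (f x) (g x))"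
  unfolding echar_def by (intro continuous_intros)

lemma measurable_echar[measurable]:
  assumes [measurable]: "f \<in> borel_measurable M" "g \<in> borel_measurable M"
  shows "(\<lambda>x. echar (f x) (g x)) \<in> borel_measurable M"
proof -
  have [measurable]: "cis \<in> borel_measurable borel" 
    by (intro borel_measurable_continuous_onI continuous_intros)
  show ?thesis unfolding echar_def by measurable
qed

lemma integrable_echar[simp]: assumes "integrable lborel f" shows "integrable lborel (\<lambda>x. f x * echar t x)"
proof -
  have [measurable]: "f \<in> borel_measurable lborel" using assms by simp
  show ?thesis by (rule Bochner_Integration.integrable_bound[OF assms]) (auto simp: norm_mult)
qed

lemma continuous_LINT:
  fixes F :: "'a::{first_countable_topology,t2_space} \<Rightarrow> 'b \<Rightarrow> 'c::{banach,second_countable_topology}"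
  assumes "\<And>p. F p \<in> borel_measurable M" "integrable M g" "\<And>p y. y \<in> space M \<Longrightarrow> norm (F p y) \<le> g y"
    "\<And>y. y \<in> space M \<Longrightarrow> continuous_on UNIV (\<lambda>p. F p y)"
  shows "continuous_on UNIV (\<lambda>p. LINT y|M. F p y)"
  unfolding continuous_on_def
proof (intro ballI)
  fix p
  show "((\<lambda>p. LINT y|M. F p y) \<longlongrightarrow> (LINT y|M. F p y)) (at p)"
    unfolding tendsto_at_iff_sequentially comp_def
  proof (intro allI impI)
    fix X assume X: "\<forall>i. X i \<in> UNIV - {p}" "X \<longlonglongrightarrow> p"
    show "(\<lambda>n. LINT y|M. F (X n) y) \<longlonglongrightarrow> (LINT y|M. F p y)"
    proof (rule integral_dominated_convergence[where w = g])
      show "AE y in M. (\<lambda>n. F (X n) y) \<longlonglongrightarrow> F p y"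
      proof (rule AE_I2)
        fix y assume "y \<in> space M"
        from assms(4)[OF this] have "isCont (\<lambda>p. F p y) p" by (simp add: continuous_on_eq_continuous_at)
        then show "(\<lambda>n. F (X n) y) \<longlonglongrightarrow> F p y" using X(2) by (rule isCont_tendsto_compose)
      qed
    qed (use assms in auto)
  qed
qed

lemma continuous_fourier: assumes "integrable lborel f" shows "continuous_on UNIV (fourier f)"
proof -
  have [measurable]: "f \<in> borel_measurable lborel" using assms by simp
  have "continuous_on UNIV (\<lambda>t. LINT x|lborel. f x * echar t x)"
    by (rule continuous_LINT[where g = "\<lambda>x. cmod (f x)"])
       (use assms in \<open>auto simp: norm_mult intro!: continuous_intros\<close>)
  then show ?thesis by (simp add: fourier_echar[abs_def])
qed

lemma cmod_fourier_le: assumes "integrable lborel f" shows "cmod (fourier f t) \<le> (LINT x|lborel. cmod (f x))"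
  unfolding fourier_echar using integral_norm_bound[of lborel "\<lambda>x. f x * echar t x"] by (simp add: norm_mult)

lemma integrable_inv_1_plus_sq: "integrable lborel (\<lambda>x::real. 1 / (1 + x\<^sup>2))"
  using integrable_inverse_1_plus_square by (simp add: set_integrable_def inverse_eq_divide)

section \<open>Gaussian integrals and moments\<close>

definition gauss :: "real \<Rightarrow> real \<Rightarrow> real" where "gauss a y = exp (- (pi * a * y\<^sup>2))"

lemma gauss_pos[simp]: "0 < gauss a y" "0 \<le> gauss a y" by (simp_all add: gauss_def)

lemma continuous_gauss[continuous_intros]: "continuous_on A f \<Longrightarrow> continuous_on A (\<lambda>x. gauss a (f x))"
  unfolding gauss_def by (intro continuous_intros)

lemma measurable_gauss[measurable]:
  assumes [measurable]: "f \<in> borel_measurable M" "g \<in> borel_measurable M"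
  shows "(\<lambda>x. gauss (f x) (g x)) \<in> borel_measurable M"
  unfolding gauss_def by measurable

text \<open>Rescaling of the characteristic function of the standard normal law: the substitution x
  = s * y with s^2 = 2 * pi * a turns x^2 / 2 into pi * a * y^2.\<close>

lemma assumes a: "0 < a"
  shows gaussian_fourier: "(LINT y|lborel. complex_of_real (gauss a y) * echar \<xi> y) = of_real (exp (- (pi * \<xi>\<^sup>2 / a)) / sqrt a)"
    and integrable_gauss: "integrable lborel (gauss a)"
proof -
  define s where "s = sqrt (2 * pi * a)"
  have s: "s > 0" "s\<^sup>2 = 2 * pi * a" using a by (simp_all add: s_def)
  have ss: "s = sqrt (2 * pi) * sqrt a" by (simp add: s_def real_sqrt_mult)
  have e: "std_normal_density (0 + s * y) = gauss a y / sqrt (2 * pi)" for y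
    using s by (simp add: std_normal_density_def gauss_def power_mult_distrib)
  have "integrable lborel (\<lambda>y. std_normal_density (0 + s * y))"
    using s by (intro lborel_integrable_real_affine) (use integrable_normal_density[of 1 0] in \<open>simp_all\<close>)
  then have "integrable lborel (\<lambda>y. gauss a y / sqrt (2 * pi))" unfolding e .
  from integrable_mult_right[OF this, of "sqrt (2 * pi)"] show i: "integrable lborel (gauss a)" by simp
  \<comment> \<open>The frequency for which t * (s * y) = - 2 * pi * \<xi> * y.\<close>
  define t where "t = - 2 * pi * \<xi> / s"
  have "complex_of_real (exp (- (t\<^sup>2) / 2)) = char std_normal_distribution t"
    by (simp add: char_std_normal_distribution)
  also have "\<dots> = (LINT x|lborel. std_normal_density x *\<^sub>R iexp (t * x))"
    unfolding char_def by (subst integral_density) auto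
  also have "\<dots> = s *\<^sub>R (LINT y|lborel. std_normal_density (0 + s * y) *\<^sub>R iexp (t * (0 + s * y)))"
    using s by (subst lborel_integral_real_affine[of s _ 0]) auto
  also have "(\<lambda>y. std_normal_density (0 + s * y) *\<^sub>R iexp (t * (0 + s * y)))
      = (\<lambda>y. (complex_of_real (gauss a y) * echar \<xi> y) / of_real (sqrt (2 * pi)))"
  proof
    fix y
    have "t * (0 + s * y) = - 2 * pi * \<xi> * y" using s(1) by (simp add: t_def)
    then show "std_normal_density (0 + s * y) *\<^sub>R iexp (t * (0 + s * y))
      = (complex_of_real (gauss a y) * echar \<xi> y) / of_real (sqrt (2 * pi))"
      unfolding e echar_def cis_conv_exp by (simp add: scaleR_conv_of_real)
  qed
  also have "(LINT y|lborel. (complex_of_real (gauss a y) * echar \<xi> y) / of_real (sqrt (2 * pi)))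
    = (LINT y|lborel. complex_of_real (gauss a y) * echar \<xi> y) / of_real (sqrt (2 * pi))" by simp
  finally have *: "complex_of_real (exp (- (t\<^sup>2) / 2)) = s *\<^sub>R ((LINT y|lborel. complex_of_real (gauss a y) * echar \<xi> y) / of_real (sqrt (2 * pi)))" .
  have "t\<^sup>2 = (2 * pi * \<xi>)\<^sup>2 / s\<^sup>2" by (simp add: t_def power_divide)
  then have t2: "- (t\<^sup>2) / 2 = - (pi * \<xi>\<^sup>2 / a)" unfolding s(2) using a by (simp add: field_simps power2_eq_square)
  have "complex_of_real (exp (- (pi * \<xi>\<^sup>2 / a))) = of_real (sqrt a) * (LINT y|lborel. complex_of_real (gauss a y) * echar \<xi> y)"
    using * unfolding t2 ss by (simp add: scaleR_conv_of_real)
  then show "(LINT y|lborel. complex_of_real (gauss a y) * echar \<xi> y) = of_real (exp (- (pi * \<xi>\<^sup>2 / a)) / sqrt a)"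
    using a by (simp add: field_simps)
qed

lemma integral_gauss: assumes "0 < a" shows "(LINT y|lborel. gauss a y) = 1 / sqrt a"
proof -
  have "complex_of_real (LINT y|lborel. gauss a y) = of_real (1 / sqrt a)"
    using gaussian_fourier[OF assms, of 0] by (simp flip: integral_complex_of_real)
  then show ?thesis by (simp only: of_real_eq_iff)
qed

text \<open>Half of the exponent is spent on the polynomial factor, through z * exp (- z) \<le> 1
  with z = pi * a * y^2 / 2.\<close>

lemma gauss_poly_bound: assumes "0 < a" shows "(1 + y\<^sup>2) * gauss a y \<le> (1 + 2 / (pi * a)) * gauss (a / 2) y"
proof -
  define z where "z = pi * a * y\<^sup>2 / 2"
  have z: "0 \<le> z" using assms by (simp add: z_def)
  have y: "y\<^sup>2 = (2 / (pi * a)) * z" using assms by (simp add: z_def)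
  have 1: "exp (- z) \<le> 1" using z by simp
  have "z \<le> exp z" using exp_ge_add_one_self[of z] by linarith
  then have 2: "z * exp (- z) \<le> 1" by (simp add: exp_minus field_simps)
  have "gauss a y = exp (- z) * gauss (a / 2) y" by (simp add: gauss_def z_def flip: exp_add) 
  moreover have "(1 + y\<^sup>2) * exp (- z) \<le> 1 + 2 / (pi * a)"
  proof -
    have "(1 + y\<^sup>2) * exp (- z) = exp (- z) + (2 / (pi * a)) * (z * exp (- z))" unfolding y by (simp add: algebra_simps)
    also have "\<dots> \<le> 1 + (2 / (pi * a)) * 1" using assms by (intro add_mono 1 mult_left_mono 2) auto
    finally show ?thesis by simp
  qed
  ultimately show ?thesis using mult_right_mono[of "(1 + y\<^sup>2) * exp (- z)" "1 + 2 / (pi * a)" "gauss (a/2) y"] by (simp add: mult_ac)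
qed

lemma integrable_gauss_poly: assumes a: "0 < a" and [measurable]: "P \<in> borel_measurable lborel" and P: "\<And>y. cmod (P y) \<le> C * (1 + y\<^sup>2)"
  shows "integrable lborel (\<lambda>y. P y * complex_of_real (gauss a y))"
proof (rule Bochner_Integration.integrable_bound)
  show "integrable lborel (\<lambda>y. C * ((1 + 2 / (pi * a)) * gauss (a / 2) y))"
    using integrable_gauss[of "a/2"] a by simp
  have C: "0 \<le> C" using order_trans[OF norm_ge_zero P[of 0]] by simp
  show "AE y in lborel. norm (P y * complex_of_real (gauss a y)) \<le> norm (C * ((1 + 2 / (pi * a)) * gauss (a / 2) y))"
  proof (rule AE_I2)
    fix y
    have "norm (P y * complex_of_real (gauss a y)) \<le> C * (1 + y\<^sup>2) * gauss a y"
      by (simp add: norm_mult mult_right_mono P)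
    also have "\<dots> \<le> C * ((1 + 2 / (pi * a)) * gauss (a / 2) y)"
      using mult_left_mono[OF gauss_poly_bound[OF a] C, of y] by (simp add: mult_ac)
    finally show "norm (P y * complex_of_real (gauss a y)) \<le> norm (C * ((1 + 2 / (pi * a)) * gauss (a / 2) y))"
      by (simp add: abs_of_nonneg)
  qed
qed simp

text \<open>Integration by parts on the whole line in disguise: a total derivative with vanishing
  ends integrates to 0, which gives the moment recursions below.\<close>

lemma integral_deriv_zero:
  fixes F f :: "real \<Rightarrow> complex"
  assumes "\<And>x. (F has_vector_derivative f x) (at x)" "continuous_on UNIV f" "integrable lborel f"
    "(F \<longlongrightarrow> 0) at_top" "(F \<longlongrightarrow> 0) at_bot"
  shows "(LINT x|lborel. f x) = 0"
proof -
  have "(LBINT x=-\<infinity>..\<infinity>. f x) = 0 - 0"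
  proof (rule interval_integral_FTC_integrable)
    show "isCont f x" for x using assms(2) by (simp add: continuous_on_eq_continuous_at)
    show "set_integrable lborel (einterval (- \<infinity>) \<infinity>) f" using assms(3) by (simp add: set_integrable_def)
    show "((F \<circ> real_of_ereal) \<longlongrightarrow> 0) (at_right (- \<infinity>))" unfolding ereal_tendsto_simps by (rule assms(5))
    show "((F \<circ> real_of_ereal) \<longlongrightarrow> 0) (at_left \<infinity>)" unfolding ereal_tendsto_simps by (rule assms(4))
  qed (use assms(1) in auto)
  then show ?thesis by (simp add: interval_integral_to_infinity_eq interval_lebesgue_integral_def set_lebesgue_integral_def)
qed

lemma tendsto_gauss_poly:
  fixes P :: "real \<Rightarrow> complex"
  assumes a: "0 < a" and P: "\<And>y. cmod (P y) \<le> C * (1 + y\<^sup>2)"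
  shows "((\<lambda>y. P y * complex_of_real (gauss a y)) \<longlongrightarrow> 0) at_top" "((\<lambda>y. P y * complex_of_real (gauss a y)) \<longlongrightarrow> 0) at_bot"
proof -
  have *: "norm (P y * complex_of_real (gauss a y)) \<le> C * (1 + y\<^sup>2) * gauss a y" for y
    by (simp add: norm_mult mult_right_mono P)
  have "((\<lambda>y. C * (1 + y\<^sup>2) * gauss a y) \<longlongrightarrow> 0) at_top" unfolding gauss_def using a by real_asymp
  then show "((\<lambda>y. P y * complex_of_real (gauss a y)) \<longlongrightarrow> 0) at_top"
    by (rule Lim_null_comparison[OF always_eventually[OF allI[OF *]]])
  have "((\<lambda>y. C * (1 + y\<^sup>2) * gauss a y) \<longlongrightarrow> 0) at_bot" unfolding gauss_def using a by real_asymp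
  then show "((\<lambda>y. P y * complex_of_real (gauss a y)) \<longlongrightarrow> 0) at_bot"
    by (rule Lim_null_comparison[OF always_eventually[OF allI[OF *]]])
qed

lemma echar_deriv: "((\<lambda>y. echar \<xi> y) has_vector_derivative (- 2 * of_real pi * \<i> * of_real \<xi>) * echar \<xi> y) (at y)"
proof -
  have "((\<lambda>z. exp ((- 2 * of_real pi * \<i> * of_real \<xi>) * z)) has_field_derivative
    (- 2 * of_real pi * \<i> * of_real \<xi>) * exp ((- 2 * of_real pi * \<i> * of_real \<xi>) * of_real y)) (at (of_real y))"
    by (auto intro!: derivative_eq_intros)
  from has_vector_derivative_real_field[OF this] show ?thesis
    unfolding echar_def cis_conv_exp by (simp add: mult_ac)
qed

lemma echar_gauss_deriv: "((\<lambda>y. complex_of_real (gauss a y) * echar \<xi> y) has_vector_derivative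
   (- 2 * of_real pi) * (of_real a * of_real y + \<i> * of_real \<xi>) * (complex_of_real (gauss a y) * echar \<xi> y)) (at y)"
proof -
  have "((\<lambda>y. gauss a y) has_real_derivative (- 2 * pi * a * y) * gauss a y) (at y)"
    unfolding gauss_def by (auto intro!: derivative_eq_intros)
  then have "((\<lambda>y. complex_of_real (gauss a y)) has_vector_derivative complex_of_real ((- 2 * pi * a * y) * gauss a y)) (at y)"
    by (intro has_vector_derivative_of_real) (simp add: has_real_derivative_iff_has_vector_derivative)
  from has_vector_derivative_mult[OF this echar_deriv[of \<xi> y]] show ?thesis
    by (simp add: algebra_simps)
qed

lemma abs_le_1_plus_sq: "\<bar>y\<bar> \<le> 1 + (y::real)\<^sup>2"
proof -
  have "0 \<le> (\<bar>y\<bar> - 1)\<^sup>2" by simp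
  then have "2 * \<bar>y\<bar> \<le> 1 + y\<^sup>2" by (simp add: power2_diff)
  then show ?thesis by simp
qed

text \<open>Integrating the derivative of \<open>gauss a y * echar \<xi> y\<close> relates the first
  moment to I, and integrating the derivative of y times this function relates the second moment to
  the first one and I.\<close>

lemma gaussian_moment:
  fixes a \<xi> :: real
  assumes a: "0 < a"
  defines "I \<equiv> complex_of_real (exp (- (pi * \<xi>\<^sup>2 / a)) / sqrt a)"
  shows "(LINT y|lborel. of_real y * (of_real (gauss a y) * echar \<xi> y)) = - (\<i> * of_real (\<xi> / a)) * I" (is ?A)
    and "(LINT y|lborel. of_real (y\<^sup>2) * (of_real (gauss a y) * echar \<xi> y)) = of_real (1 / (2 * pi * a) - \<xi>\<^sup>2 / a\<^sup>2) * I" (is ?B)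
    and "integrable lborel (\<lambda>y. of_real y * (of_real (gauss a y) * echar \<xi> y))" (is ?i1)
    and "integrable lborel (\<lambda>y. of_real (y\<^sup>2) * (of_real (gauss a y) * echar \<xi> y))" (is ?i2)
    and "integrable lborel (\<lambda>y. complex_of_real (gauss a y) * echar \<xi> y)" (is ?i0)
proof -
  let ?G = "\<lambda>y. complex_of_real (gauss a y) * echar \<xi> y"
  show i0: ?i0 using integrable_gauss[OF a] by (intro integrable_echar) simp
  have *: "cmod (of_real y * echar \<xi> y) \<le> 1 * (1 + y\<^sup>2)" "cmod (of_real (y\<^sup>2) * echar \<xi> y) \<le> 1 * (1 + y\<^sup>2)"
    "cmod (echar \<xi> y) \<le> 1 * (1 + y\<^sup>2)" for y
    using abs_le_1_plus_sq[of y] by (simp_all add: norm_mult norm_power)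
  have i1: ?i1 using integrable_gauss_poly[OF a _ *(1)] by (simp add: mult_ac)
  then show ?i1 .
  have i2: ?i2 using integrable_gauss_poly[OF a _ *(2)] by (simp add: mult_ac)
  then show ?i2 .
  have I: "(LINT y|lborel. ?G y) = I" unfolding I_def by (rule gaussian_fourier[OF a])
  let ?c = "- 2 * complex_of_real pi"
  have c0: "?c \<noteq> 0" by simp
  have e1: "(\<lambda>y. ?c * (of_real a * of_real y + \<i> * of_real \<xi>) * ?G y)
     = (\<lambda>y. ?c * (of_real a * (of_real y * ?G y) + \<i> * of_real \<xi> * ?G y))"
    by (simp add: fun_eq_iff algebra_simps)
  have "(LINT y|lborel. ?c * (of_real a * of_real y + \<i> * of_real \<xi>) * ?G y) = 0"
  proof (rule integral_deriv_zero[OF echar_gauss_deriv])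
    show "continuous_on UNIV (\<lambda>y. ?c * (of_real a * of_real y + \<i> * of_real \<xi>) * ?G y)"
      by (intro continuous_intros)
    show "integrable lborel (\<lambda>y. ?c * (of_real a * of_real y + \<i> * of_real \<xi>) * ?G y)"
      unfolding e1 by (intro integrable_mult_right Bochner_Integration.integrable_add i0 i1)
    show "(?G \<longlongrightarrow> 0) at_top" "(?G \<longlongrightarrow> 0) at_bot"
      using tendsto_gauss_poly[OF a *(3)] by (simp_all add: mult.commute)
  qed
  then have "of_real a * (LINT y|lborel. of_real y * ?G y) + \<i> * of_real \<xi> * I = 0"
    unfolding e1 using i0 i1 by (simp add: I)
  then have "of_real a * (LINT y|lborel. of_real y * ?G y) = - (\<i> * of_real \<xi> * I)" by (simp add: add_eq_0_iff2)
  then show A: ?A using a by (simp add: field_simps)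
  let ?D = "\<lambda>y. ?G y + of_real y * (?c * (of_real a * of_real y + \<i> * of_real \<xi>) * ?G y)"
  have e2: "?D = (\<lambda>y. ?G y + ?c * (of_real a * (of_real (y\<^sup>2) * ?G y) + \<i> * of_real \<xi> * (of_real y * ?G y)))"
    by (simp add: fun_eq_iff algebra_simps power2_eq_square)
  have "(LINT y|lborel. ?D y) = 0"
  proof (rule integral_deriv_zero)
    show "((\<lambda>y. of_real y * ?G y) has_vector_derivative ?D y) (at y)" for y
      using has_vector_derivative_mult[OF has_vector_derivative_of_real[OF DERIV_ident] echar_gauss_deriv[of a \<xi> y]]
      by (simp add: add.commute)
    show "continuous_on UNIV ?D" by (intro continuous_intros)
    show "integrable lborel ?D"
      unfolding e2 by (intro integrable_mult_right Bochner_Integration.integrable_add i0 i1 i2)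
    show "((\<lambda>y. of_real y * ?G y) \<longlongrightarrow> 0) at_top" "((\<lambda>y. of_real y * ?G y) \<longlongrightarrow> 0) at_bot"
      using tendsto_gauss_poly[OF a *(1)] by (simp_all add: mult_ac)
  qed
  then have "I + ?c * (of_real a * (LINT y|lborel. of_real (y\<^sup>2) * ?G y) + \<i> * of_real \<xi> * (LINT y|lborel. of_real y * ?G y)) = 0"
    unfolding e2 using i0 i1 i2 by (simp add: I)
  then have "I + ?c * (of_real a * (LINT y|lborel. of_real (y\<^sup>2) * ?G y) + of_real (\<xi>\<^sup>2 / a) * I) = 0"
    unfolding A by (simp add: algebra_simps power2_eq_square)
  then have "2 * of_real pi * of_real a * (LINT y|lborel. of_real (y\<^sup>2) * ?G y) = I - 2 * of_real pi * of_real (\<xi>\<^sup>2 / a) * I"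
    by (simp add: algebra_simps add_eq_0_iff2)
  then have "(LINT y|lborel. of_real (y\<^sup>2) * ?G y) = (I - 2 * of_real pi * of_real (\<xi>\<^sup>2 / a) * I) / (2 * of_real pi * of_real a)"
    using a by (simp add: field_simps)
  also have "\<dots> = of_real (1 / (2 * pi * a) - \<xi>\<^sup>2 / a\<^sup>2) * I"
    using a by (simp add: field_simps power2_eq_square)
  finally show ?B .
qed

section \<open>Fourier inversion\<close>

text \<open>The weights G n have mass 1. Within distance d of x, continuity bounds the error by e /
  2; outside, the weight is at most t n times a fixed Gaussian, with t n tending to 0.\<close>

lemma approx_identity:
  fixes f :: "real \<Rightarrow> complex"
  assumes f: "integrable lborel f" and c: "isCont f x"
  shows "(\<lambda>n. LINT y|lborel. f y * of_real (real (Suc n) * gauss ((real (Suc n))\<^sup>2) (y - x))) \<longlonglongrightarrow> f x"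
proof (rule LIMSEQ_I)
  fix e :: real assume e: "0 < e"
  define G where "G n y = real (Suc n) * gauss ((real (Suc n))\<^sup>2) (y - x)" for n y
  have shift: "integrable lborel (\<lambda>y. gauss a (y - x))" "(LINT y|lborel. gauss a (y - x)) = 1 / sqrt a" if "a > 0" for a
  proof -
    have "integrable lborel (\<lambda>y. gauss a (- x + 1 * y))" using integrable_gauss[OF that] by (intro lborel_integrable_real_affine) auto
    then show "integrable lborel (\<lambda>y. gauss a (y - x))" by simp
    have "(LINT y|lborel. gauss a y) = (LINT y|lborel. gauss a (- x + 1 * y))"
      by (subst lborel_integral_real_affine[of 1 _ "-x"]) auto
    then show "(LINT y|lborel. gauss a (y - x)) = 1 / sqrt a" using integral_gauss[OF that] by simp
  qed
  have G: "integrable lborel (G n)" "(LINT y|lborel. G n y) = 1" "\<And>y. 0 \<le> G n y" for n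
    using shift[of "(real (Suc n))\<^sup>2"] by (simp_all add: G_def[abs_def])
  have [measurable]: "f \<in> borel_measurable lborel" using f by simp
  obtain d where d: "d > 0" "\<And>y. dist y x < d \<Longrightarrow> dist (f y) (f x) < e / 2"
    using c e unfolding continuous_at_eps_delta dist_norm by (metis half_gt_zero)
  \<comment> \<open>An integrable majorant, independent of n, of |f y - f x| times the fixed
    Gaussian; it needs only \<open>gauss \<le> 1\<close> on the first term.\<close>
  define h where "h y = cmod (f y) + cmod (f x) * gauss (1/2) (y - x)" for y
  have h: "integrable lborel h" unfolding h_def
    by (intro Bochner_Integration.integrable_add integrable_mult_right shift integrable_norm f) simp
  define t where "t n = real (Suc n) * exp (- (pi * (real (Suc n))\<^sup>2 * d\<^sup>2 / 2))" for n
  \<comment> \<open>Half of the exponent is estimated by d, giving the decay t n; the other half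
    keeps a Gaussian in y integrable.\<close>
  have tail: "G n y \<le> t n * gauss (1/2) (y - x)" if "d \<le> \<bar>y - x\<bar>" for n y
  proof -
    have "d\<^sup>2 \<le> (y - x)\<^sup>2" using that d(1) by (metis abs_le_square_iff abs_of_pos)
    then have 1: "(real (Suc n))\<^sup>2 * d\<^sup>2 \<le> (real (Suc n))\<^sup>2 * (y - x)\<^sup>2" by (intro mult_left_mono) auto
    have "1 * (y - x)\<^sup>2 \<le> (real (Suc n))\<^sup>2 * (y - x)\<^sup>2" by (intro mult_right_mono) auto
    with 1 have "(real (Suc n))\<^sup>2 * d\<^sup>2 / 2 + (1/2) * (y - x)\<^sup>2 \<le> (real (Suc n))\<^sup>2 * (y - x)\<^sup>2" by linarith
    then have "pi * ((real (Suc n))\<^sup>2 * d\<^sup>2 / 2 + (1/2) * (y - x)\<^sup>2) \<le> pi * ((real (Suc n))\<^sup>2 * (y - x)\<^sup>2)"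
      by (intro mult_left_mono) auto
    then have "exp (- (pi * ((real (Suc n))\<^sup>2 * (y - x)\<^sup>2))) \<le> exp (- (pi * ((real (Suc n))\<^sup>2 * d\<^sup>2 / 2 + (1/2) * (y - x)\<^sup>2)))" by simp
    also have "\<dots> = exp (- (pi * (real (Suc n))\<^sup>2 * d\<^sup>2 / 2)) * exp (- (pi * (1/2) * (y - x)\<^sup>2))"
      by (simp add: exp_add[symmetric] algebra_simps)
    finally show ?thesis unfolding G_def gauss_def t_def by (simp add: mult.assoc mult_left_mono)
  qed
  have t0: "t n \<ge> 0" for n by (simp add: t_def)
  have ptw: "cmod ((f y - f x) * of_real (G n y)) \<le> e / 2 * G n y + t n * h y" for n y
  proof (cases "\<bar>y - x\<bar> < d")
    case True
    then have "cmod (f y - f x) \<le> e / 2" using d(2)[of y] by (simp add: dist_norm)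
    from mult_right_mono[OF this G(3)[of n y]]
    have "cmod ((f y - f x) * of_real (G n y)) \<le> e / 2 * G n y"
      using G(3)[of n y] by (simp add: norm_mult)
    moreover have "0 \<le> t n * h y" using t0 by (simp add: h_def)
    ultimately show ?thesis by linarith
  next
    case False
    have "gauss (1/2) (y - x) \<le> 1" by (simp add: gauss_def)
    then have "cmod (f y) * gauss (1/2) (y - x) \<le> cmod (f y)" by (simp add: mult_left_le)
    then have 1: "(cmod (f y) + cmod (f x)) * gauss (1/2) (y - x) \<le> h y" by (simp add: h_def algebra_simps)
    have "cmod ((f y - f x) * of_real (G n y)) = cmod (f y - f x) * G n y" using G(3)[of n y] by (simp add: norm_mult)
    also have "\<dots> \<le> (cmod (f y) + cmod (f x)) * (t n * gauss (1/2) (y - x))"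
      using False G(3)[of n y] by (intro mult_mono norm_triangle_ineq4 tail) auto
    also have "\<dots> = t n * ((cmod (f y) + cmod (f x)) * gauss (1/2) (y - x))" by simp
    also have "\<dots> \<le> t n * h y" by (intro mult_left_mono 1 t0)
    finally show ?thesis using G(3)[of n y] e by (simp add: add_increasing)
  qed
  have fG: "integrable lborel (\<lambda>y. f y * of_real (G n y))" for n
  proof (rule Bochner_Integration.integrable_bound[of _ "\<lambda>y. real (Suc n) * cmod (f y)"])
    show "integrable lborel (\<lambda>y. real (Suc n) * cmod (f y))" using f by simp
    show "AE y in lborel. norm (f y * of_real (G n y)) \<le> norm (real (Suc n) * cmod (f y))"
    proof (rule AE_I2)
      fix y
      have "G n y \<le> real (Suc n) * 1" unfolding G_def gauss_def by (intro mult_left_mono) auto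
      then show "norm (f y * of_real (G n y)) \<le> norm (real (Suc n) * cmod (f y))"
        using G(3)[of n y] mult_left_mono[of "G n y" "real (Suc n)" "cmod (f y)"] by (simp add: norm_mult mult.commute)
    qed
  qed (simp add: G_def[abs_def])
  define C where "C = (LINT y|lborel. h y)"
  have est: "cmod ((LINT y|lborel. f y * of_real (G n y)) - f x) \<le> e / 2 + t n * C" for n
  proof -
    have "(LINT y|lborel. f x * complex_of_real (G n y)) = f x"
      using G(1,2)[of n] by simp
    then have "(LINT y|lborel. f y * of_real (G n y)) - f x = (LINT y|lborel. f y * of_real (G n y)) - (LINT y|lborel. f x * of_real (G n y))" by simp
    also have "\<dots> = (LINT y|lborel. (f y - f x) * of_real (G n y))"
      using fG G(1)[of n] by (simp add: left_diff_distrib)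
    also have "cmod \<dots> \<le> (LINT y|lborel. e / 2 * G n y + t n * h y)"
    proof (rule Bochner_Integration.integral_norm_bound_integral)
      show "integrable lborel (\<lambda>y. (f y - f x) * of_real (G n y))" using fG G(1)[of n] by (simp add: left_diff_distrib)
      show "integrable lborel (\<lambda>y. e / 2 * G n y + t n * h y)" using G(1)[of n] h by simp
    qed (rule ptw)
    also have "\<dots> = e / 2 + t n * C" using G(1,2)[of n] h by (simp add: C_def)
    finally show ?thesis .
  qed
  have "t \<longlonglongrightarrow> 0" unfolding t_def using d(1) by real_asymp
  then have "(\<lambda>n. t n * C) \<longlonglongrightarrow> 0 * C" by (intro tendsto_intros)
  then have "\<forall>\<^sub>F n in sequentially. t n * C < e / 2" using e by (intro order_tendstoD(2)) auto
  then obtain N where N: "\<And>n. n \<ge> N \<Longrightarrow> t n * C < e / 2" unfolding eventually_sequentially by auto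
  show "\<exists>no. \<forall>n\<ge>no. norm ((LINT y|lborel. f y * of_real (real (Suc n) * gauss ((real (Suc n))\<^sup>2) (y - x))) - f x) < e"
    unfolding G_def[symmetric]
  proof (intro exI[of _ N] allI impI)
    fix n assume "n \<ge> N"
    then show "cmod ((LINT y|lborel. f y * of_real (G n y)) - f x) < e" using est[of n] N[of n] by linarith
  qed
qed

text \<open>Both sides are the double integral of \<open>f y * g \<xi> * echar \<xi> y\<close>.\<close>
lemma fourier_exchange:
  assumes f: "integrable lborel f" and g: "integrable lborel g"
  shows "(LINT \<xi>|lborel. fourier f \<xi> * g \<xi>) = (LINT y|lborel. f y * fourier g y)"
proof -
  have [measurable]: "f \<in> borel_measurable lborel" "g \<in> borel_measurable lborel" using f g by simp_all
  have "integrable (lborel \<Otimes>\<^sub>M lborel) (\<lambda>(\<xi>, y). f y * echar \<xi> y * g \<xi>)"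
  proof (rule lborel_pair.Fubini_integrable)
    show "(\<lambda>(\<xi>, y). f y * echar \<xi> y * g \<xi>) \<in> borel_measurable (lborel \<Otimes>\<^sub>M lborel)" by measurable
    show "integrable lborel (\<lambda>\<xi>. LINT y|lborel. norm (case (\<xi>, y) of (\<xi>, y) \<Rightarrow> f y * echar \<xi> y * g \<xi>))"
      using g by (simp add: norm_mult)
    show "AE \<xi> in lborel. integrable lborel (\<lambda>y. case (\<xi>, y) of (\<xi>, y) \<Rightarrow> f y * echar \<xi> y * g \<xi>)"
      using f by simp
  qed
  from lborel_pair.Fubini_integral[OF this]
  have "(LINT y|lborel. (LINT \<xi>|lborel. f y * echar \<xi> y * g \<xi>)) = (LINT \<xi>|lborel. (LINT y|lborel. f y * echar \<xi> y * g \<xi>))"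
    by simp
  moreover have "(LINT y|lborel. f y * echar \<xi> y * g \<xi>) = fourier f \<xi> * g \<xi>" for \<xi>
    by (simp add: fourier_echar)
  moreover have "(LINT \<xi>|lborel. f y * echar \<xi> y * g \<xi>) = f y * fourier g y" for y
  proof -
    have "(\<lambda>\<xi>. f y * echar \<xi> y * g \<xi>) = (\<lambda>\<xi>. f y * (g \<xi> * echar y \<xi>))" by (simp add: echar_commute mult_ac)
    then show ?thesis by (simp add: fourier_echar)
  qed
  ultimately show ?thesis by (simp add: fourier_echar)
qed

text \<open>A Gaussian factor is inserted into the inversion integral. By
  \<open>fourier_exchange\<close> the damped integral is an approximate identity applied to f, hence
  tends to f x, while dominated convergence removes the damping.\<close>

lemma fourier_inversion:
  assumes f: "integrable lborel f" and f': "integrable lborel (fourier f)" and c: "isCont f x"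
  shows "(LINT \<xi>|lborel. fourier f \<xi> * echar (- x) \<xi>) = f x"
proof -
  \<comment> \<open>The width for which the transform of the damping factor is precisely the kernel
    of \<open>approx_identity\<close>.\<close>
  define a where "a n = 1 / (real (Suc n))\<^sup>2" for n
  have a: "a n > 0" for n by (simp add: a_def)
  define g where "g n \<xi> = complex_of_real (gauss (a n) \<xi>) * echar (- x) \<xi>" for n \<xi>
  have g: "integrable lborel (g n)" for n unfolding g_def using integrable_gauss[OF a] by (intro integrable_echar) simp
  have Fg: "fourier (g n) y = of_real (real (Suc n) * gauss ((real (Suc n))\<^sup>2) (y - x))" for n y
  proof -
    have "fourier (g n) y = (LINT \<xi>|lborel. complex_of_real (gauss (a n) \<xi>) * echar (y - x) \<xi>)"
      unfolding fourier_echar g_def by (simp add: mult.assoc echar_def cis_mult algebra_simps)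
    also have "\<dots> = of_real (exp (- (pi * (y - x)\<^sup>2 / a n)) / sqrt (a n))" by (rule gaussian_fourier[OF a])
    also have "exp (- (pi * (y - x)\<^sup>2 / a n)) / sqrt (a n) = real (Suc n) * gauss ((real (Suc n))\<^sup>2) (y - x)"
      by (simp add: a_def gauss_def real_sqrt_divide mult_ac)
    finally show ?thesis .
  qed
  have "(\<lambda>n. LINT \<xi>|lborel. fourier f \<xi> * g n \<xi>) \<longlonglongrightarrow> f x"
    using approx_identity[OF f c] by (simp only: fourier_exchange[OF f g] Fg)
  moreover have "(\<lambda>n. LINT \<xi>|lborel. fourier f \<xi> * g n \<xi>) \<longlonglongrightarrow> (LINT \<xi>|lborel. fourier f \<xi> * echar (- x) \<xi>)"
  proof (rule integral_dominated_convergence[where w = "\<lambda>\<xi>. cmod (fourier f \<xi>)"])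
    have [measurable]: "fourier f \<in> borel_measurable lborel" using f' by simp
    show "(\<lambda>\<xi>. fourier f \<xi> * echar (- x) \<xi>) \<in> borel_measurable lborel" by measurable
    show "(\<lambda>\<xi>. fourier f \<xi> * g n \<xi>) \<in> borel_measurable lborel" for n unfolding g_def by measurable
    show "integrable lborel (\<lambda>\<xi>. cmod (fourier f \<xi>))" using f' by simp
    show "AE \<xi> in lborel. cmod (fourier f \<xi> * g n \<xi>) \<le> cmod (fourier f \<xi>)" for n
      using a[of n] by (intro AE_I2) (simp add: norm_mult g_def gauss_def mult_left_le)
    have "(\<lambda>n. g n \<xi>) \<longlonglongrightarrow> echar (- x) \<xi>" for \<xi>
    proof -
      have "(\<lambda>n. gauss (a n) \<xi>) \<longlonglongrightarrow> 1" unfolding gauss_def a_def by real_asymp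
      then have "(\<lambda>n. g n \<xi>) \<longlonglongrightarrow> of_real 1 * echar (- x) \<xi>" unfolding g_def by (intro tendsto_intros)
      then show ?thesis by simp
    qed
    then show "AE \<xi> in lborel. (\<lambda>n. fourier f \<xi> * g n \<xi>) \<longlonglongrightarrow> fourier f \<xi> * echar (- x) \<xi>"
      by (intro AE_I2 tendsto_intros)
  qed
  ultimately show ?thesis using LIMSEQ_unique by blast
qed

text \<open>The conjugate of \<open>fourier g\<close> is the transform of the reflected conjugate of
  g, so the identity is \<open>fourier_exchange\<close> followed by inversion of f. Integrability of
  the transform is asked of f only; in the application g is the weighted kernel, which enters
  through its L1 norm.\<close>

lemma parseval:
  assumes f: "integrable lborel f" "integrable lborel (fourier f)" "continuous_on UNIV f" and g: "integrable lborel g"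
  shows "(LINT \<xi>|lborel. fourier f \<xi> * cnj (fourier g \<xi>)) = (LINT x|lborel. f x * cnj (g x))"
proof -
  have ff: "fourier (fourier f) (- x) = f x" for x
    using fourier_inversion[OF f(1,2), of x] f(3) by (simp add: fourier_echar[of "fourier f"] continuous_on_eq_continuous_at)
  have g': "integrable lborel (\<lambda>x. cnj (g x))" using g by simp
  have g2: "integrable lborel (\<lambda>x. cnj (g (- x)))"
    using lborel_integrable_real_affine[OF g', of "-1" 0] by simp
  have cg: "cnj (fourier g \<xi>) = fourier (\<lambda>x. cnj (g (- x))) \<xi>" for \<xi>
  proof -
    have "cnj (fourier g \<xi>) = (LINT x|lborel. cnj (g x) * echar \<xi> (- x))"
      unfolding fourier_echar by (simp add: cnj_echar(2) flip: Bochner_Integration.integral_cnj)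
    also have "\<dots> = (LINT x|lborel. cnj (g (- x)) * echar \<xi> x)"
      by (subst lborel_integral_real_affine[of "-1" _ 0]) auto
    finally show ?thesis by (simp add: fourier_echar)
  qed
  have "(LINT \<xi>|lborel. fourier f \<xi> * cnj (fourier g \<xi>)) = (LINT y|lborel. fourier (fourier f) y * cnj (g (- y)))"
    unfolding cg by (rule fourier_exchange[OF f(2) g2, symmetric])
  also have "\<dots> = (LINT y|lborel. fourier (fourier f) (- y) * cnj (g y))"
    by (subst lborel_integral_real_affine[of "-1" _ 0]) auto
  finally show ?thesis unfolding ff .
qed

section \<open>The Fourier symmetric Sobolev space\<close>

lemma measurable_cnj[measurable]: "cnj \<in> borel_measurable borel"
  by (intro borel_measurable_continuous_onI continuous_intros)

lemma FSobolev_continuous: "f \<in> FSobolev \<Longrightarrow> continuous_on UNIV f"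
  by (simp add: FSobolev_def)

lemma FSobolev_measurable: "f \<in> FSobolev \<Longrightarrow> f \<in> borel_measurable borel"
  by (intro borel_measurable_continuous_onI FSobolev_continuous)

lemma fourier_measurable: 
  assumes [measurable]: "f \<in> borel_measurable borel" shows "fourier f \<in> borel_measurable borel"
  unfolding fourier_echar[abs_def] by measurable

text \<open>The arithmetic-geometric mean inequality gives 2 |f| \<le> |f|^2 (1 + x^2) + 1 / (1 +
  x^2), and both terms are integrable.\<close>

lemma L2_weight_imp_L1:
  fixes f :: "real \<Rightarrow> complex"
  assumes [measurable]: "f \<in> borel_measurable borel" and i: "integrable lborel (\<lambda>x. (cmod (f x))\<^sup>2 * (1 + x\<^sup>2))"
  shows "integrable lborel f"
proof (rule Bochner_Integration.integrable_bound)
  show "integrable lborel (\<lambda>x. (cmod (f x))\<^sup>2 * (1 + x\<^sup>2) + 1 / (1 + x\<^sup>2))"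
    by (intro Bochner_Integration.integrable_add i integrable_inv_1_plus_sq)
  show "AE x in lborel. norm (f x) \<le> norm ((cmod (f x))\<^sup>2 * (1 + x\<^sup>2) + 1 / (1 + x\<^sup>2))"
  proof (rule AE_I2)
    fix x :: real
    have p: "1 + x\<^sup>2 > 0" by (rule add_pos_nonneg) auto
    define s where "s = sqrt (1 + x\<^sup>2)"
    have s: "s > 0" "s\<^sup>2 = 1 + x\<^sup>2" using p by (simp_all add: s_def)
    have "0 \<le> (cmod (f x) * s - 1 / s)\<^sup>2" by simp
    then have "2 * cmod (f x) \<le> (cmod (f x))\<^sup>2 * s\<^sup>2 + 1 / s\<^sup>2"
      using s(1) by (simp add: power2_diff power_mult_distrib power_divide)
    then have "cmod (f x) \<le> (cmod (f x))\<^sup>2 * (1 + x\<^sup>2) + 1 / (1 + x\<^sup>2)" unfolding s(2) using norm_ge_zero[of "f x"] by linarith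
    then show "norm (f x) \<le> norm ((cmod (f x))\<^sup>2 * (1 + x\<^sup>2) + 1 / (1 + x\<^sup>2))" by simp
  qed
qed measurable

lemma FSobolev_integrable: assumes "f \<in> FSobolev"
  shows "integrable lborel f" "integrable lborel (fourier f)"
  using assms by (auto intro!: L2_weight_imp_L1 simp: FSobolev_def borel_measurable_continuous_onI fourier_measurable)

lemma integrable_inner:
  fixes f g :: "real \<Rightarrow> complex"
  assumes [measurable]: "f \<in> borel_measurable borel" "g \<in> borel_measurable borel"
    and f: "integrable lborel (\<lambda>x::real. (cmod (f x))\<^sup>2 * (1 + x\<^sup>2))" and g: "integrable lborel (\<lambda>x. (cmod (g x))\<^sup>2 * (1 + x\<^sup>2))"
  shows "integrable lborel (\<lambda>x. f x * cnj (g x) * of_real (1 + x\<^sup>2))"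
proof (rule Bochner_Integration.integrable_bound)
  show "integrable lborel (\<lambda>x. (cmod (f x))\<^sup>2 * (1 + x\<^sup>2) + (cmod (g x))\<^sup>2 * (1 + x\<^sup>2))"
    by (intro Bochner_Integration.integrable_add f g)
  show "AE x in lborel. norm (f x * cnj (g x) * of_real (1 + x\<^sup>2)) \<le> norm ((cmod (f x))\<^sup>2 * (1 + x\<^sup>2) + (cmod (g x))\<^sup>2 * (1 + x\<^sup>2))"
  proof (rule AE_I2)
    fix x :: real
    have w: "cmod (of_real (1 + x\<^sup>2)) = 1 + x\<^sup>2" by (subst norm_of_real) simp
    have "0 \<le> (cmod (f x) - cmod (g x))\<^sup>2" by simp
    then have "2 * (cmod (f x) * cmod (g x)) \<le> (cmod (f x))\<^sup>2 + (cmod (g x))\<^sup>2" by (simp add: power2_diff)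
    then have "cmod (f x) * cmod (g x) \<le> (cmod (f x))\<^sup>2 + (cmod (g x))\<^sup>2"
      using mult_nonneg_nonneg[OF norm_ge_zero[of "f x"] norm_ge_zero[of "g x"]] by linarith
    then have "cmod (f x) * cmod (g x) * (1 + x\<^sup>2) \<le> ((cmod (f x))\<^sup>2 + (cmod (g x))\<^sup>2) * (1 + x\<^sup>2)"
      by (intro mult_right_mono) auto
    moreover have "0 \<le> (cmod (f x))\<^sup>2 * (1 + x\<^sup>2) + (cmod (g x))\<^sup>2 * (1 + x\<^sup>2)" by simp
    ultimately show "norm (f x * cnj (g x) * of_real (1 + x\<^sup>2)) \<le> norm ((cmod (f x))\<^sup>2 * (1 + x\<^sup>2) + (cmod (g x))\<^sup>2 * (1 + x\<^sup>2))"
      by (simp only: norm_mult complex_mod_cnj w real_norm_def abs_of_nonneg distrib_right)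
  qed
qed measurable

lemma FSobolev_inner_integrable: assumes "f \<in> FSobolev" "g \<in> FSobolev"
  shows "integrable lborel (\<lambda>x. f x * cnj (g x) * of_real (1 + x\<^sup>2))"
    "integrable lborel (\<lambda>x. fourier f x * cnj (fourier g x) * of_real (1 + x\<^sup>2))"
  by (rule integrable_inner; use assms in \<open>auto simp: FSobolev_def borel_measurable_continuous_onI fourier_measurable\<close>)+

lemma fourier_add: assumes "integrable lborel f" "integrable lborel g"
  shows "fourier (f + g) t = fourier f t + fourier g t"
  unfolding fourier_echar using integrable_echar[OF assms(1)] integrable_echar[OF assms(2)] by (simp add: distrib_right)

lemma fourier_fscale: "fourier (fscale c f) t = c * fourier f t"
  unfolding fourier_echar fscale_def by (simp add: mult.assoc)

lemma L2_weight_add: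
  fixes f g :: "real \<Rightarrow> complex"
  assumes [measurable]: "f \<in> borel_measurable borel" "g \<in> borel_measurable borel"
    and f: "integrable lborel (\<lambda>x::real. (cmod (f x))\<^sup>2 * (1 + x\<^sup>2))" and g: "integrable lborel (\<lambda>x. (cmod (g x))\<^sup>2 * (1 + x\<^sup>2))"
  shows "integrable lborel (\<lambda>x. (cmod (f x + g x))\<^sup>2 * (1 + x\<^sup>2))"
proof (rule Bochner_Integration.integrable_bound)
  show "integrable lborel (\<lambda>x. 2 * ((cmod (f x))\<^sup>2 * (1 + x\<^sup>2)) + 2 * ((cmod (g x))\<^sup>2 * (1 + x\<^sup>2)))"
    using f g by simp
  show "AE x in lborel. norm ((cmod (f x + g x))\<^sup>2 * (1 + x\<^sup>2)) \<le> norm (2 * ((cmod (f x))\<^sup>2 * (1 + x\<^sup>2)) + 2 * ((cmod (g x))\<^sup>2 * (1 + x\<^sup>2)))"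
  proof (rule AE_I2)
    fix x :: real
    have "(cmod (f x + g x))\<^sup>2 \<le> (cmod (f x) + cmod (g x))\<^sup>2" by (intro power_mono norm_triangle_ineq) auto
    also have "\<dots> \<le> 2 * (cmod (f x))\<^sup>2 + 2 * (cmod (g x))\<^sup>2"
      using zero_le_power2[of "cmod (f x) - cmod (g x)"] unfolding power2_diff power2_sum by linarith
    finally have "(cmod (f x + g x))\<^sup>2 * (1 + x\<^sup>2) \<le> (2 * (cmod (f x))\<^sup>2 + 2 * (cmod (g x))\<^sup>2) * (1 + x\<^sup>2)"
      by (intro mult_right_mono) auto
    then show "norm ((cmod (f x + g x))\<^sup>2 * (1 + x\<^sup>2)) \<le> norm (2 * ((cmod (f x))\<^sup>2 * (1 + x\<^sup>2)) + 2 * ((cmod (g x))\<^sup>2 * (1 + x\<^sup>2)))"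
      by (simp add: distrib_right mult.assoc)
  qed
qed measurable

lemma subspace_FSobolev: "fun_space.subspace FSobolev"
  unfolding fun_space.subspace_def
proof (intro conjI ballI allI)
  have z: "fourier 0 = (\<lambda>t. 0)" by (simp add: fun_eq_iff fourier_echar)
  show "0 \<in> FSobolev" by (simp add: FSobolev_def z)
next
  fix f g assume f: "f \<in> FSobolev" and g: "g \<in> FSobolev"
  have "fourier (f + g) = (\<lambda>t. fourier f t + fourier g t)"
    using fourier_add[OF FSobolev_integrable(1)[OF f] FSobolev_integrable(1)[OF g]] by auto
  then show "f + g \<in> FSobolev"
    using f g unfolding FSobolev_def
    by (auto simp: plus_fun_def intro!: continuous_intros L2_weight_add borel_measurable_continuous_onI fourier_measurable)
next
  fix c f assume f: "f \<in> FSobolev"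
  have "fourier (fscale c f) = (\<lambda>t. c * fourier f t)" using fourier_fscale by auto
  then show "fscale c f \<in> FSobolev"
    using f unfolding FSobolev_def
    by (auto simp: fscale_def norm_mult power_mult_distrib mult.assoc intro!: continuous_intros)
qed

text \<open>The zero set of a continuous function is closed; having full measure, it is everything.
  This is where working with continuous representatives makes the inner product definite.\<close>

lemma zero_of_integral_zero:
  fixes f :: "real \<Rightarrow> complex"
  assumes c: "continuous_on UNIV f" and i: "integrable lborel (\<lambda>x. (cmod (f x))\<^sup>2 * (1 + x\<^sup>2))"
    and z: "(LINT x|lborel. (cmod (f x))\<^sup>2 * (1 + x\<^sup>2)) = 0"
  shows "f = 0"
proof -
  have "AE x in lborel. (cmod (f x))\<^sup>2 * (1 + x\<^sup>2) = 0"
    using integral_nonneg_eq_0_iff_AE[OF i] z by simp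
  then have "AE x in lborel. x \<in> {x. f x = 0}"
  proof eventually_elim
    case (elim x)
    have "0 < 1 + x\<^sup>2" by (rule add_pos_nonneg) auto
    then show ?case using elim by simp
  qed
  then have "AE x in lebesgue. x \<in> {x. f x = 0}" by (rule AE_completion)
  moreover have "closed {x. f x = 0}" using c by (intro closed_Collect_eq) auto
  ultimately have "x \<in> {x. f x = 0}" for x using mem_closed_if_AE_lebesgue by blast
  then show ?thesis by auto
qed

interpretation FS: complex_semi_inner FSobolev FS_inner
proof
  show "fun_space.subspace FSobolev" by (rule subspace_FSobolev)
  show "FS_inner (f + g) h = FS_inner f h + FS_inner g h"
    if "f \<in> FSobolev" "g \<in> FSobolev" "h \<in> FSobolev" for f g h
    using FSobolev_inner_integrable[OF that(1,3)] FSobolev_inner_integrable[OF that(2,3)]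
    by (simp add: FS_inner_def fourier_add FSobolev_integrable that distrib_right del: of_real_add of_real_power)
  show "FS_inner (fscale c f) h = c * FS_inner f h" for c f h
    unfolding FS_inner_def fourier_fscale by (simp add: fscale_def mult.assoc distrib_left del: of_real_add of_real_power)
  show "FS_inner f g = cnj (FS_inner g f)" for f g
    unfolding FS_inner_def by (simp add: mult.commute flip: Bochner_Integration.integral_cnj)
  have *: "z * cnj z * of_real w = complex_of_real ((cmod z)\<^sup>2 * w)" for z w by (simp only: of_real_mult complex_norm_square)
  show "0 \<le> Re (FS_inner f f)" for f
    unfolding FS_inner_def * integral_complex_of_real by simp
qed

lemma FS_inner_self: "FS_inner f f = of_real ((LINT x|lborel. (cmod (f x))\<^sup>2 * (1 + x\<^sup>2)) + (LINT \<xi>|lborel. (cmod (fourier f \<xi>))\<^sup>2 * (1 + \<xi>\<^sup>2)))"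
proof -
  have *: "z * cnj z * of_real w = complex_of_real ((cmod z)\<^sup>2 * w)" for z w by (simp only: of_real_mult complex_norm_square)
  show ?thesis unfolding FS_inner_def * integral_complex_of_real by simp
qed

lemma FS_inner_eq_0: assumes f: "f \<in> FSobolev" and z: "FS_inner f f = 0" shows "f = 0"
proof (rule zero_of_integral_zero)
  have "(LINT x|lborel. (cmod (f x))\<^sup>2 * (1 + x\<^sup>2)) + (LINT \<xi>|lborel. (cmod (fourier f \<xi>))\<^sup>2 * (1 + \<xi>\<^sup>2)) = 0"
    using z unfolding FS_inner_self by (simp only: of_real_eq_0_iff)
  moreover have "0 \<le> (LINT x|lborel. (cmod (f x))\<^sup>2 * (1 + x\<^sup>2))" "0 \<le> (LINT \<xi>|lborel. (cmod (fourier f \<xi>))\<^sup>2 * (1 + \<xi>\<^sup>2))"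
    by simp_all
  ultimately show "(LINT x|lborel. (cmod (f x))\<^sup>2 * (1 + x\<^sup>2)) = 0" by linarith
qed (use f in \<open>auto simp: FSobolev_def\<close>)

text \<open>The uniqueness that \<open>THE\<close> requires: the difference of two reproducing
  functions is orthogonal to itself.\<close>

lemma FS_kernel_eqI: assumes k: "k \<in> FSobolev" "\<And>f. f \<in> FSobolev \<Longrightarrow> f t = FS_inner f k"
  shows "FS_kernel t = k"
  unfolding FS_kernel_def
proof (rule the_equality)
  fix k' assume k': "k' \<in> FSobolev \<and> (\<forall>f\<in>FSobolev. f t = FS_inner f k')"
  let ?d = "k' - k"
  have d: "?d \<in> FSobolev" using k k' by simp
  have "FS_inner ?d ?d = FS_inner ?d k' - FS_inner ?d k" using d k k' by (intro FS.ip_diff_right) auto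
  also have "\<dots> = 0" using k(2)[OF d] k' d by simp
  finally have "?d = 0" by (rule FS_inner_eq_0[OF d])
  then show "k' = k" by simp
qed (use k in auto)

section \<open>The Fourier transform as a unitary map of the space\<close>

lemma fourier_fourier: assumes f: "f \<in> FSobolev" shows "fourier (fourier f) x = f (- x)"
  using fourier_inversion[OF FSobolev_integrable[OF f], of "- x"] FSobolev_continuous[OF f]
  by (simp add: fourier_echar[of "fourier f"] continuous_on_eq_continuous_at)

lemma LINT_uminus: "(LINT x|lborel. f (- x)) = (LINT x|lborel. f (x::real) :: complex)"
  by (subst (2) lborel_integral_real_affine[of "-1" _ 0]) auto

text \<open>Transforming twice is reflection, which preserves the even weight, so the transform
  merely exchanges the two halves of the norm.\<close>

lemma fourier_FSobolev: assumes f: "f \<in> FSobolev" shows "fourier f \<in> FSobolev"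
proof -
  have "fourier (fourier f) = (\<lambda>x. f (- x))" using fourier_fourier[OF f] by auto
  moreover have "integrable lborel (\<lambda>x. (cmod (f (- x)))\<^sup>2 * (1 + x\<^sup>2))"
    using lborel_integrable_real_affine[of "\<lambda>x. (cmod (f x))\<^sup>2 * (1 + x\<^sup>2)" "-1" 0] f by (simp add: FSobolev_def)
  ultimately show ?thesis using f continuous_fourier[OF FSobolev_integrable(1)[OF f]] by (simp add: FSobolev_def)
qed

lemma FS_inner_fourier: assumes f: "f \<in> FSobolev" and g: "g \<in> FSobolev"
  shows "FS_inner (fourier f) (fourier g) = FS_inner f g"
  unfolding FS_inner_def fourier_fourier[OF f] fourier_fourier[OF g]
  using LINT_uminus[of "\<lambda>x. f x * cnj (g x) * of_real (1 + x\<^sup>2)"] by simp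

definition inv_fourier :: "(real \<Rightarrow> complex) \<Rightarrow> real \<Rightarrow> complex" where
  "inv_fourier f x = fourier f (- x)"

lemma fourier_reflect: "fourier (\<lambda>x. f (- x)) t = fourier f (- t)"
  unfolding fourier_echar using LINT_uminus[of "\<lambda>x. f x * echar (- t) x"] by (simp add: echar_def)

lemma fourier_inv: assumes f: "f \<in> FSobolev"
  shows "fourier (inv_fourier f) = f"
  using fourier_fourier[OF f] by (simp add: fun_eq_iff inv_fourier_def[abs_def] fourier_reflect)

lemma inv_fourier_FSobolev: assumes f: "f \<in> FSobolev" shows "inv_fourier f \<in> FSobolev"
proof -
  have "fourier (inv_fourier f) = f" by (rule fourier_inv[OF f])
  moreover have "continuous_on UNIV (inv_fourier f)" unfolding inv_fourier_def[abs_def]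
    by (rule continuous_on_compose2[OF continuous_fourier[OF FSobolev_integrable(1)[OF f]]]) (auto intro!: continuous_intros)
  moreover have "integrable lborel (\<lambda>x. (cmod (inv_fourier f x))\<^sup>2 * (1 + x\<^sup>2))"
    using lborel_integrable_real_affine[of "\<lambda>x. (cmod (fourier f x))\<^sup>2 * (1 + x\<^sup>2)" "-1" 0] f
    by (simp add: FSobolev_def inv_fourier_def)
  ultimately show ?thesis using f by (simp add: FSobolev_def)
qed

lemma FS_inner_inv: assumes f: "f \<in> FSobolev" and g: "g \<in> FSobolev"
  shows "FS_inner (inv_fourier f) g = FS_inner f (fourier g)"
  using FS_inner_fourier[OF inv_fourier_FSobolev[OF f] g] by (simp add: fourier_inv[OF f])

text \<open>Quadratic pointwise decay makes the squared function times the weight at most a constant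
  over 1 + x^2. Kernels and their superpositions enter the space through this test.\<close>

lemma FSobolev_criterion:
  assumes c: "continuous_on UNIV f" and A: "\<And>x. (1 + x\<^sup>2) * cmod (f x) \<le> A" and B: "\<And>x. (1 + x\<^sup>2) * cmod (fourier f x) \<le> B"
  shows "f \<in> FSobolev"
proof -
  have *: "integrable lborel (\<lambda>x::real. (cmod (g x))\<^sup>2 * (1 + x\<^sup>2))"
    if [measurable]: "g \<in> borel_measurable borel" and C: "\<And>x. (1 + x\<^sup>2) * cmod (g x) \<le> C" for g :: "real \<Rightarrow> complex" and C
  proof (rule Bochner_Integration.integrable_bound)
    show "integrable lborel (\<lambda>x::real. C\<^sup>2 * (1 / (1 + x\<^sup>2)))" using integrable_inv_1_plus_sq by (rule integrable_mult_right)
    show "AE x in lborel. norm ((cmod (g x))\<^sup>2 * (1 + x\<^sup>2)) \<le> norm (C\<^sup>2 * (1 / (1 + x\<^sup>2)))"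
    proof (rule AE_I2)
      fix x :: real
      have p: "1 + x\<^sup>2 > 0" by (rule add_pos_nonneg) auto
      have "((1 + x\<^sup>2) * cmod (g x))\<^sup>2 \<le> C\<^sup>2" using C[of x] by (intro power_mono) auto
      then have "(cmod (g x))\<^sup>2 * (1 + x\<^sup>2) * (1 + x\<^sup>2) \<le> C\<^sup>2" by (simp only: power_mult_distrib power2_eq_square[of "1 + x\<^sup>2"] mult_ac)
      then have "(cmod (g x))\<^sup>2 * (1 + x\<^sup>2) \<le> C\<^sup>2 / (1 + x\<^sup>2)" using p by (simp only: pos_le_divide_eq)
      then show "norm ((cmod (g x))\<^sup>2 * (1 + x\<^sup>2)) \<le> norm (C\<^sup>2 * (1 / (1 + x\<^sup>2)))" by simp
    qed
  qed measurable
  have [measurable]: "f \<in> borel_measurable borel" using c by (rule borel_measurable_continuous_onI)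
  have "fourier f \<in> borel_measurable borel" by (rule fourier_measurable) fact
  then show ?thesis unfolding FSobolev_def using c *[OF _ A] *[OF _ B] \<open>f \<in> borel_measurable borel\<close> by blast
qed

section \<open>The Mehler kernel\<close>

text \<open>With \<open>v\<^sup>2 = tanh (\<tau> / 2)\<close> the first three functions are \<open>tanh \<tau>\<close>, \<open>sech \<tau>\<close> and \<open>exp (- \<tau>)\<close>, and
  \<open>mehler_weight\<close> absorbs the prefactor of Mehler's kernel and the Jacobian \<open>d\<tau> / dv\<close>. The division by
  \<open>mehler_tanh v\<close> is harmless at \<open>v = 0\<close>, where the weight vanishes.\<close>

definition mehler_tanh :: "real \<Rightarrow> real" where "mehler_tanh v = 2 * v\<^sup>2 / (1 + v^4)"
definition mehler_sech :: "real \<Rightarrow> real" where "mehler_sech v = (1 - v^4) / (1 + v^4)"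
definition mehler_exp :: "real \<Rightarrow> real" where "mehler_exp v = (1 - v\<^sup>2) / (1 + v\<^sup>2)"
definition mehler_weight :: "real \<Rightarrow> real" where
  "mehler_weight v = (if 0 < v \<and> v < 1 then 2 * sqrt 2 * pi * mehler_exp v powr (2 * pi) / sqrt (1 - v^4) else 0)"
definition mehler_gauss :: "real \<Rightarrow> real \<Rightarrow> real \<Rightarrow> real" where
  "mehler_gauss v t x = exp (- (pi * (x\<^sup>2 + t\<^sup>2 - 2 * mehler_sech v * x * t) / mehler_tanh v))"
definition mehler :: "real \<Rightarrow> real \<Rightarrow> complex" where
  "mehler t x = of_real (LINT v|lborel. mehler_weight v * mehler_gauss v t x)"

lemma measurable_pqr[measurable]: "mehler_tanh \<in> borel_measurable borel" "mehler_sech \<in> borel_measurable borel" "mehler_exp \<in> borel_measurable borel"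
  unfolding mehler_tanh_def[abs_def] mehler_sech_def[abs_def] mehler_exp_def[abs_def] by measurable

lemma measurable_mehler_weight[measurable]: "mehler_weight \<in> borel_measurable borel"
  unfolding mehler_weight_def[abs_def] by measurable

lemma measurable_mehler_gauss[measurable]: 
  assumes [measurable]: "a \<in> borel_measurable M" "b \<in> borel_measurable M" "c \<in> borel_measurable M"
  shows "(\<lambda>y. mehler_gauss (a y) (b y) (c y)) \<in> borel_measurable M"
  unfolding mehler_gauss_def[abs_def] by measurable

lemma four_pos: "0 < 1 + (v::real)^4" "1 + v^4 \<noteq> 0" "0 < 1 + v\<^sup>2" "1 + v\<^sup>2 \<noteq> 0"
proof -
  have "0 \<le> v^4" "0 \<le> v\<^sup>2" by simp_all
  then show "0 < 1 + v^4" "1 + v^4 \<noteq> 0" "0 < 1 + v\<^sup>2" "1 + v\<^sup>2 \<noteq> 0" by linarith+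
qed

context
  fixes v :: real assumes v: "0 < v" "v < 1"
begin

lemma v_lt: "v\<^sup>2 < 1" "v^4 < 1"
  using v by (simp_all add: power_less_one_iff)

lemma mehler_tanh_pos: "0 < mehler_tanh v" using v four_pos[of v] by (simp add: mehler_tanh_def)
lemma mehler_sech_pos: "0 < mehler_sech v" using v_lt four_pos[of v] by (simp add: mehler_sech_def)
lemma mehler_exp_pos: "0 < mehler_exp v" using v_lt four_pos[of v] by (simp add: mehler_exp_def)

lemma pq: "(mehler_tanh v)\<^sup>2 + (mehler_sech v)\<^sup>2 = 1"
proof -
  have "(2 * v\<^sup>2)\<^sup>2 + (1 - v^4)\<^sup>2 = (1 + v^4)\<^sup>2" by algebra
  then show ?thesis using four_pos[of v] by (simp add: mehler_tanh_def mehler_sech_def power_divide add_divide_distrib[symmetric])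
qed

lemma mehler_tanh_le_1: "mehler_tanh v \<le> 1"
proof -
  have "(mehler_tanh v)\<^sup>2 \<le> 1\<^sup>2" using pq zero_le_power2[of "mehler_sech v"] unfolding one_power2 by linarith
  then show ?thesis by (rule power2_le_imp_le) simp
qed

lemma mehler_sech_le_1: "mehler_sech v \<le> 1"
proof -
  have "(mehler_sech v)\<^sup>2 \<le> 1\<^sup>2" using pq zero_le_power2[of "mehler_tanh v"] unfolding one_power2 by linarith
  then show ?thesis by (rule power2_le_imp_le) simp
qed

text \<open>The half-angle formula (1 - sech \<tau>) / tanh \<tau> = tanh (\<tau> / 2); it turns the
  kernel on the diagonal into a pure Gaussian in v.\<close>

lemma one_minus_q_over_p: "(1 - mehler_sech v) / mehler_tanh v = v\<^sup>2"
proof -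
  define d where "d = 1 + v^4"
  have d: "d \<noteq> 0" using four_pos[of v] by (simp add: d_def)
  have v4: "v^4 = v\<^sup>2 * v\<^sup>2" by algebra
  have "1 - mehler_sech v = (d - (1 - v^4)) / d" unfolding mehler_sech_def d_def[symmetric] using d by (simp add: diff_divide_distrib)
  also have "d - (1 - v^4) = 2 * v\<^sup>2 * v\<^sup>2" unfolding d_def v4 by simp
  finally show ?thesis unfolding mehler_tanh_def d_def[symmetric] using d v by simp
qed

lemma mehler_weight_eq: "mehler_weight v = 2 * sqrt 2 * pi * mehler_exp v powr (2 * pi) / sqrt (1 - v^4)"
  using v by (simp add: mehler_weight_def)

text \<open>Only v near 1 is critical, that is, large time: there exp (- 2 * pi * \<tau>) \<le> exp
  (- \<tau>) \<le> sqrt (1 - v^4) compensates the denominator.\<close>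

lemma mehler_weight_le: "mehler_weight v \<le> 2 * sqrt 2 * pi"
proof -
  have r1: "mehler_exp v \<le> 1" using four_pos[of v] by (simp add: mehler_exp_def)
  have "2 * pi \<ge> 1" using pi_gt3 by simp
  then have "mehler_exp v powr (2 * pi) \<le> mehler_exp v powr 1" using r1 mehler_exp_pos by (intro powr_mono') auto
  also have "\<dots> = mehler_exp v" using mehler_exp_pos by simp
  also have "mehler_exp v \<le> sqrt (1 - v^4)"
  proof (rule real_le_rsqrt)
    have f: "1 - v^4 = (1 - v\<^sup>2) * (1 + v\<^sup>2)" by algebra
    have "(mehler_exp v)\<^sup>2 \<le> mehler_exp v" using r1 mehler_exp_pos by (simp add: power2_eq_square mult_left_le)
    also have "mehler_exp v \<le> 1 - v\<^sup>2" using v_lt four_pos[of v] unfolding mehler_exp_def by (simp add: divide_le_eq mult_le_cancel_left1)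
    also have "\<dots> \<le> 1 - v^4" unfolding f using v_lt by (simp add: mult_le_cancel_left1)
    finally show "(mehler_exp v)\<^sup>2 \<le> 1 - v^4" .
  qed
  finally have "mehler_exp v powr (2 * pi) / sqrt (1 - v^4) \<le> 1" using v_lt by simp
  then have "2 * sqrt 2 * pi * (mehler_exp v powr (2 * pi) / sqrt (1 - v^4)) \<le> 2 * sqrt 2 * pi * 1"
    by (intro mult_left_mono) auto
  then show ?thesis by (simp add: mehler_weight_eq)
qed

lemma mehler_weight_pos: "0 < mehler_weight v"
  using mehler_exp_pos v_lt by (simp add: mehler_weight_eq)

text \<open>Completing the square in x with tanh^2 + sech^2 = 1. As a function of x the kernel is a
  Gaussian centred at \<open>mehler_sech v * t\<close>, so its transform is explicit.\<close>

lemma mehler_gauss_shift: "mehler_gauss v t x = exp (- (pi * mehler_tanh v * t\<^sup>2)) * gauss (1 / mehler_tanh v) (x - mehler_sech v * t)"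
proof -
  have "pi * (x\<^sup>2 + t\<^sup>2 - 2 * mehler_sech v * x * t) / mehler_tanh v = pi * mehler_tanh v * t\<^sup>2 + pi * (1 / mehler_tanh v) * (x - mehler_sech v * t)\<^sup>2"
  proof -
    have "x\<^sup>2 + t\<^sup>2 - 2 * mehler_sech v * x * t = (mehler_tanh v)\<^sup>2 * t\<^sup>2 + (x - mehler_sech v * t)\<^sup>2"
      using pq by algebra
    then show ?thesis using mehler_tanh_pos by (simp add: add_divide_distrib distrib_left power2_eq_square)
  qed
  then show ?thesis by (simp add: mehler_gauss_def gauss_def exp_add[symmetric])
qed

text \<open>The quadratic form is a convex combination of (x - t)^2 and x^2 + t^2, both at least (x
  - t)^2 / 2, and dividing by \<open>mehler_tanh v \<le> 1\<close> only enlarges it. The bound no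
  longer depends on v.\<close>

lemma mehler_gauss_le: "mehler_gauss v t x \<le> gauss (1/2) (x - t)"
proof -
  let ?Q = "x\<^sup>2 + t\<^sup>2 - 2 * mehler_sech v * x * t"
  have q: "0 \<le> mehler_sech v" "mehler_sech v \<le> 1" using mehler_sech_pos mehler_sech_le_1 by auto
  have "?Q = mehler_sech v * (x - t)\<^sup>2 + (1 - mehler_sech v) * (x\<^sup>2 + t\<^sup>2)" by algebra
  moreover have s: "(x - t)\<^sup>2 + (x + t)\<^sup>2 = 2 * (x\<^sup>2 + t\<^sup>2)" by algebra
  have "(x - t)\<^sup>2 \<le> 2 * (x\<^sup>2 + t\<^sup>2)" unfolding s[symmetric] by simp
  then have "(x - t)\<^sup>2 / 2 \<le> x\<^sup>2 + t\<^sup>2" by simp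
  then have "(1 - mehler_sech v) * ((x - t)\<^sup>2 / 2) \<le> (1 - mehler_sech v) * (x\<^sup>2 + t\<^sup>2)" using q by (intro mult_left_mono) auto
  moreover have "mehler_sech v * ((x - t)\<^sup>2 / 2) \<le> mehler_sech v * (x - t)\<^sup>2" using q by (intro mult_left_mono) auto
  ultimately have "mehler_sech v * ((x - t)\<^sup>2 / 2) + (1 - mehler_sech v) * ((x - t)\<^sup>2 / 2) \<le> ?Q" by simp
  moreover have "mehler_sech v * ((x - t)\<^sup>2 / 2) + (1 - mehler_sech v) * ((x - t)\<^sup>2 / 2) = (x - t)\<^sup>2 / 2"
    unfolding distrib_right[symmetric] by simp
  ultimately have Q: "(x - t)\<^sup>2 / 2 \<le> ?Q" by simp
  then have "0 \<le> ?Q" using zero_le_power2[of "x - t"] by linarith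
  then have "?Q \<le> ?Q / mehler_tanh v" using mehler_tanh_le_1 mehler_tanh_pos by (simp add: le_divide_eq mult_left_le)
  then have "(x - t)\<^sup>2 / 2 \<le> ?Q / mehler_tanh v" using Q by linarith
  then have "pi * ((x - t)\<^sup>2 / 2) \<le> pi * (?Q / mehler_tanh v)" by (intro mult_left_mono) auto
  then show ?thesis by (simp add: mehler_gauss_def gauss_def)
qed

definition "mehler_gauss_hat \<xi> t = complex_of_real (sqrt (mehler_tanh v) * exp (- (pi * mehler_tanh v * (\<xi>\<^sup>2 + t\<^sup>2)))) * echar \<xi> (mehler_sech v * t)"

text \<open>After translation by q * t the integrals are those of \<open>gaussian_moment\<close>
  with a = 1 / p. The second formula has the shape of a second moment of a complex Gaussian with
  mean q * t - \<i> * p * \<xi> and variance p / (2 * pi).\<close>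

lemma mehler_gauss_fourier:
  shows "(LINT x|lborel. complex_of_real (mehler_gauss v t x) * echar \<xi> x) = mehler_gauss_hat \<xi> t" (is ?A)
    and "(LINT x|lborel. complex_of_real ((1 + x\<^sup>2) * mehler_gauss v t x) * echar \<xi> x)
         = (1 + of_real (mehler_tanh v / (2 * pi)) + (of_real (mehler_sech v * t) - \<i> * of_real (mehler_tanh v * \<xi>))\<^sup>2) * mehler_gauss_hat \<xi> t" (is ?B)
proof -
  define p q where "p = mehler_tanh v" and "q = mehler_sech v"
  define a where "a = 1 / p"
  have p: "0 < p" using mehler_tanh_pos by (simp add: p_def)
  have a: "0 < a" using p by (simp add: a_def)
  define I where "I = complex_of_real (exp (- (pi * \<xi>\<^sup>2 / a)) / sqrt a)"
  define c where "c = complex_of_real (exp (- (pi * p * t\<^sup>2))) * echar \<xi> (q * t)"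
  let ?G = "\<lambda>y. complex_of_real (gauss a y) * echar \<xi> y"
  note mom = gaussian_moment[OF a, of \<xi>, folded I_def]
  have I0: "(LINT y|lborel. ?G y) = I" unfolding I_def by (rule gaussian_fourier[OF a])
  have "exp (- (pi * p * t\<^sup>2)) * (exp (- (pi * \<xi>\<^sup>2 / a)) / sqrt a) = sqrt p * exp (- (pi * p * (\<xi>\<^sup>2 + t\<^sup>2)))"
    using p by (simp add: a_def real_sqrt_divide exp_add[symmetric] algebra_simps)
  then have h: "complex_of_real (exp (- (pi * p * t\<^sup>2))) * I = of_real (sqrt p * exp (- (pi * p * (\<xi>\<^sup>2 + t\<^sup>2))))"
    unfolding I_def of_real_mult[symmetric] by (simp only:)
  have "c * I = (complex_of_real (exp (- (pi * p * t\<^sup>2))) * I) * echar \<xi> (q * t)" by (simp add: c_def)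
  also have "\<dots> = mehler_gauss_hat \<xi> t" unfolding h mehler_gauss_hat_def p_def[symmetric] q_def[symmetric] by (rule refl)
  finally have cI: "c * I = mehler_gauss_hat \<xi> t" .
  have sh: "complex_of_real (mehler_gauss v t (q * t + 1 * y)) * echar \<xi> (q * t + 1 * y) = c * ?G y" for y
    unfolding mehler_gauss_shift c_def by (simp add: echar_add p_def[symmetric] q_def[symmetric] a_def[symmetric])
  have "(LINT x|lborel. complex_of_real (mehler_gauss v t x) * echar \<xi> x) = (LINT y|lborel. c * ?G y)"
    by (subst lborel_integral_real_affine[of 1 _ "q * t"]) (simp_all only: sh, simp_all)
  also have "\<dots> = c * I" by (simp add: I0)
  finally show ?A using cI by simp
  have sh2: "complex_of_real ((1 + (q * t + 1 * y)\<^sup>2) * mehler_gauss v t (q * t + 1 * y)) * echar \<xi> (q * t + 1 * y)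
      = c * ((1 + of_real (q * t)^2) * ?G y + 2 * of_real (q * t) * (of_real y * ?G y) + of_real (y\<^sup>2) * ?G y)" for y
  proof -
    have "complex_of_real ((1 + (q * t + 1 * y)\<^sup>2) * mehler_gauss v t (q * t + 1 * y)) * echar \<xi> (q * t + 1 * y)
      = of_real (1 + (q * t + 1 * y)\<^sup>2) * (c * ?G y)"
      unfolding sh[symmetric] by simp
    also have "\<dots> = c * ((1 + of_real (q * t)^2) * ?G y + 2 * of_real (q * t) * (of_real y * ?G y) + of_real (y\<^sup>2) * ?G y)"
      by (simp add: power2_sum algebra_simps)
    finally show ?thesis .
  qed
  have "(LINT x|lborel. complex_of_real ((1 + x\<^sup>2) * mehler_gauss v t x) * echar \<xi> x) =
    (LINT y|lborel. c * ((1 + of_real (q * t)^2) * ?G y + 2 * of_real (q * t) * (of_real y * ?G y) + of_real (y\<^sup>2) * ?G y))"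
    by (subst lborel_integral_real_affine[of 1 _ "q * t"]) (simp_all only: sh2, simp_all)
  also have "\<dots> = c * ((1 + of_real (q * t)^2) * (LINT y|lborel. ?G y)
      + 2 * of_real (q * t) * (LINT y|lborel. of_real y * ?G y) + (LINT y|lborel. of_real (y\<^sup>2) * ?G y))"
    using mom(3-5)
    by (subst integral_mult_right_zero, subst Bochner_Integration.integral_add, simp, simp,
        subst Bochner_Integration.integral_add, simp, simp, simp)
  also have "\<dots> = c * ((1 + of_real (q * t)^2) * I
      + 2 * of_real (q * t) * (- (\<i> * of_real (\<xi> / a)) * I) + of_real (1 / (2 * pi * a) - \<xi>\<^sup>2 / a\<^sup>2) * I)"
    unfolding mom(1,2) I0 ..
  also have "\<dots> = (1 + of_real (p / (2 * pi)) + (of_real (q * t) - \<i> * of_real (p * \<xi>))\<^sup>2) * (c * I)"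
    using p by (simp add: a_def power2_diff power_divide power_mult_distrib) (simp add: algebra_simps power2_eq_square)
  finally show ?B unfolding cI p_def q_def .
qed

end

section \<open>Bounds, continuity and integrability of the kernel\<close>

abbreviation (input) mehler_weight_max :: real where "mehler_weight_max \<equiv> 2 * sqrt 2 * pi"

lemma mehler_weight_nonneg: "0 \<le> mehler_weight v"
  using mehler_weight_pos[of v] by (cases "0 < v \<and> v < 1") (auto simp: mehler_weight_def)

lemma mehler_weight_le_indicator: "mehler_weight v \<le> mehler_weight_max * indicator {0<..<1} v"
  using mehler_weight_le[of v] by (cases "0 < v \<and> v < 1") (auto simp: mehler_weight_def indicator_def)

lemma mehler_gauss_nonneg: "0 \<le> mehler_gauss v t x" by (simp add: mehler_gauss_def)

lemma mehler_weight_mehler_gauss_bound: "mehler_weight v * mehler_gauss v t x \<le> mehler_weight_max * indicator {0<..<1} v * gauss (1/2) (x - t)"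
proof (cases "0 < v \<and> v < 1")
  case True
  then show ?thesis using mehler_weight_le_indicator[of v] mehler_gauss_le[of v t x] mehler_gauss_nonneg by (intro mult_mono) auto
qed (auto simp: mehler_weight_def)

lemma gauss_le_1: "0 \<le> a \<Longrightarrow> gauss a y \<le> 1"
  by (simp add: gauss_def)

lemma mehler_weight_mehler_gauss_bound': "mehler_weight v * mehler_gauss v t x \<le> mehler_weight_max * indicator {0<..<1} v"
proof -
  have "mehler_weight_max * indicator {0<..<1} v * gauss (1/2) (x - t) \<le> mehler_weight_max * indicator {0<..<1} v * 1"
    by (intro mult_left_mono gauss_le_1) auto
  then show ?thesis using mehler_weight_mehler_gauss_bound[of v t x] by linarith
qed

lemma integrable_ind: "integrable lborel (indicator {0<..<1} :: real \<Rightarrow> real)"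
  by (simp add: integrable_indicator_iff)

text \<open>The factor 2 + 2 * t^2 is the cost of recentring the weight from x to x - t, and 1 + 4 /
  pi is the constant of \<open>gauss_poly_bound\<close> for a = 1 / 2.\<close>

definition weight_const :: "real \<Rightarrow> real" where "weight_const t = (2 + 2 * t\<^sup>2) * (1 + 4 / pi)"

lemma weight_const_pos: "0 < weight_const t" "0 \<le> weight_const t"
proof -
  have "0 < 2 + 2 * t\<^sup>2" by (rule add_pos_nonneg) auto
  moreover have "0 < 1 + 4 / pi" by (rule add_pos_nonneg) auto
  ultimately show "0 < weight_const t" unfolding weight_const_def by (rule mult_pos_pos)
  then show "0 \<le> weight_const t" by simp
qed

lemma weight_gauss_bound: "(1 + x\<^sup>2) * gauss (1/2) (x - t) \<le> weight_const t * gauss (1/4) (x - t)"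
proof -
  define y where "y = x - t"
  have "(1 + x\<^sup>2) \<le> (2 + 2 * t\<^sup>2) * (1 + y\<^sup>2)"
  proof -
    have "(2 + 2 * t\<^sup>2) * (1 + y\<^sup>2) - (1 + x\<^sup>2) = 1 + (y - t)\<^sup>2 + 2 * t\<^sup>2 * y\<^sup>2"
      unfolding y_def by algebra
    moreover have "0 \<le> 1 + (y - t)\<^sup>2 + 2 * t\<^sup>2 * y\<^sup>2" by simp
    ultimately show ?thesis by linarith
  qed
  then have "(1 + x\<^sup>2) * gauss (1/2) y \<le> (2 + 2 * t\<^sup>2) * (1 + y\<^sup>2) * gauss (1/2) y" by (intro mult_right_mono) auto
  also have "\<dots> = (2 + 2 * t\<^sup>2) * ((1 + y\<^sup>2) * gauss (1/2) y)" by simp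
  also have "\<dots> \<le> (2 + 2 * t\<^sup>2) * ((1 + 4 / pi) * gauss (1/4) y)"
    using gauss_poly_bound[of "1/2" y] by (intro mult_left_mono) auto
  finally show ?thesis by (simp add: weight_const_def y_def mult.assoc)
qed

lemma integrable_gauss_shift: "0 < a \<Longrightarrow> integrable lborel (\<lambda>x. gauss a (x - t))"
  using lborel_integrable_real_affine[OF integrable_gauss, of a 1 "-t"] by simp

lemma integral_gauss_shift: "0 < a \<Longrightarrow> (LINT x|lborel. gauss a (x - t)) = 1 / sqrt a"
  using lborel_integral_real_affine[of 1 "\<lambda>x. gauss a (x - t)" t] integral_gauss[of a] by simp

text \<open>The majorant is a product of an integrable function of v and one of x, so it serves
  domination in v as well as the exchange of the two integrals.\<close>

lemma weighted_kernel_bound: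
  assumes P: "\<And>x. cmod (P x) \<le> 1 + x\<^sup>2"
  shows "cmod (P x * of_real (mehler_weight v * mehler_gauss v t x)) \<le> mehler_weight_max * indicator {0<..<1} v * (weight_const t * gauss (1/4) (x - t))"
proof -
  have "cmod (P x * of_real (mehler_weight v * mehler_gauss v t x)) = cmod (P x) * (mehler_weight v * mehler_gauss v t x)"
    by (simp add: norm_mult mehler_weight_nonneg mehler_gauss_nonneg del: of_real_mult)
  also have "\<dots> \<le> (1 + x\<^sup>2) * (mehler_weight_max * indicator {0<..<1} v * gauss (1/2) (x - t))"
    by (intro mult_mono P mehler_weight_mehler_gauss_bound) (simp_all add: mehler_weight_nonneg mehler_gauss_nonneg)
  also have "\<dots> = mehler_weight_max * indicator {0<..<1} v * ((1 + x\<^sup>2) * gauss (1/2) (x - t))" by simp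
  also have "\<dots> \<le> mehler_weight_max * indicator {0<..<1} v * (weight_const t * gauss (1/4) (x - t))"
    by (intro mult_left_mono weight_gauss_bound) simp
  finally show ?thesis .
qed

lemma mehler_weight_mehler_gauss_integrable: "integrable lborel (\<lambda>v. mehler_weight v * mehler_gauss v t x)"
proof (rule Bochner_Integration.integrable_bound)
  show "integrable lborel (\<lambda>v::real. mehler_weight_max * indicator {0<..<1} v :: real)" using integrable_ind by simp
  show "AE v in lborel. norm (mehler_weight v * mehler_gauss v t x) \<le> norm (mehler_weight_max * indicator {0<..<1} v)"
    using mehler_weight_mehler_gauss_bound'[of _ t x] by (intro AE_I2) (simp add: mehler_weight_nonneg mehler_gauss_nonneg)
qed measurable

lemma mehler_eq: "mehler t x = (LINT v|lborel. complex_of_real (mehler_weight v * mehler_gauss v t x))"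
  unfolding mehler_def integral_complex_of_real ..

lemma mehler_commute: "mehler t x = mehler x t"
  by (simp add: mehler_def mehler_gauss_def add.commute mult_ac)

lemma mehler_weight_bound: "(1 + x\<^sup>2) * cmod (mehler t x) \<le> mehler_weight_max * weight_const t * gauss (1/4) (x - t)"
proof -
  have "(1 + x\<^sup>2) * cmod (mehler t x) = cmod (LINT v|lborel. complex_of_real (1 + x\<^sup>2) * of_real (mehler_weight v * mehler_gauss v t x))"
  proof -
    have "cmod (complex_of_real (1 + x\<^sup>2)) = 1 + x\<^sup>2" by (subst norm_of_real) simp
    then show ?thesis unfolding mehler_eq by (simp only: integral_mult_right_zero norm_mult)
  qed
  also have "\<dots> \<le> (LINT v::real|lborel. mehler_weight_max * indicator {0<..<1} v * (weight_const t * gauss (1/4) (x - t)))"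
  proof (rule Bochner_Integration.integral_norm_bound_integral)
    show "integrable lborel (\<lambda>v. complex_of_real (1 + x\<^sup>2) * of_real (mehler_weight v * mehler_gauss v t x))"
      using mehler_weight_mehler_gauss_integrable by (intro integrable_mult_right) (simp add: complex_of_real_integrable_eq del: of_real_mult)
    show "integrable lborel (\<lambda>v::real. mehler_weight_max * indicator {0<..<1} v * (weight_const t * gauss (1/4) (x - t)))"
      using integrable_ind by simp
    show "cmod (complex_of_real (1 + x\<^sup>2) * of_real (mehler_weight v * mehler_gauss v t x)) \<le> mehler_weight_max * indicator {0<..<1} v * (weight_const t * gauss (1/4) (x - t))" for v
      by (rule weighted_kernel_bound[of "\<lambda>x. complex_of_real (1 + x\<^sup>2)"]) (subst norm_of_real, simp)
  qed
  also have "\<dots> = mehler_weight_max * weight_const t * gauss (1/4) (x - t)" by simp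
  finally show ?thesis .
qed

lemma mehler_weight_bound': "(1 + x\<^sup>2) * cmod (mehler t x) \<le> mehler_weight_max * weight_const t"
proof -
  have "mehler_weight_max * weight_const t * gauss (1/4) (x - t) \<le> mehler_weight_max * weight_const t * 1"
    using weight_const_pos[of t] by (intro mult_left_mono gauss_le_1) auto
  then show ?thesis using mehler_weight_bound[of x t] by linarith
qed

text \<open>The integrand is continuous in (t, x) and dominated by a multiple of the indicator of
  (0, 1) that does not depend on (t, x).\<close>

lemma mehler_joint_continuous: "continuous_on UNIV (\<lambda>(t, x). mehler t x)"
proof -
  have "continuous_on UNIV (\<lambda>p. LINT v|lborel. complex_of_real (mehler_weight v * mehler_gauss v (fst p) (snd p)))"
  proof (rule continuous_LINT)
    show "integrable lborel (\<lambda>v::real. mehler_weight_max * indicator {0<..<1} v :: real)" using integrable_ind by simp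
    show "norm (complex_of_real (mehler_weight v * mehler_gauss v (fst p) (snd p))) \<le> mehler_weight_max * indicator {0<..<1} v" for p v
      using mehler_weight_mehler_gauss_bound'[of v "fst p" "snd p"] by (simp add: mehler_weight_nonneg mehler_gauss_nonneg del: of_real_mult)
    show "continuous_on UNIV (\<lambda>p. complex_of_real (mehler_weight v * mehler_gauss v (fst p) (snd p)))" for v
      unfolding mehler_gauss_def divide_inverse by (intro continuous_intros)
  qed measurable
  then show ?thesis by (simp add: mehler_eq case_prod_beta')
qed

lemma mehler_continuous: "continuous_on UNIV (mehler t)"
proof -
  have "continuous_on UNIV (\<lambda>x. case (t, x) of (t, x) \<Rightarrow> mehler t x)"
    by (rule continuous_on_compose2[OF mehler_joint_continuous]) (auto intro!: continuous_intros)
  then show ?thesis by (simp add: eta_contract_eq)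
qed

lemma measurable_mehler[measurable]:
  assumes [measurable]: "f \<in> borel_measurable M" "g \<in> borel_measurable M"
  shows "(\<lambda>x. mehler (f x) (g x)) \<in> borel_measurable M"
proof -
  have "(\<lambda>(t, x). mehler t x) \<in> borel_measurable borel" by (rule borel_measurable_continuous_onI[OF mehler_joint_continuous])
  then have [measurable]: "(\<lambda>(t, x). mehler t x) \<in> borel_measurable (borel \<Otimes>\<^sub>M borel)" by (simp add: borel_prod)
  have "(\<lambda>x. case (f x, g x) of (t, x) \<Rightarrow> mehler t x) \<in> borel_measurable M" by measurable
  then show ?thesis by simp
qed

lemma mehler_weighted_integrable:
  assumes [measurable]: "P \<in> borel_measurable borel" and P: "\<And>x. cmod (P x) \<le> 1 + x\<^sup>2"
  shows "integrable lborel (\<lambda>x. P x * mehler t x)"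
proof (rule Bochner_Integration.integrable_bound)
  show "integrable lborel (\<lambda>x. mehler_weight_max * weight_const t * gauss (1/4) (x - t))" using integrable_gauss_shift[of "1/4" t] by simp
  show "AE x in lborel. norm (P x * mehler t x) \<le> norm (mehler_weight_max * weight_const t * gauss (1/4) (x - t))"
  proof (rule AE_I2)
    fix x
    have "norm (P x * mehler t x) \<le> (1 + x\<^sup>2) * cmod (mehler t x)" by (simp add: norm_mult mult_right_mono P)
    also have "\<dots> \<le> mehler_weight_max * weight_const t * gauss (1/4) (x - t)" by (rule mehler_weight_bound)
    finally show "norm (P x * mehler t x) \<le> norm (mehler_weight_max * weight_const t * gauss (1/4) (x - t))" using weight_const_pos[of t] by simp
  qed
qed measurable

lemma mehler_fubini:
  assumes [measurable]: "P \<in> borel_measurable borel" and P: "\<And>x. cmod (P x) \<le> 1 + x\<^sup>2"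
  shows "(LINT x|lborel. P x * mehler t x) = (LINT v|lborel. of_real (mehler_weight v) * (LINT x|lborel. P x * of_real (mehler_gauss v t x)))"
    and "integrable lborel (\<lambda>v. of_real (mehler_weight v) * (LINT x|lborel. P x * of_real (mehler_gauss v t x)))"
proof -
  let ?F = "\<lambda>(x, v). P x * complex_of_real (mehler_weight v * mehler_gauss v t x)"
  let ?b = "\<lambda>x (v::real). mehler_weight_max * indicator {0<..<1} v * (weight_const t * gauss (1/4) (x - t)) :: real"
  note bnd = weighted_kernel_bound[of P, OF P]
  have bi: "integrable lborel (?b x)" for x using integrable_ind by simp
  have Fi: "integrable lborel (\<lambda>v. ?F (x, v))" for x
  proof (rule Bochner_Integration.integrable_bound[OF bi[of x]])
    show "(\<lambda>v. ?F (x, v)) \<in> borel_measurable lborel" unfolding prod.case by measurable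
    show "AE v in lborel. norm (?F (x, v)) \<le> norm (?b x v)"
    proof (rule AE_I2)
      fix v
      have "0 \<le> ?b x v" using weight_const_pos[of t] by simp
      then show "norm (?F (x, v)) \<le> norm (?b x v)" using bnd[of x v t] by (simp del: of_real_mult)
    qed
  qed
  have "integrable (lborel \<Otimes>\<^sub>M lborel) ?F"
  proof (rule lborel_pair.Fubini_integrable)
    show "?F \<in> borel_measurable (lborel \<Otimes>\<^sub>M lborel)" by measurable
    show "integrable lborel (\<lambda>x. LINT v|lborel. norm (?F (x, v)))"
    proof (rule Bochner_Integration.integrable_bound)
      show "integrable lborel (\<lambda>x. mehler_weight_max * (weight_const t * gauss (1/4) (x - t)))" using integrable_gauss_shift[of "1/4" t] by simp
      show "AE x in lborel. norm (LINT v|lborel. norm (?F (x, v))) \<le> norm (mehler_weight_max * (weight_const t * gauss (1/4) (x - t)))"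
      proof (rule AE_I2)
        fix x
        have "(LINT v|lborel. norm (?F (x, v))) \<le> (LINT v|lborel. ?b x v)"
          using Fi bi bnd by (intro integral_mono) auto
        also have "\<dots> = mehler_weight_max * (weight_const t * gauss (1/4) (x - t))" by simp
        finally show "norm (LINT v|lborel. norm (?F (x, v))) \<le> norm (mehler_weight_max * (weight_const t * gauss (1/4) (x - t)))"
          using weight_const_pos[of t] by (simp add: abs_of_nonneg)
      qed
    qed measurable
    show "AE x in lborel. integrable lborel (\<lambda>v. ?F (x, v))" using Fi by simp
  qed
  note F = this
  have e: "(LINT x|lborel. P x * complex_of_real (mehler_weight v * mehler_gauss v t x)) = of_real (mehler_weight v) * (LINT x|lborel. P x * of_real (mehler_gauss v t x))" for v
  proof -
    have "(\<lambda>x. P x * complex_of_real (mehler_weight v * mehler_gauss v t x)) = (\<lambda>x. of_real (mehler_weight v) * (P x * of_real (mehler_gauss v t x)))" by (simp add: mult_ac)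
    then show ?thesis by simp
  qed
  have "(LINT v|lborel. (LINT x|lborel. P x * complex_of_real (mehler_weight v * mehler_gauss v t x))) = (LINT x|lborel. (LINT v|lborel. P x * complex_of_real (mehler_weight v * mehler_gauss v t x)))"
    using lborel_pair.Fubini_integral[OF F] by (simp del: of_real_mult)
  then show "(LINT x|lborel. P x * mehler t x) = (LINT v|lborel. of_real (mehler_weight v) * (LINT x|lborel. P x * of_real (mehler_gauss v t x)))"
    unfolding e mehler_eq by (simp del: of_real_mult)
  show "integrable lborel (\<lambda>v. of_real (mehler_weight v) * (LINT x|lborel. P x * of_real (mehler_gauss v t x)))"
    using lborel_pair.integrable_snd[OF F] unfolding e[symmetric] by (simp del: of_real_mult)
qed

text \<open>The Fourier transform at \<xi> of the oscillator semigroup applied to the point mass at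
  t, written in v: sqrt (sech \<tau>) is the prefactor 1 / sqrt (sinh \<tau>) times the factor sqrt
  (tanh \<tau>) from transforming the Gaussian.\<close>

definition mehler_flow :: "real \<Rightarrow> real \<Rightarrow> real \<Rightarrow> complex" where
  "mehler_flow \<xi> t v = of_real (mehler_exp v powr (2 * pi) * sqrt (mehler_sech v) * exp (- (pi * mehler_tanh v * (\<xi>\<^sup>2 + t\<^sup>2)))) * echar \<xi> (mehler_sech v * t)"

text \<open>The derivatives of tanh \<tau>, sech \<tau> and exp (- \<tau>) by the chain rule. The
  local name \<tau> stands for the Jacobian of the time with respect to v, here and in
  \<open>mehler_flow_deriv\<close>, and not for the time itself.\<close>

lemma pqr_deriv:
  assumes v: "0 < v" "v < 1"
  defines "\<tau> \<equiv> 4 * v / (1 - v^4)"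
  shows "(mehler_tanh has_real_derivative \<tau> * (mehler_sech v)\<^sup>2) (at v)"
    "(mehler_sech has_real_derivative - \<tau> * mehler_tanh v * mehler_sech v) (at v)"
    "(mehler_exp has_real_derivative - \<tau> * mehler_exp v) (at v)"
proof -
  define d where "d = 1 + v^4"
  define e where "e = 1 - v^4"
  have d: "d \<noteq> 0" and d2: "1 + v\<^sup>2 \<noteq> 0" using four_pos[of v] by (simp_all add: d_def)
  have e: "e \<noteq> 0" using v_lt[OF v] by (simp add: e_def)
  have ef: "e = (1 - v\<^sup>2) * (1 + v\<^sup>2)" unfolding e_def by algebra
  have "(mehler_tanh has_real_derivative ((2 * (2 * v)) * d - (2 * v\<^sup>2) * (4 * v^3)) / (d * d)) (at v)"
    unfolding mehler_tanh_def[abs_def] d_def using four_pos[of v] by (auto intro!: derivative_eq_intros)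
  moreover have "(2 * (2 * v)) * d - (2 * v\<^sup>2) * (4 * v^3) = 4 * v * e" unfolding d_def e_def by algebra
  moreover have "4 * v * e / (d * d) = \<tau> * (mehler_sech v)\<^sup>2"
    unfolding \<tau>_def mehler_sech_def d_def[symmetric] e_def[symmetric] using d e by (simp add: power2_eq_square)
  ultimately show "(mehler_tanh has_real_derivative \<tau> * (mehler_sech v)\<^sup>2) (at v)" by simp
  have "(mehler_sech has_real_derivative ((- (4 * v^3)) * d - e * (4 * v^3)) / (d * d)) (at v)"
    unfolding mehler_sech_def[abs_def] d_def e_def using four_pos[of v] by (auto intro!: derivative_eq_intros)
  moreover have "(- (4 * v^3)) * d - e * (4 * v^3) = - 8 * v^3" unfolding d_def e_def by algebra
  moreover have "- 8 * v^3 / (d * d) = - \<tau> * mehler_tanh v * mehler_sech v"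
    unfolding \<tau>_def mehler_sech_def mehler_tanh_def d_def[symmetric] e_def[symmetric] using d e by (simp add: power2_eq_square power3_eq_cube)
  ultimately show "(mehler_sech has_real_derivative - \<tau> * mehler_tanh v * mehler_sech v) (at v)" by simp
  have "(mehler_exp has_real_derivative ((- (2 * v)) * (1 + v\<^sup>2) - (1 - v\<^sup>2) * (2 * v)) / ((1 + v\<^sup>2) * (1 + v\<^sup>2))) (at v)"
    unfolding mehler_exp_def[abs_def] using four_pos[of v] by (auto intro!: derivative_eq_intros)
  moreover have "(- (2 * v)) * (1 + v\<^sup>2) - (1 - v\<^sup>2) * (2 * v) = - 4 * v" by algebra
  moreover have "- 4 * v / ((1 + v\<^sup>2) * (1 + v\<^sup>2)) = - \<tau> * mehler_exp v"
    unfolding \<tau>_def mehler_exp_def e_def[symmetric] ef using d2 e ef by simp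
  ultimately show "(mehler_exp has_real_derivative - \<tau> * mehler_exp v) (at v)" by simp
qed

text \<open>In the variable \<open>\<tau>\<close> with \<open>v\<^sup>2 = tanh (\<tau> / 2)\<close> this says that the Mehler semigroup solves its heat equation
  on the Fourier side; \<open>4 * v / (1 - v^4)\<close> is \<open>d\<tau> / dv\<close>.\<close>
lemma mehler_flow_deriv:
  assumes v: "0 < v" "v < 1"
  shows "(mehler_flow \<xi> t has_vector_derivative - (of_real (mehler_weight v) *
     ((2 + of_real (\<xi>\<^sup>2) + of_real (mehler_tanh v / (2 * pi)) + (of_real (mehler_sech v * t) - \<i> * of_real (mehler_tanh v * \<xi>))\<^sup>2) * mehler_gauss_hat v \<xi> t))) (at v)"
proof -
  define \<tau> where "\<tau> = 4 * v / (1 - v^4)"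
  define p q r where "p = mehler_tanh v" and "q = mehler_sech v" and "r = mehler_exp v"
  note D = pqr_deriv[OF v, folded \<tau>_def p_def q_def r_def]
  have q: "q > 0" and r: "r > 0" using mehler_sech_pos[OF v] mehler_exp_pos[OF v] by (simp_all add: q_def r_def)
  define s where "s = \<xi>\<^sup>2 + t\<^sup>2"
  define A where "A v = mehler_exp v powr (2 * pi) * sqrt (mehler_sech v) * exp (- (pi * mehler_tanh v * s))" for v
  have d1: "((\<lambda>v. mehler_exp v powr (2 * pi)) has_real_derivative - \<tau> * (2 * pi) * r powr (2 * pi)) (at v)"
  proof -
    have "((\<lambda>v. mehler_exp v powr (2 * pi)) has_real_derivative (2 * pi) * r powr (2 * pi - 1) * (- \<tau> * r)) (at v)"
      using DERIV_chain2[OF has_real_derivative_powr[OF r[unfolded r_def]] D(3)] by (simp add: r_def)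
    moreover have "r powr (2 * pi - 1) * r = r powr (2 * pi)" using r powr_mult_base[of r "2 * pi - 1"] by (simp add: mult.commute)
    moreover have "(2 * pi) * r powr (2 * pi - 1) * (- \<tau> * r) = - \<tau> * (2 * pi) * (r powr (2 * pi - 1) * r)" by simp
    ultimately show ?thesis by (simp only:)
  qed
  have d2: "((\<lambda>v. sqrt (mehler_sech v)) has_real_derivative - \<tau> * (p / 2) * sqrt q) (at v)"
  proof -
    have "((\<lambda>v. sqrt (mehler_sech v)) has_real_derivative (inverse (sqrt q) / 2) * (- \<tau> * p * q)) (at v)"
      using DERIV_chain2[OF DERIV_real_sqrt[OF q[unfolded q_def]] D(2)] by (simp add: q_def)
    moreover have "(inverse (sqrt q) / 2) * (- \<tau> * p * q) = - \<tau> * (p / 2) * sqrt q"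
      using q real_sqrt_mult_self[of q] by (simp add: field_simps)
    ultimately show ?thesis by (simp only:)
  qed
  have d3: "((\<lambda>v. exp (- (pi * mehler_tanh v * s))) has_real_derivative - \<tau> * (pi * s * q\<^sup>2) * exp (- (pi * p * s))) (at v)"
    by (auto intro!: derivative_eq_intros D(1) simp: p_def)
  have "(A has_real_derivative - \<tau> * (2 * pi + p / 2 + pi * s * q\<^sup>2) * A v) (at v)"
    unfolding A_def[abs_def]
    by (rule DERIV_cong[OF DERIV_mult'[OF DERIV_mult'[OF d1 d2] d3]])
       (simp add: p_def[symmetric] q_def[symmetric] r_def[symmetric] algebra_simps)
  then have dA: "((\<lambda>v. complex_of_real (A v)) has_vector_derivative of_real (- \<tau> * (2 * pi + p / 2 + pi * s * q\<^sup>2) * A v)) (at v)"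
    by (rule has_vector_derivative_of_real)
  have "((\<lambda>v. mehler_sech v * t) has_vector_derivative (- \<tau> * p * q * t)) (at v)"
    using DERIV_cmult_right[OF D(2), of t] by (simp add: has_real_derivative_iff_has_vector_derivative)
  from vector_diff_chain_at[OF this echar_deriv[of \<xi>]]
  have dE: "((\<lambda>v. echar \<xi> (mehler_sech v * t)) has_vector_derivative of_real (- \<tau> * p * q * t) * ((- 2 * of_real pi * \<i> * of_real \<xi>) * echar \<xi> (q * t))) (at v)"
    by (simp add: o_def q_def scaleR_conv_of_real)
  have mehler_floweq: "mehler_flow \<xi> t = (\<lambda>v. complex_of_real (A v) * echar \<xi> (mehler_sech v * t))"
    by (simp add: mehler_flow_def A_def s_def fun_eq_iff)
  let ?Q = "2 + of_real (\<xi>\<^sup>2) + of_real (p / (2 * pi)) + (of_real (q * t) - \<i> * of_real (p * \<xi>))\<^sup>2 :: complex"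
  \<comment> \<open>The identity for which \<open>mehler_weight\<close> was designed: times the sqrt
    (tanh) of \<open>mehler_gauss_hat\<close> it equals pi times the Jacobian times the amplitude of
    the flow. The factor pi is the ratio between oscillator time and Mehler time.\<close>
  have rg: "of_real (mehler_weight v) * mehler_gauss_hat v \<xi> t = of_real (pi * \<tau> * A v) * echar \<xi> (q * t)"
  proof -
    define d where "d = 1 + v^4"
    define e where "e = 1 - v^4"
    have de: "d > 0" "e > 0" using four_pos[of v] v_lt[OF v] by (simp_all add: d_def e_def)
    have "mehler_weight v * sqrt p = pi * \<tau> * (r powr (2 * pi) * sqrt q)"
    proof -
      have p1: "sqrt p = sqrt 2 * v / sqrt d" using v by (simp add: p_def mehler_tanh_def d_def[symmetric] real_sqrt_divide real_sqrt_mult)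
      have q1: "sqrt q = sqrt e / sqrt d" by (simp add: q_def mehler_sech_def d_def[symmetric] e_def[symmetric] real_sqrt_divide)
      have echar: "1 / sqrt e = sqrt e / e" using de(2) by (metis real_div_sqrt less_imp_le nonzero_divide_eq_eq divide_divide_eq_left' order_less_irrefl real_sqrt_eq_zero_cancel_iff divide_self_if times_divide_eq_right mult.right_neutral inverse_eq_divide)
      have "mehler_weight v * sqrt p = 2 * (sqrt 2 * sqrt 2) * pi * r powr (2 * pi) * v * (1 / sqrt e) / sqrt d"
        unfolding mehler_weight_eq[OF v] p1 e_def[symmetric] r_def by simp
      also have "\<dots> = pi * \<tau> * (r powr (2 * pi) * sqrt q)"
        unfolding echar q1 \<tau>_def e_def[symmetric] by simp
      finally show ?thesis .
    qed
    then have "mehler_weight v * (sqrt p * exp (- (pi * p * s))) = pi * \<tau> * A v"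
      unfolding A_def p_def[symmetric] q_def[symmetric] r_def[symmetric] by (simp add: mult.assoc[symmetric])
    then have "of_real (mehler_weight v) * complex_of_real (sqrt p * exp (- (pi * p * s))) = of_real (pi * \<tau> * A v)"
      by (simp only: of_real_mult[symmetric])
    then show ?thesis unfolding mehler_gauss_hat_def[OF v] s_def[symmetric] p_def[symmetric] q_def[symmetric] by (simp only: mult.assoc[symmetric])
  qed
  \<comment> \<open>pi times the quadratic symbol is minus the logarithmic derivative of the flow in
    Mehler time; tanh^2 + sech^2 = 1 collects the \<xi> and t terms into s * q^2.\<close>
  have key: "complex_of_real pi * ?Q = of_real (2 * pi + p / 2 + pi * s * q\<^sup>2) - 2 * of_real pi * \<i> * of_real \<xi> * of_real (p * q * t)"
  proof -
    have pq1: "p\<^sup>2 + q\<^sup>2 = 1" using pq[OF v] by (simp add: p_def q_def)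
    have "of_real (\<xi>\<^sup>2) + (of_real (q * t) - \<i> * of_real (p * \<xi>))\<^sup>2 = complex_of_real (\<xi>\<^sup>2 + q\<^sup>2 * t\<^sup>2 - p\<^sup>2 * \<xi>\<^sup>2) - 2 * \<i> * of_real (p * q * t * \<xi>)"
      by (simp add: power2_diff power_mult_distrib) 
    also have "\<xi>\<^sup>2 + q\<^sup>2 * t\<^sup>2 - p\<^sup>2 * \<xi>\<^sup>2 = s * q\<^sup>2" unfolding s_def using pq1 by algebra
    finally have 1: "of_real (\<xi>\<^sup>2) + (of_real (q * t) - \<i> * of_real (p * \<xi>))\<^sup>2 = complex_of_real (s * q\<^sup>2) - 2 * \<i> * of_real (p * q * t * \<xi>)" .
    have "complex_of_real pi * ?Q = of_real pi * (2 + of_real (p / (2 * pi)) + (of_real (\<xi>\<^sup>2) + (of_real (q * t) - \<i> * of_real (p * \<xi>))\<^sup>2))" by (simp add: algebra_simps)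
    also have "\<dots> = of_real (2 * pi + p / 2 + pi * s * q\<^sup>2) - 2 * of_real pi * \<i> * of_real \<xi> * of_real (p * q * t)"
      unfolding 1 by (simp add: algebra_simps)
    finally show ?thesis .
  qed
  show ?thesis unfolding mehler_floweq p_def[symmetric] q_def[symmetric]
  proof (rule has_vector_derivative_eq_rhs[OF has_vector_derivative_mult[OF dA dE]])
    let ?e = "echar \<xi> (q * t)" and ?K = "of_real (2 * pi + p / 2 + pi * s * q\<^sup>2) :: complex"
    have "of_real (mehler_weight v) * (?Q * mehler_gauss_hat v \<xi> t) = ?Q * (of_real (mehler_weight v) * mehler_gauss_hat v \<xi> t)" by simp
    also have "\<dots> = (complex_of_real pi * ?Q) * (of_real \<tau> * of_real (A v) * ?e)" unfolding rg by simp
    also have "\<dots> = (?K - 2 * of_real pi * \<i> * of_real \<xi> * of_real (p * q * t)) * (of_real \<tau> * of_real (A v) * ?e)" unfolding key ..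
    finally have R: "of_real (mehler_weight v) * (?Q * mehler_gauss_hat v \<xi> t) = (?K - 2 * of_real pi * \<i> * of_real \<xi> * of_real (p * q * t)) * (of_real \<tau> * of_real (A v) * ?e)" .
    have L: "of_real (A v) * (of_real (- \<tau> * p * q * t) * (- 2 * of_real pi * \<i> * of_real \<xi> * ?e)) +
        of_real (- \<tau> * (2 * pi + p / 2 + pi * s * q\<^sup>2) * A v) * echar \<xi> (mehler_sech v * t)
      = - ((?K - 2 * of_real pi * \<i> * of_real \<xi> * of_real (p * q * t)) * (of_real \<tau> * of_real (A v) * ?e))"
      unfolding of_real_mult q_def[symmetric] by (simp add: left_diff_distrib)
    show "of_real (A v) * (of_real (- \<tau> * p * q * t) * (- 2 * of_real pi * \<i> * of_real \<xi> * ?e)) +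
        of_real (- \<tau> * (2 * pi + p / 2 + pi * s * q\<^sup>2) * A v) * echar \<xi> (mehler_sech v * t) = - (of_real (mehler_weight v) * (?Q * mehler_gauss_hat v \<xi> t))"
      unfolding R by (rule L)
  qed
qed

section \<open>The reproducing kernel\<close>

text \<open>Continuity on the closed interval lets the fundamental theorem reach both ends while the
  derivative is known only inside. At v = 1 the base of \<open>powr\<close> is 0, where positivity
  of the exponent keeps the power continuous.\<close>

lemma mehler_flow_continuous: "continuous_on {0..1} (mehler_flow \<xi> t)"
proof -
  have r: "continuous_on {0..1} mehler_exp" "continuous_on {0..1} mehler_tanh" "continuous_on {0..1} mehler_sech"
    unfolding mehler_exp_def[abs_def] mehler_tanh_def[abs_def] mehler_sech_def[abs_def] using four_pos by (auto intro!: continuous_intros)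
  have "0 \<le> mehler_exp v" if "v \<in> {0..1}" for v
    using that four_pos(3)[of v] by (simp add: mehler_exp_def power_le_one)
  then have p: "continuous_on {0..1} (\<lambda>v. mehler_exp v powr (2 * pi))"
    by (intro continuous_on_powr' r continuous_on_const) auto
  have "continuous_on {0..1} (\<lambda>v. mehler_exp v powr (2 * pi) * sqrt (mehler_sech v) * exp (- (pi * mehler_tanh v * (\<xi>\<^sup>2 + t\<^sup>2))))"
    by (rule continuous_on_mult[OF continuous_on_mult[OF p]]) (intro continuous_intros r)+
  moreover have "continuous_on {0..1} (\<lambda>v. echar \<xi> (mehler_sech v * t))" by (intro continuous_intros r)
  ultimately show ?thesis unfolding mehler_flow_def[abs_def] by (rule continuous_on_mult[OF continuous_on_of_real])
qed

lemma norm_weight: "cmod (1 + (complex_of_real x)\<^sup>2) = 1 + x\<^sup>2"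
proof -
  have "1 + (complex_of_real x)\<^sup>2 = of_real (1 + x\<^sup>2)" by simp
  then show ?thesis by (simp only: norm_of_real) simp
qed

text \<open>The equation \<open>2 k + x\<^sup>2 k - k'' / (4 * pi\<^sup>2) = \<delta>\<close> for \<open>k = mehler t\<close>, read on the Fourier side.\<close>
lemma mehler_equation:
  "of_real (1 + \<xi>\<^sup>2) * fourier (mehler t) \<xi> + fourier (\<lambda>x. of_real (1 + x\<^sup>2) * mehler t x) \<xi> = echar \<xi> t"
proof -
  let ?P1 = "\<lambda>x. echar \<xi> x" and ?P2 = "\<lambda>x. of_real (1 + x\<^sup>2) * echar \<xi> x"
  have P1: "?P1 \<in> borel_measurable borel" "\<And>x. cmod (?P1 x) \<le> 1 + x\<^sup>2" by simp_all
  have P2: "?P2 \<in> borel_measurable borel" "\<And>x. cmod (?P2 x) \<le> 1 + x\<^sup>2" by (simp_all add: norm_mult norm_weight)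
  define I1 where "I1 v = (LINT x|lborel. ?P1 x * of_real (mehler_gauss v t x))" for v
  define I2 where "I2 v = (LINT x|lborel. ?P2 x * of_real (mehler_gauss v t x))" for v
  define G where "G v = of_real (1 + \<xi>\<^sup>2) * (of_real (mehler_weight v) * I1 v) + of_real (mehler_weight v) * I2 v" for v
  have f1: "fourier (mehler t) \<xi> = (LINT v|lborel. of_real (mehler_weight v) * I1 v)"
    unfolding fourier_echar I1_def mehler_fubini(1)[OF P1, symmetric] by (simp add: mult.commute)
  have f2: "fourier (\<lambda>x. of_real (1 + x\<^sup>2) * mehler t x) \<xi> = (LINT v|lborel. of_real (mehler_weight v) * I2 v)"
    unfolding fourier_echar I2_def mehler_fubini(1)[OF P2, symmetric] by (simp only: mult_ac)
  have i1: "integrable lborel (\<lambda>v. of_real (mehler_weight v) * I1 v)" unfolding I1_def by (rule mehler_fubini(2)[OF P1])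
  have i2: "integrable lborel (\<lambda>v. of_real (mehler_weight v) * I2 v)" unfolding I2_def by (rule mehler_fubini(2)[OF P2])
  have iG: "integrable lborel G" unfolding G_def by (intro Bochner_Integration.integrable_add integrable_mult_right i1 i2)
  have sum: "of_real (1 + \<xi>\<^sup>2) * fourier (mehler t) \<xi> + fourier (\<lambda>x. of_real (1 + x\<^sup>2) * mehler t x) \<xi> = (LINT v|lborel. G v)"
    unfolding f1 f2 G_def using i1 i2 by simp
  have G0: "G v = 0" if "v \<notin> {0<..<1}" for v using that by (auto simp: G_def mehler_weight_def)
  have "((\<lambda>v. - G v) has_integral (mehler_flow \<xi> t 1 - mehler_flow \<xi> t 0)) {0..1}"
  proof (rule fundamental_theorem_of_calculus_interior[OF _ mehler_flow_continuous])
    fix v :: real assume "v \<in> {0<..<1}"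
    then have v: "0 < v" "v < 1" by auto
    have "I1 v = mehler_gauss_hat v \<xi> t" unfolding I1_def using mehler_gauss_fourier(1)[OF v, of t \<xi>] by (simp add: mult.commute)
    moreover have "I2 v = (1 + of_real (mehler_tanh v / (2 * pi)) + (of_real (mehler_sech v * t) - \<i> * of_real (mehler_tanh v * \<xi>))\<^sup>2) * mehler_gauss_hat v \<xi> t"
    proof -
      have "I2 v = (LINT x|lborel. complex_of_real ((1 + x\<^sup>2) * mehler_gauss v t x) * echar \<xi> x)"
        unfolding I2_def of_real_mult by (simp only: mult_ac)
      then show ?thesis using mehler_gauss_fourier(2)[OF v, of t \<xi>] by (simp only:)
    qed
    ultimately have "G v = of_real (mehler_weight v) *
     ((2 + of_real (\<xi>\<^sup>2) + of_real (mehler_tanh v / (2 * pi)) + (of_real (mehler_sech v * t) - \<i> * of_real (mehler_tanh v * \<xi>))\<^sup>2) * mehler_gauss_hat v \<xi> t)"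
      unfolding G_def by (simp add: algebra_simps)
    then show "(mehler_flow \<xi> t has_vector_derivative - G v) (at v)" using mehler_flow_deriv[OF v, of \<xi> t] by (simp only:)
  qed simp
  note ftc = this
  \<comment> \<open>The end v = 0 is time 0, where the flow is the transform of the point mass; v =
    1 is infinite time, where the flow has died out.\<close>
  have "mehler_exp 1 = 0" "mehler_exp 0 = 1" "mehler_sech 0 = 1" "mehler_tanh 0 = 0" by (simp_all add: mehler_exp_def mehler_sech_def mehler_tanh_def)
  then have ends: "mehler_flow \<xi> t 1 - mehler_flow \<xi> t 0 = - echar \<xi> t" unfolding mehler_flow_def by simp
  have "(G has_integral echar \<xi> t) {0..1}"
    using has_integral_neg[OF ftc] unfolding ends by (simp only: minus_minus)
  then have "(G has_integral echar \<xi> t) UNIV"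
    by (rule has_integral_on_superset) (use G0 in auto)
  moreover have "(G has_integral (LINT v|lborel. G v)) UNIV" by (rule has_integral_integral_lborel[OF iG])
  ultimately show ?thesis unfolding sum by (rule has_integral_unique[symmetric])
qed

lemma mehler_L1: "integrable lborel (mehler t)" "integrable lborel (\<lambda>x. of_real (1 + x\<^sup>2) * mehler t x)"
  using mehler_weighted_integrable[of "\<lambda>x. 1" t] mehler_weighted_integrable[of "\<lambda>x. of_real (1 + x\<^sup>2)" t]
  by (simp_all add: norm_weight)

lemma mehler_L1_bound: "(LINT x|lborel. cmod (of_real (1 + x\<^sup>2) * mehler t x)) \<le> mehler_weight_max * weight_const t * 2"
proof -
  have "(LINT x|lborel. cmod (of_real (1 + x\<^sup>2) * mehler t x)) \<le> (LINT x|lborel. mehler_weight_max * weight_const t * gauss (1/4) (x - t))"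
  proof (rule integral_mono)
    show "integrable lborel (\<lambda>x. cmod (of_real (1 + x\<^sup>2) * mehler t x))" using mehler_L1(2) by (rule integrable_norm)
    show "integrable lborel (\<lambda>x. mehler_weight_max * weight_const t * gauss (1/4) (x - t))" using integrable_gauss_shift[of "1/4" t] by simp
    show "cmod (of_real (1 + x\<^sup>2) * mehler t x) \<le> mehler_weight_max * weight_const t * gauss (1/4) (x - t)" for x
      using mehler_weight_bound[of x t] by (simp add: norm_mult norm_weight)
  qed
  also have "\<dots> = mehler_weight_max * weight_const t * 2" using integral_gauss_shift[of "1/4" t] by (simp add: real_sqrt_divide)
  finally show ?thesis .
qed

text \<open>The 1 bounds the character in \<open>mehler_equation\<close> and the rest bounds the L1
  norm of the weighted kernel; its last factor 2 is the integral of
  \<open>gauss (1/4)\<close>.\<close>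

definition fourier_const :: "real \<Rightarrow> real" where "fourier_const t = 1 + mehler_weight_max * weight_const t * 2"

text \<open>\<open>mehler_equation\<close> expresses the weighted transform of the kernel as a
  character minus the transform of an L1 function, both bounded.\<close>

lemma mehler_fourier_bound: "(1 + \<xi>\<^sup>2) * cmod (fourier (mehler t) \<xi>) \<le> fourier_const t"
proof -
  let ?g = "\<lambda>x. complex_of_real (1 + x\<^sup>2) * mehler t x"
  have "(1 + \<xi>\<^sup>2) * cmod (fourier (mehler t) \<xi>) = cmod (of_real (1 + \<xi>\<^sup>2) * fourier (mehler t) \<xi>)"
    by (simp add: norm_mult norm_weight)
  also have "of_real (1 + \<xi>\<^sup>2) * fourier (mehler t) \<xi> = echar \<xi> t - fourier ?g \<xi>"
    using mehler_equation[of \<xi> t] by (simp only: eq_diff_eq)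
  also have "cmod \<dots> \<le> cmod (echar \<xi> t) + cmod (fourier ?g \<xi>)" by (rule norm_triangle_ineq4)
  also have "\<dots> \<le> 1 + (LINT x|lborel. cmod (?g x))" using cmod_fourier_le[OF mehler_L1(2)] by simp
  also have "\<dots> \<le> fourier_const t" using mehler_L1_bound[of t] unfolding fourier_const_def by linarith
  finally show ?thesis .
qed

lemma mehler_FSobolev: "mehler t \<in> FSobolev"
  by (rule FSobolev_criterion[OF mehler_continuous mehler_weight_bound' mehler_fourier_bound])

text \<open>Substituting \<open>mehler_equation\<close> into the Fourier half of the inner product
  splits it in two: the character gives f t by inversion, and by Parseval the remaining term cancels
  the spatial half.\<close>

lemma mehler_reproducing: assumes f: "f \<in> FSobolev" shows "FS_inner f (mehler t) = f t"
proof -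
  let ?g = "\<lambda>x. complex_of_real (1 + x\<^sup>2) * mehler t x"
  note fi = FSobolev_integrable[OF f]
  have c1: "fourier f \<xi> * cnj (fourier (mehler t) \<xi>) * of_real (1 + \<xi>\<^sup>2)
      = fourier f \<xi> * echar (- t) \<xi> - fourier f \<xi> * cnj (fourier ?g \<xi>)" for \<xi>
  proof -
    have "of_real (1 + \<xi>\<^sup>2) * fourier (mehler t) \<xi> = echar \<xi> t - fourier ?g \<xi>"
      using mehler_equation[of \<xi> t] by (simp only: eq_diff_eq)
    from arg_cong[OF this, of cnj] have "of_real (1 + \<xi>\<^sup>2) * cnj (fourier (mehler t) \<xi>) = echar (- t) \<xi> - cnj (fourier ?g \<xi>)"
      by (simp add: cnj_echar(2) echar_commute)
    then show ?thesis by (metis (no_types, lifting) mult.assoc mult.commute right_diff_distrib)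
  qed
  have [measurable]: "f \<in> borel_measurable borel" by (rule FSobolev_measurable[OF f])
  have m1[measurable]: "fourier f \<in> borel_measurable borel" by (rule fourier_measurable) measurable
  have m2[measurable]: "fourier ?g \<in> borel_measurable borel" by (rule fourier_measurable) measurable
  have i1: "integrable lborel (\<lambda>\<xi>. fourier f \<xi> * echar (- t) \<xi>)" using fi(2) by (rule integrable_echar)
  have i2: "integrable lborel (\<lambda>\<xi>. fourier f \<xi> * cnj (fourier ?g \<xi>))"
  proof (rule Bochner_Integration.integrable_bound)
    show "integrable lborel (\<lambda>\<xi>. (LINT x|lborel. cmod (?g x)) * cmod (fourier f \<xi>))" using fi(2) by simp
    show "AE \<xi> in lborel. norm (fourier f \<xi> * cnj (fourier ?g \<xi>)) \<le> norm ((LINT x|lborel. cmod (?g x)) * cmod (fourier f \<xi>))"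
      using cmod_fourier_le[OF mehler_L1(2)] by (intro AE_I2) (simp add: norm_mult mult.commute mult_left_mono abs_of_nonneg del: of_real_add of_real_power)
  qed measurable
  have "(LINT \<xi>|lborel. fourier f \<xi> * cnj (fourier (mehler t) \<xi>) * of_real (1 + \<xi>\<^sup>2))
     = (LINT \<xi>|lborel. fourier f \<xi> * echar (- t) \<xi>) - (LINT \<xi>|lborel. fourier f \<xi> * cnj (fourier ?g \<xi>))"
    unfolding c1 using i1 i2 by (rule Bochner_Integration.integral_diff)
  also have "(LINT \<xi>|lborel. fourier f \<xi> * echar (- t) \<xi>) = f t"
    using fourier_inversion[OF fi] FSobolev_continuous[OF f] by (simp add: continuous_on_eq_continuous_at)
  also have "(LINT \<xi>|lborel. fourier f \<xi> * cnj (fourier ?g \<xi>)) = (LINT x|lborel. f x * cnj (?g x))"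
    by (rule parseval[OF fi FSobolev_continuous[OF f] mehler_L1(2)])
  also have "(LINT x|lborel. f x * cnj (?g x)) = (LINT x|lborel. f x * cnj (mehler t x) * of_real (1 + x\<^sup>2))"
    by (intro Bochner_Integration.integral_cong) simp_all
  finally show ?thesis unfolding FS_inner_def by simp
qed

lemma FS_kernel_eq: "FS_kernel t = mehler t"
  by (rule FS_kernel_eqI) (simp_all add: mehler_FSobolev mehler_reproducing)

lemma FS_inner_mehler: "FS_inner (mehler y) (mehler x) = mehler x y"
  using mehler_reproducing[OF mehler_FSobolev, of y x] by (simp add: mehler_commute)

section \<open>Superpositions of kernels with bounded support\<close>

lemma weight_const_mono: "\<bar>x\<bar> \<le> R \<Longrightarrow> weight_const x \<le> weight_const R"
proof -
  assume "\<bar>x\<bar> \<le> R"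
  then have "x\<^sup>2 \<le> R\<^sup>2" by (metis abs_ge_zero power2_abs power_mono)
  moreover have "0 \<le> 1 + 4 / pi" by simp
  ultimately show ?thesis unfolding weight_const_def by (intro mult_right_mono) auto
qed

text \<open>Stated for a general m because it is applied to the kernel and to its transform. The
  bound is asked only where c is nonzero, since the available constants grow with the position x of
  the kernel.\<close>

lemma superposition_fubini:
  fixes c g :: "real \<Rightarrow> complex" and m :: "real \<Rightarrow> real \<Rightarrow> complex"
  assumes c: "integrable lborel c" and g: "integrable lborel g"
    and m[measurable]: "(\<lambda>(x, t). m x t) \<in> borel_measurable (borel \<Otimes>\<^sub>M borel)"
    and B: "\<And>x t. c x \<noteq> 0 \<Longrightarrow> (1 + t\<^sup>2) * cmod (m x t) \<le> B"
  shows "(LINT t|lborel. (LINT x|lborel. c x * m x t) * g t * of_real (1 + t\<^sup>2))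
     = (LINT x|lborel. c x * (LINT t|lborel. m x t * g t * of_real (1 + t\<^sup>2)))"
proof -
  have [measurable]: "c \<in> borel_measurable borel" "g \<in> borel_measurable borel" using c g by simp_all
  have [measurable]: "(\<lambda>(x, t). m x t) \<in> borel_measurable (lborel \<Otimes>\<^sub>M lborel)" using m by (simp add: measurable_lborel1 cong: measurable_cong_sets sets_pair_measure_cong)
  let ?F = "\<lambda>(x, t). c x * (m x t * g t * of_real (1 + t\<^sup>2))"
  have bnd: "cmod (?F (x, t)) \<le> cmod (c x) * (\<bar>B\<bar> * cmod (g t))" for x t
  proof (cases "c x = 0")
    case False
    have "cmod (?F (x, t)) = cmod (c x) * (((1 + t\<^sup>2) * cmod (m x t)) * cmod (g t))"
      by (simp add: norm_mult norm_weight)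
    also have "\<dots> \<le> cmod (c x) * (\<bar>B\<bar> * cmod (g t))"
      using B[OF False, of t] by (intro mult_left_mono mult_right_mono) auto
    finally show ?thesis .
  qed simp
  have gi: "integrable lborel (\<lambda>t. cmod (c x) * (\<bar>B\<bar> * cmod (g t)))" for x using g by simp
  have Fi: "integrable lborel (\<lambda>t. ?F (x, t))" for x
  proof (rule Bochner_Integration.integrable_bound[OF gi[of x]])
    show "(\<lambda>t. ?F (x, t)) \<in> borel_measurable lborel" unfolding prod.case by measurable
    show "AE t in lborel. norm (?F (x, t)) \<le> norm (cmod (c x) * (\<bar>B\<bar> * cmod (g t)))"
      using bnd[of x] by (intro AE_I2) (simp add: abs_mult)
  qed
  have F: "integrable (lborel \<Otimes>\<^sub>M lborel) ?F"
  proof (rule lborel_pair.Fubini_integrable)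
    show "?F \<in> borel_measurable (lborel \<Otimes>\<^sub>M lborel)" by measurable
    show "integrable lborel (\<lambda>x. LINT t|lborel. norm (?F (x, t)))"
    proof (rule Bochner_Integration.integrable_bound)
      show "integrable lborel (\<lambda>x. cmod (c x) * (\<bar>B\<bar> * (LINT t|lborel. cmod (g t))))" using c by simp
      show "AE x in lborel. norm (LINT t|lborel. norm (?F (x, t))) \<le> norm (cmod (c x) * (\<bar>B\<bar> * (LINT t|lborel. cmod (g t))))"
      proof (rule AE_I2)
        fix x
        have "(LINT t|lborel. norm (?F (x, t))) \<le> (LINT t|lborel. cmod (c x) * (\<bar>B\<bar> * cmod (g t)))"
          using Fi gi bnd by (intro integral_mono) auto
        then show "norm (LINT t|lborel. norm (?F (x, t))) \<le> norm (cmod (c x) * (\<bar>B\<bar> * (LINT t|lborel. cmod (g t))))"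
          by (simp add: abs_of_nonneg)
      qed
    qed measurable
    show "AE x in lborel. integrable lborel (\<lambda>t. ?F (x, t))" using Fi by simp
  qed
  have "(LINT t|lborel. (LINT x|lborel. c x * (m x t * g t * of_real (1 + t\<^sup>2)))) = (LINT x|lborel. (LINT t|lborel. c x * (m x t * g t * of_real (1 + t\<^sup>2))))"
    using lborel_pair.Fubini_integral[OF F] by (simp only: prod.case)
  moreover have "(LINT x|lborel. c x * (m x t * g t * of_real (1 + t\<^sup>2))) = (LINT x|lborel. c x * m x t) * g t * of_real (1 + t\<^sup>2)" for t
  proof -
    have "(LINT x|lborel. (c x * m x t) * (g t * of_real (1 + t\<^sup>2))) = (LINT x|lborel. c x * m x t) * (g t * of_real (1 + t\<^sup>2))"
      by (rule integral_mult_left_zero)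
    then show ?thesis by (simp only: mult.assoc)
  qed
  ultimately show ?thesis by (simp only: integral_mult_right_zero)
qed

lemma superposition_bound:
  fixes c :: "real \<Rightarrow> complex"
  assumes c: "integrable lborel c" and [measurable]: "(\<lambda>x. m x t) \<in> borel_measurable borel"
    and B: "\<And>x. c x \<noteq> 0 \<Longrightarrow> (1 + t\<^sup>2) * cmod (m x t) \<le> B"
  shows "(1 + t\<^sup>2) * cmod (LINT x|lborel. c x * m x t) \<le> \<bar>B\<bar> * (LINT x|lborel. cmod (c x))"
proof -
  have [measurable]: "c \<in> borel_measurable borel" using c by simp
  have ptw: "cmod (of_real (1 + t\<^sup>2) * (c x * m x t)) \<le> \<bar>B\<bar> * cmod (c x)" for x
  proof (cases "c x = 0")
    case False
    have "cmod (of_real (1 + t\<^sup>2) * (c x * m x t)) = ((1 + t\<^sup>2) * cmod (m x t)) * cmod (c x)"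
      by (simp add: norm_mult norm_weight)
    also have "\<dots> \<le> \<bar>B\<bar> * cmod (c x)" using B[OF False] by (intro mult_right_mono) auto
    finally show ?thesis .
  qed simp
  have bi: "integrable lborel (\<lambda>x. \<bar>B\<bar> * cmod (c x))" using c by simp
  have "(1 + t\<^sup>2) * cmod (LINT x|lborel. c x * m x t) = cmod (of_real (1 + t\<^sup>2) * (LINT x|lborel. c x * m x t))"
    by (simp add: norm_mult norm_weight)
  also have "\<dots> = cmod (LINT x|lborel. of_real (1 + t\<^sup>2) * (c x * m x t))" by (simp only: integral_mult_right_zero)
  also have "\<dots> \<le> (LINT x|lborel. \<bar>B\<bar> * cmod (c x))"
  proof (rule Bochner_Integration.integral_norm_bound_integral[OF _ bi ptw])
    show "integrable lborel (\<lambda>x. of_real (1 + t\<^sup>2) * (c x * m x t))"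
    proof (rule Bochner_Integration.integrable_bound[OF bi])
      show "AE x in lborel. norm (of_real (1 + t\<^sup>2) * (c x * m x t)) \<le> norm (\<bar>B\<bar> * cmod (c x))"
        using ptw by (intro AE_I2) (simp only: real_norm_def abs_mult abs_abs abs_norm_cancel)
    qed measurable
  qed
  finally show ?thesis by simp
qed

text \<open>The weak integral of c x times the kernel at x, realised as an ordinary function;
  pairing it with g moves the pairing under the integral, where the reproducing property gives the
  conjugate of g x. Bounded support of c makes the kernel bounds uniform.\<close>

lemma mehler_superposition:
  fixes c :: "real \<Rightarrow> complex"
  assumes c: "integrable lborel c" and R: "\<And>x. R < \<bar>x\<bar> \<Longrightarrow> c x = 0"
  defines "\<sigma> \<equiv> \<lambda>t. LINT x|lborel. c x * mehler x t"
  shows "\<sigma> \<in> FSobolev" "\<And>g. g \<in> FSobolev \<Longrightarrow> FS_inner \<sigma> g = (LINT x|lborel. c x * cnj (g x))"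
proof -
  have [measurable]: "c \<in> borel_measurable borel" using c by simp
  have cR: "weight_const x \<le> weight_const R" if "c x \<noteq> 0" for x using R[of x] that by (intro weight_const_mono) force
  have K1: "(1 + t\<^sup>2) * cmod (mehler x t) \<le> mehler_weight_max * weight_const R" if "c x \<noteq> 0" for x t
  proof -
    have "(1 + t\<^sup>2) * cmod (mehler x t) \<le> mehler_weight_max * weight_const x" by (rule mehler_weight_bound')
    also have "\<dots> \<le> mehler_weight_max * weight_const R" using cR[OF that] by (intro mult_left_mono) auto
    finally show ?thesis .
  qed
  have K2: "(1 + t\<^sup>2) * cmod (fourier (mehler x) t) \<le> fourier_const R" if "c x \<noteq> 0" for x t
  proof -
    have "(1 + t\<^sup>2) * cmod (fourier (mehler x) t) \<le> fourier_const x" by (rule mehler_fourier_bound)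
    also have "\<dots> \<le> fourier_const R" unfolding fourier_const_def using cR[OF that] by (intro add_left_mono mult_right_mono mult_left_mono) auto
    finally show ?thesis .
  qed
  have m1: "(\<lambda>(x, t). mehler x t) \<in> borel_measurable (borel \<Otimes>\<^sub>M borel)" by measurable
  have m2: "(\<lambda>(x, t). fourier (mehler x) t) \<in> borel_measurable (borel \<Otimes>\<^sub>M borel)" unfolding fourier_echar by measurable
  have m2': "(\<lambda>x. fourier (mehler x) t) \<in> borel_measurable borel" for t using m2 by measurable
  have cont: "continuous_on UNIV \<sigma>" unfolding \<sigma>_def
  proof (rule continuous_LINT)
    show "integrable lborel (\<lambda>x. cmod (c x) * (mehler_weight_max * \<bar>weight_const R\<bar>))" using c by simp
    show "norm (c x * mehler x t) \<le> cmod (c x) * (mehler_weight_max * \<bar>weight_const R\<bar>)" for t x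
    proof (cases "c x = 0")
      case False
      have "1 * cmod (mehler x t) \<le> (1 + t\<^sup>2) * cmod (mehler x t)" by (intro mult_right_mono) auto
      also have "\<dots> \<le> mehler_weight_max * weight_const R" by (rule K1[OF False])
      also have "\<dots> \<le> mehler_weight_max * \<bar>weight_const R\<bar>" by (intro mult_left_mono) auto
      finally show ?thesis by (simp add: norm_mult mult_left_mono)
    qed simp
    show "continuous_on UNIV (\<lambda>t. c x * mehler x t)" for x by (intro continuous_intros mehler_continuous)
  qed measurable
  have b1: "(1 + t\<^sup>2) * cmod (\<sigma> t) \<le> \<bar>mehler_weight_max * weight_const R\<bar> * (LINT x|lborel. cmod (c x))" for t
    unfolding \<sigma>_def by (rule superposition_bound[OF c _ K1]) measurable
  have F\<sigma>: "fourier \<sigma> \<tau> = (LINT x|lborel. c x * fourier (mehler x) \<tau>)" for \<tau>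
  proof -
    \<comment> \<open>Dividing by 1 + t^2 cancels the weight built into
      \<open>superposition_fubini\<close>, so that the exchange computes a plain Fourier
      transform.\<close>
    let ?g = "\<lambda>t. of_real (1 / (1 + t\<^sup>2)) * echar \<tau> t"
    have gi: "integrable lborel ?g" using integrable_inv_1_plus_sq by (intro integrable_echar) (simp only: complex_of_real_integrable_eq)
    have ge: "z * ?g t * of_real (1 + t\<^sup>2) = z * echar \<tau> t" for z t
    proof -
      have "1 + t\<^sup>2 \<noteq> 0" using four_pos(3)[of t] by simp
      then have "complex_of_real (1 / (1 + t\<^sup>2)) * of_real (1 + t\<^sup>2) = 1" unfolding of_real_mult[symmetric] by simp
      then show ?thesis by (metis (no_types, lifting) mult.assoc mult.commute mult.right_neutral)
    qed
    show ?thesis using superposition_fubini[OF c gi m1 K1] unfolding ge fourier_echar \<sigma>_def .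
  qed
  have b2: "(1 + t\<^sup>2) * cmod (fourier \<sigma> t) \<le> \<bar>fourier_const R\<bar> * (LINT x|lborel. cmod (c x))" for t
    unfolding F\<sigma> by (rule superposition_bound[OF c m2' K2])
  show \<sigma>: "\<sigma> \<in> FSobolev" by (rule FSobolev_criterion[OF cont b1 b2])
  fix g assume g: "g \<in> FSobolev"
  have gi: "integrable lborel (\<lambda>t. cnj (g t))" "integrable lborel (\<lambda>t. cnj (fourier g t))"
    using FSobolev_integrable[OF g] by simp_all
  define J1 where "J1 x = (LINT t|lborel. mehler x t * cnj (g t) * of_real (1 + t\<^sup>2))" for x
  define J2 where "J2 x = (LINT t|lborel. fourier (mehler x) t * cnj (fourier g t) * of_real (1 + t\<^sup>2))" for x
  have 1: "(LINT t|lborel. \<sigma> t * cnj (g t) * of_real (1 + t\<^sup>2)) = (LINT x|lborel. c x * J1 x)"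
    unfolding \<sigma>_def J1_def by (rule superposition_fubini[OF c gi(1) m1 K1])
  have 2: "(LINT t|lborel. fourier \<sigma> t * cnj (fourier g t) * of_real (1 + t\<^sup>2)) = (LINT x|lborel. c x * J2 x)"
    unfolding F\<sigma> J2_def by (rule superposition_fubini[OF c gi(2) m2 K2])
  have J: "J1 x + J2 x = cnj (g x)" for x
  proof -
    have "J1 x + J2 x = FS_inner (mehler x) g" unfolding J1_def J2_def FS_inner_def ..
    also have "\<dots> = cnj (FS_inner g (mehler x))" using FS.ip_cnj[OF mehler_FSobolev g] .
    finally show ?thesis by (simp add: mehler_reproducing[OF g])
  qed
  have [measurable]: "g \<in> borel_measurable borel" by (rule FSobolev_measurable[OF g])
  have mg[measurable]: "fourier g \<in> borel_measurable borel" by (rule fourier_measurable) measurable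
  have bi: "integrable lborel (\<lambda>x. c x * J1 x)"
  proof (rule Bochner_Integration.integrable_bound)
    let ?L = "LINT t|lborel. cmod (g t)"
    show "integrable lborel (\<lambda>x. cmod (c x) * (\<bar>mehler_weight_max * weight_const R\<bar> * ?L))" using c by simp
    show "(\<lambda>x. c x * J1 x) \<in> borel_measurable lborel" unfolding J1_def by measurable
    show "AE x in lborel. norm (c x * J1 x) \<le> norm (cmod (c x) * (\<bar>mehler_weight_max * weight_const R\<bar> * ?L))"
    proof (rule AE_I2)
      fix x
      show "norm (c x * J1 x) \<le> norm (cmod (c x) * (\<bar>mehler_weight_max * weight_const R\<bar> * ?L))"
      proof (cases "c x = 0")
        case False
        have "cmod (J1 x) \<le> (LINT t|lborel. \<bar>mehler_weight_max * weight_const R\<bar> * cmod (g t))" unfolding J1_def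
        proof (rule Bochner_Integration.integral_norm_bound_integral)
          show "integrable lborel (\<lambda>t. mehler x t * cnj (g t) * of_real (1 + t\<^sup>2))"
            by (rule FSobolev_inner_integrable(1)[OF mehler_FSobolev g])
          show "integrable lborel (\<lambda>t. \<bar>mehler_weight_max * weight_const R\<bar> * cmod (g t))" using FSobolev_integrable(1)[OF g] by simp
          fix t
          have "cmod (mehler x t * cnj (g t) * of_real (1 + t\<^sup>2)) = ((1 + t\<^sup>2) * cmod (mehler x t)) * cmod (g t)"
            by (simp add: norm_mult norm_weight)
          also have "\<dots> \<le> \<bar>mehler_weight_max * weight_const R\<bar> * cmod (g t)" using K1[OF False, of t] by (intro mult_right_mono) auto
          finally show "cmod (mehler x t * cnj (g t) * of_real (1 + t\<^sup>2)) \<le> \<bar>mehler_weight_max * weight_const R\<bar> * cmod (g t)" .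
        qed
        then have "cmod (J1 x) \<le> \<bar>mehler_weight_max * weight_const R\<bar> * ?L" by simp
        then have "cmod (c x) * cmod (J1 x) \<le> cmod (c x) * (\<bar>mehler_weight_max * weight_const R\<bar> * ?L)" by (intro mult_left_mono) auto
        also have "\<dots> \<le> norm (cmod (c x) * (\<bar>mehler_weight_max * weight_const R\<bar> * ?L))" by simp
        finally show ?thesis by (simp only: norm_mult)
      qed simp
    qed
  qed
  have bg: "integrable lborel (\<lambda>x. c x * cnj (g x))"
  proof -
    have cont: "continuous_on {-R..R} g" using FSobolev_continuous[OF g] continuous_on_subset by blast
    have "bounded (g ` {-R..R})" by (intro compact_imp_bounded compact_continuous_image cont) simp
    then obtain M where M: "\<forall>x\<in>{-R..R}. cmod (g x) \<le> M" unfolding bounded_iff by auto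
    show ?thesis
    proof (rule Bochner_Integration.integrable_bound)
      show "integrable lborel (\<lambda>x. \<bar>M\<bar> * cmod (c x))" using c by simp
      show "AE x in lborel. norm (c x * cnj (g x)) \<le> norm (\<bar>M\<bar> * cmod (c x))"
      proof (rule AE_I2)
        fix x
        show "norm (c x * cnj (g x)) \<le> norm (\<bar>M\<bar> * cmod (c x))"
        proof (cases "c x = 0")
          case False
          then have "x \<in> {-R..R}" using R[of x] by force
          then have "cmod (g x) \<le> \<bar>M\<bar>" using M by force
          then have "cmod (c x) * cmod (g x) \<le> cmod (c x) * \<bar>M\<bar>" by (intro mult_left_mono) auto
          also have "\<dots> = norm (\<bar>M\<bar> * cmod (c x))" by simp
          finally show ?thesis by (simp only: norm_mult complex_mod_cnj)
        qed simp
      qed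
    qed measurable
  qed
  \<comment> \<open>Integrability of the Fourier half comes for free: both halves add up to the
    conjugate of g, which is bounded on the support of c.\<close>
  have J2: "c x * J2 x = c x * cnj (g x) - c x * J1 x" for x
    unfolding J[symmetric] by (simp add: distrib_left)
  have bi2: "integrable lborel (\<lambda>x. c x * J2 x)" unfolding J2 by (intro Bochner_Integration.integrable_diff bg bi)
  have "FS_inner \<sigma> g = (LINT x|lborel. c x * J1 x) + (LINT x|lborel. c x * J2 x)" unfolding FS_inner_def 1 2 ..
  also have "\<dots> = (LINT x|lborel. c x * J1 x + c x * J2 x)" using bi bi2 by (rule Bochner_Integration.integral_add[symmetric])
  also have "\<dots> = (LINT x|lborel. c x * cnj (g x))" by (simp add: J2)
  finally show "FS_inner \<sigma> g = (LINT x|lborel. c x * cnj (g x))" .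
qed

section \<open>Asymptotics of the kernel on the diagonal\<close>

definition kernel_diag :: "real \<Rightarrow> real" where "kernel_diag x = Re (mehler x x)"

lemma mehler_diag: "mehler x x = of_real (kernel_diag x)"
  by (simp add: kernel_diag_def mehler_def)

lemma kernel_diag_eq: "kernel_diag x = (LINT v|lborel. mehler_weight v * gauss (2 * x\<^sup>2) v)"
proof -
  have e: "mehler_weight v * mehler_gauss v x x = mehler_weight v * gauss (2 * x\<^sup>2) v" for v
  proof (cases "0 < v \<and> v < 1")
    case True
    then have v: "0 < v" "v < 1" by auto
    have "x\<^sup>2 + x\<^sup>2 - 2 * mehler_sech v * x * x = 2 * x\<^sup>2 * (1 - mehler_sech v)" by (simp add: power2_eq_square algebra_simps)
    then have "pi * (x\<^sup>2 + x\<^sup>2 - 2 * mehler_sech v * x * x) / mehler_tanh v = pi * (2 * x\<^sup>2) * ((1 - mehler_sech v) / mehler_tanh v)" by simp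
    also have "\<dots> = pi * (2 * x\<^sup>2) * v\<^sup>2" unfolding one_minus_q_over_p[OF v] ..
    finally show ?thesis by (simp add: mehler_gauss_def gauss_def)
  qed (auto simp: mehler_weight_def)
  show ?thesis unfolding kernel_diag_def mehler_def e by simp
qed

lemma kernel_diag_continuous: "continuous_on A kernel_diag"
proof -
  have "continuous_on UNIV (\<lambda>x. case (x, x) of (t, x) \<Rightarrow> mehler t x)"
    by (rule continuous_on_compose2[OF mehler_joint_continuous]) (auto intro!: continuous_intros)
  then have "continuous_on UNIV kernel_diag" unfolding kernel_diag_def by (auto intro!: continuous_intros)
  then show ?thesis by (rule continuous_on_subset) simp
qed

lemma kernel_diag_even: "kernel_diag (- x) = kernel_diag x" by (simp add: kernel_diag_eq)

lemma half_gauss: "(LINT s|lborel. indicator {0<..} s * gauss 2 s) = 1 / (2 * sqrt 2)"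
proof -
  let ?g = "\<lambda>s::real. indicator {0<..} s * gauss 2 s" and ?h = "\<lambda>s::real. indicator {..<0} s * gauss 2 s"
  have i: "integrable lborel ?g" "integrable lborel ?h"
    using integrable_mult_indicator[of "{0<..}" lborel "gauss 2"] integrable_mult_indicator[of "{..<0}" lborel "gauss 2"]
      integrable_gauss[of 2] by simp_all
  have "(LINT s|lborel. ?h s) = (LINT s|lborel. ?g s)"
    by (subst lborel_integral_real_affine[of "-1" _ 0]) (auto intro!: Bochner_Integration.integral_cong simp: gauss_def indicator_def)
  then have "2 * (LINT s|lborel. ?g s) = (LINT s|lborel. ?g s) + (LINT s|lborel. ?h s)" by simp
  also have "\<dots> = (LINT s|lborel. ?g s + ?h s)" using i by simp
  also have "\<dots> = (LINT s|lborel. gauss 2 s)"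
  proof (rule integral_cong_AE)
    show "AE s in lborel. ?g s + ?h s = gauss 2 s"
      using AE_lborel_singleton[of 0] by eventually_elim (auto simp: indicator_def)
  qed measurable
  also have "\<dots> = 1 / sqrt 2" by (rule integral_gauss) simp
  finally show ?thesis by simp
qed

lemma mehler_weight_tendsto: "(mehler_weight \<longlongrightarrow> 2 * sqrt 2 * pi) (at_right 0)"
proof -
  let ?f = "\<lambda>v. 2 * sqrt 2 * pi * mehler_exp v powr (2 * pi) / sqrt (1 - v^4)"
  have r: "isCont mehler_exp 0" unfolding mehler_exp_def[abs_def] by (intro continuous_intros) simp
  have "mehler_exp 0 \<noteq> 0" by (simp add: mehler_exp_def)
  with r have "isCont ?f 0" by (intro continuous_intros) auto
  then have "(?f \<longlongrightarrow> ?f 0) (at 0)" by (simp add: isCont_def)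
  then have "(?f \<longlongrightarrow> ?f 0) (at_right 0)" by (rule tendsto_within_subset) simp
  moreover have "\<forall>\<^sub>F v in at_right 0. ?f v = mehler_weight v"
    using eventually_at_right_less[of 0] eventually_at_right_real[of 0 1] by (auto simp: mehler_weight_def elim: eventually_mono)
  ultimately have "(mehler_weight \<longlongrightarrow> ?f 0) (at_right 0)" by (rule Lim_transform_eventually)
  then show ?thesis by (simp add: mehler_exp_def)
qed

text \<open>The substitution v = s / x freezes the Gaussian and leaves x only in the argument of the
  weight.\<close>

lemma x_kernel_diag: "0 < x \<Longrightarrow> x * kernel_diag x = (LINT s|lborel. mehler_weight (s / x) * gauss 2 s)"
proof -
  assume x: "0 < x"
  have "kernel_diag x = \<bar>1/x\<bar> *\<^sub>R (LINT s|lborel. mehler_weight (0 + 1/x * s) * gauss (2 * x\<^sup>2) (0 + 1/x * s))"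
    unfolding kernel_diag_eq using x by (intro lborel_integral_real_affine) simp
  also have "(\<lambda>s. mehler_weight (0 + 1/x * s) * gauss (2 * x\<^sup>2) (0 + 1/x * s)) = (\<lambda>s. mehler_weight (s / x) * gauss 2 s)"
    using x by (simp add: gauss_def power_divide mult.assoc)
  finally show ?thesis using x by simp
qed

lemma mehler_weight_le_max: "mehler_weight v \<le> 2 * sqrt 2 * pi"
  using mehler_weight_le[of v] by (cases "0 < v \<and> v < 1") (auto simp: mehler_weight_def)

text \<open>For s > 0 the weight at s / x tends to its right limit at 0, and for s \<le> 0 it
  vanishes, so the limit is that constant times half a Gaussian integral. Boundedness of the weight
  provides the domination.\<close>

lemma x_kernel_diag_tendsto: "((\<lambda>x. x * kernel_diag x) \<longlongrightarrow> pi) at_top"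
proof -
  let ?L = "\<lambda>s. 2 * sqrt 2 * pi * (indicator {0<..} s * gauss 2 s)"
  have A: "((\<lambda>x. LINT s|lborel. mehler_weight (s / x) * gauss 2 s) \<longlongrightarrow> (LINT s|lborel. ?L s)) at_top"
  proof (rule integral_dominated_convergence_at_top)
    show "integrable lborel (\<lambda>s. 2 * sqrt 2 * pi * gauss 2 s)" using integrable_gauss[of 2] by simp
    show "\<forall>\<^sub>F x in at_top. AE s in lborel. norm (mehler_weight (s / x) * gauss 2 s) \<le> 2 * sqrt 2 * pi * gauss 2 s"
    proof (intro always_eventually allI AE_I2)
      fix x s :: real
      have "mehler_weight (s / x) \<le> 2 * sqrt 2 * pi" by (rule mehler_weight_le_max)
      then show "norm (mehler_weight (s / x) * gauss 2 s) \<le> 2 * sqrt 2 * pi * gauss 2 s" by (simp add: mehler_weight_nonneg mult_right_mono)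
    qed
    show "AE s in lborel. ((\<lambda>x. mehler_weight (s / x) * gauss 2 s) \<longlongrightarrow> ?L s) at_top"
    proof (rule AE_I2)
      fix s :: real
      show "((\<lambda>x. mehler_weight (s / x) * gauss 2 s) \<longlongrightarrow> ?L s) at_top"
      proof (cases "0 < s")
        case True
        then have "filterlim (\<lambda>x. s / x) (at_right 0) at_top" by real_asymp
        from filterlim_compose[OF mehler_weight_tendsto this]
        have "((\<lambda>x. mehler_weight (s / x)) \<longlongrightarrow> 2 * sqrt 2 * pi) at_top" .
        from tendsto_mult_right[OF this, of "gauss 2 s"] show ?thesis using True by simp
      next
        case False
        have "\<forall>\<^sub>F x in at_top. 0 = mehler_weight (s / x) * gauss 2 s"
          using eventually_gt_at_top[of 0] by eventually_elim (use False in \<open>auto simp: mehler_weight_def zero_less_divide_iff\<close>)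
        then have "((\<lambda>x. mehler_weight (s / x) * gauss 2 s) \<longlongrightarrow> 0) at_top" by (rule Lim_transform_eventually[OF tendsto_const])
        then show ?thesis using False by simp
      qed
    qed
  qed measurable
  have L: "(LINT s|lborel. ?L s) = pi" using half_gauss by simp
  have "\<forall>\<^sub>F x in at_top. (LINT s|lborel. mehler_weight (s / x) * gauss 2 s) = x * kernel_diag x"
    using eventually_gt_at_top[of 0] by eventually_elim (simp add: x_kernel_diag)
  with A[unfolded L] show ?thesis by (rule Lim_transform_eventually)
qed

section \<open>Growth of the integrated diagonal\<close>

definition diag_trace :: "real \<Rightarrow> real" where "diag_trace R = (LINT x:{-R..R}|lborel. (1 + x\<^sup>2) * kernel_diag x)"

lemma diag_trace_eq: assumes R: "0 \<le> R" shows "diag_trace R = 2 * integral {0..R} (\<lambda>x. (1 + x\<^sup>2) * kernel_diag x)"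
proof -
  let ?g = "\<lambda>x. (1 + x\<^sup>2) * kernel_diag x"
  have c: "continuous_on A ?g" for A by (intro continuous_intros kernel_diag_continuous)
  have "set_integrable lborel {-R..R} ?g"
    using borel_integrable_compact[of "{-R..R}" ?g] c by (simp add: set_integrable_def)
  then have "diag_trace R = integral {-R..R} ?g" unfolding diag_trace_def by (rule set_borel_integral_eq_integral(2))
  also have "\<dots> = integral {-R..0} ?g + integral {0..R} ?g"
    using R c by (intro Henstock_Kurzweil_Integration.integral_combine[symmetric] integrable_continuous_interval) auto
  also have "integral {-R..0} ?g = integral {0..R} ?g"
    using Henstock_Kurzweil_Integration.integral_reflect_real[of R 0 ?g] by (simp add: kernel_diag_even)
  finally show ?thesis by simp
qed

text \<open>L'Hospital's rule: the quotient of derivatives is x * K(x) times (1 + x^2) / (2 * x^2),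
  with limit pi / 2, and evenness of the diagonal contributes the factor 2.\<close>

lemma diag_trace_tendsto: "((\<lambda>R. diag_trace R / (pi * R\<^sup>2)) \<longlongrightarrow> 1) at_top"
proof -
  let ?g = "\<lambda>x. (1 + x\<^sup>2) * kernel_diag x"
  let ?F = "\<lambda>R. integral {0..R} ?g"
  have c: "continuous_on A ?g" for A by (intro continuous_intros kernel_diag_continuous)
  have "((\<lambda>R. ?F R / R\<^sup>2) \<longlongrightarrow> pi / 2) at_top"
  proof (rule lhospital_at_top_at_top)
    show "LIM x at_top. x\<^sup>2 :> (at_top :: real filter)" by real_asymp
    show "\<forall>\<^sub>F x in at_top. 2 * x \<noteq> (0::real)" using eventually_gt_at_top[of 0] by eventually_elim simp
    show "\<forall>\<^sub>F x in at_top. (?F has_real_derivative ?g x) (at x)"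
      using eventually_gt_at_top[of 0]
    proof eventually_elim
      case (elim x)
      have "(?F has_real_derivative ?g x) (at x within {0..x + 1})"
        by (rule integral_has_real_derivative[OF c]) (use elim in auto)
      moreover have "at x within {0..x + 1} = at x" using elim by (intro at_within_interior) simp
      ultimately show ?case by simp
    qed
    show "\<forall>\<^sub>F x in at_top. ((\<lambda>x. x\<^sup>2) has_real_derivative 2 * x) (at x)"
      by (intro always_eventually allI) (auto intro!: derivative_eq_intros)
    have "((\<lambda>x::real. (1 + x\<^sup>2) / (2 * x\<^sup>2)) \<longlongrightarrow> 1/2) at_top" by real_asymp
    from tendsto_mult[OF x_kernel_diag_tendsto this]
    have "((\<lambda>x. x * kernel_diag x * ((1 + x\<^sup>2) / (2 * x\<^sup>2))) \<longlongrightarrow> pi / 2) at_top" by simp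
    moreover have "\<forall>\<^sub>F x in at_top. x * kernel_diag x * ((1 + x\<^sup>2) / (2 * x\<^sup>2)) = ?g x / (2 * x)"
      using eventually_gt_at_top[of 0] by eventually_elim (simp add: power2_eq_square)
    ultimately show "((\<lambda>x. ?g x / (2 * x)) \<longlongrightarrow> pi / 2) at_top" by (rule Lim_transform_eventually)
  qed
  from tendsto_mult_left[OF this, of "2 / pi"]
  have "((\<lambda>R. 2 / pi * (?F R / R\<^sup>2)) \<longlongrightarrow> 1) at_top" by simp
  moreover have "\<forall>\<^sub>F R in at_top. 2 / pi * (?F R / R\<^sup>2) = diag_trace R / (pi * R\<^sup>2)"
    using eventually_ge_at_top[of 0] by eventually_elim (simp add: diag_trace_eq)
  ultimately show ?thesis by (rule Lim_transform_eventually)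
qed

text \<open>Both main terms are positive, so a relative error of at most e / 2 in each summand is
  one in the sum, whatever the ratio of R1 to R2. This allows the two radii to tend to infinity
  independently.\<close>

lemma diag_trace_sum_asymp:
  "(\<lambda>(R1, R2). complex_of_real (diag_trace R1 + diag_trace R2)) \<sim>[at_top \<times>\<^sub>F at_top] (\<lambda>(R1, R2). complex_of_real (pi * R1\<^sup>2 + pi * R2\<^sup>2))"
proof (rule asymp_equivI')
  have "((\<lambda>p. (diag_trace (fst p) + diag_trace (snd p)) / (pi * (fst p)\<^sup>2 + pi * (snd p)\<^sup>2)) \<longlongrightarrow> 1) (at_top \<times>\<^sub>F at_top)"
  proof (rule tendstoI)
    fix e :: real assume e: "e > 0"
    have ev: "\<forall>\<^sub>F R in at_top. 0 < R \<and> \<bar>diag_trace R - pi * R\<^sup>2\<bar> \<le> e / 2 * (pi * R\<^sup>2)"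
      using tendstoD[OF diag_trace_tendsto half_gt_zero[OF e]] eventually_gt_at_top[of 0]
    proof (eventually_elim)
      case (elim R)
      then have p: "0 < pi * R\<^sup>2" by simp
      have "diag_trace R - pi * R\<^sup>2 = (diag_trace R / (pi * R\<^sup>2) - 1) * (pi * R\<^sup>2)" using elim(2) by (simp add: left_diff_distrib)
      then have "\<bar>diag_trace R - pi * R\<^sup>2\<bar> = \<bar>diag_trace R / (pi * R\<^sup>2) - 1\<bar> * (pi * R\<^sup>2)" using p by (metis abs_mult abs_of_pos)
      also have "\<dots> \<le> e / 2 * (pi * R\<^sup>2)" using elim(1) p by (intro mult_right_mono) (auto simp: dist_real_def)
      finally show ?case using elim by simp
    qed
    have "\<forall>\<^sub>F p in at_top \<times>\<^sub>F at_top. (0 < fst p \<and> \<bar>diag_trace (fst p) - pi * (fst p)\<^sup>2\<bar> \<le> e / 2 * (pi * (fst p)\<^sup>2))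
       \<and> (0 < snd p \<and> \<bar>diag_trace (snd p) - pi * (snd p)\<^sup>2\<bar> \<le> e / 2 * (pi * (snd p)\<^sup>2))"
      using eventually_prodI[OF ev ev] by (simp add: case_prod_beta')
    then show "\<forall>\<^sub>F p in at_top \<times>\<^sub>F at_top. dist ((diag_trace (fst p) + diag_trace (snd p)) / (pi * (fst p)\<^sup>2 + pi * (snd p)\<^sup>2)) 1 < e"
    proof eventually_elim
      case (elim p)
      let ?s = "pi * (fst p)\<^sup>2 + pi * (snd p)\<^sup>2"
      have s: "0 < ?s" using elim by (intro add_pos_pos) auto
      have "\<bar>diag_trace (fst p) + diag_trace (snd p) - ?s\<bar> \<le> e / 2 * ?s" using elim unfolding distrib_left by linarith
      also have "\<dots> < e * ?s" using s e by (intro mult_strict_right_mono) auto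
      finally have "\<bar>diag_trace (fst p) + diag_trace (snd p) - ?s\<bar> / ?s < e" using s by (simp only: pos_divide_less_eq)
      moreover have "(diag_trace (fst p) + diag_trace (snd p)) / ?s - 1 = (diag_trace (fst p) + diag_trace (snd p) - ?s) / ?s" using s by (simp add: diff_divide_distrib)
      ultimately show ?case using s unfolding dist_real_def by (simp only: abs_divide abs_of_pos)
    qed
  qed
  then have "((\<lambda>p. complex_of_real ((diag_trace (fst p) + diag_trace (snd p)) / (pi * (fst p)\<^sup>2 + pi * (snd p)\<^sup>2))) \<longlongrightarrow> of_real 1) (at_top \<times>\<^sub>F at_top)"
    by (rule tendsto_of_real)
  then show "((\<lambda>x. (case x of (R1, R2) \<Rightarrow> complex_of_real (diag_trace R1 + diag_trace R2)) / (case x of (R1, R2) \<Rightarrow> complex_of_real (pi * R1\<^sup>2 + pi * R2\<^sup>2))) \<longlongrightarrow> 1) (at_top \<times>\<^sub>F at_top)"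
    by (simp add: case_prod_beta')
qed

section \<open>The localization operator\<close>

text \<open>The representer of the functional f \<mapsto> \<open>fourier f \<xi>\<close>.\<close>

definition mehler_dual :: "real \<Rightarrow> real \<Rightarrow> complex" where "mehler_dual \<xi> = inv_fourier (mehler \<xi>)"

lemma mehler_dual_FSobolev: "mehler_dual \<xi> \<in> FSobolev"
  unfolding mehler_dual_def by (rule inv_fourier_FSobolev[OF mehler_FSobolev])

lemma mehler_dual_inner: "g \<in> FSobolev \<Longrightarrow> FS_inner (mehler_dual \<xi>) g = FS_inner (mehler \<xi>) (fourier g)"
  unfolding mehler_dual_def by (rule FS_inner_inv[OF mehler_FSobolev])

lemma mehler_dual_reproducing: assumes f: "f \<in> FSobolev" shows "FS_inner f (mehler_dual \<xi>) = fourier f \<xi>"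
proof -
  have "FS_inner f (mehler_dual \<xi>) = cnj (FS_inner (mehler \<xi>) (fourier f))"
    using FS.ip_cnj[OF f mehler_dual_FSobolev] by (simp add: mehler_dual_inner[OF f])
  also have "\<dots> = FS_inner (fourier f) (mehler \<xi>)"
    by (rule FS.ip_cnj[OF fourier_FSobolev[OF f] mehler_FSobolev, symmetric])
  also have "\<dots> = fourier f \<xi>" by (rule mehler_reproducing[OF fourier_FSobolev[OF f]])
  finally show ?thesis .
qed

lemma nsq_mehler_diff: "FS.nsq (mehler y - mehler x) = kernel_diag y - 2 * Re (mehler x y) + kernel_diag x"
  by (subst FS.nsq_diff[OF mehler_FSobolev mehler_FSobolev]) (simp add: FS.nsq_def FS_inner_mehler kernel_diag_def)

lemma nsq_mehler: "FS.nsq (mehler x) = kernel_diag x"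
  by (simp add: FS.nsq_def FS_inner_mehler kernel_diag_def)

lemma FS_inner_mehler_dual: "FS_inner (mehler_dual x) (mehler_dual y) = FS_inner (mehler x) (mehler y)"
  using mehler_dual_inner[OF mehler_dual_FSobolev] by (simp add: mehler_dual_def fourier_inv[OF mehler_FSobolev])

lemma nsq_mehler_dual: "FS.nsq (mehler_dual x) = kernel_diag x"
  by (simp add: FS.nsq_def FS_inner_mehler_dual FS_inner_mehler kernel_diag_def)

lemma nsq_mehler_dual_diff: "FS.nsq (mehler_dual y - mehler_dual x) = FS.nsq (mehler y - mehler x)"
  unfolding FS.nsq_diff[OF mehler_FSobolev mehler_FSobolev] FS.nsq_diff[OF mehler_dual_FSobolev mehler_dual_FSobolev]
  by (simp add: FS.nsq_def FS_inner_mehler_dual)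

text \<open>Norm distances of kernels are given by kernel values, K(y,y) - 2 Re K(x,y) + K(x,x), so
  joint continuity of the function is enough; the dual family has the same distances.\<close>

lemma mehler_norm_continuous:
  assumes e: "0 < e" shows "\<exists>d>0. \<forall>y. dist y x < d \<longrightarrow> FS.nrm (mehler y - mehler x) < e \<and> FS.nrm (mehler_dual y - mehler_dual x) < e"
proof -
  have "continuous_on UNIV (\<lambda>y. case (x, y) of (t, x) \<Rightarrow> mehler t x)"
    by (rule continuous_on_compose2[OF mehler_joint_continuous]) (auto intro!: continuous_intros)
  then have "continuous_on UNIV (\<lambda>y. sqrt (kernel_diag y - 2 * Re (mehler x y) + kernel_diag x))"
    by (intro continuous_intros kernel_diag_continuous) simp
  then have "isCont (\<lambda>y. sqrt (kernel_diag y - 2 * Re (mehler x y) + kernel_diag x)) x" by (simp add: continuous_on_eq_continuous_at)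
  then obtain d where d: "d > 0" "\<And>y. dist y x < d \<Longrightarrow>
      dist (sqrt (kernel_diag y - 2 * Re (mehler x y) + kernel_diag x)) (sqrt (kernel_diag x - 2 * Re (mehler x x) + kernel_diag x)) < e"
    using e unfolding continuous_at_eps_delta dist_norm by blast
  have "FS.nrm (mehler y - mehler x) < e \<and> FS.nrm (mehler_dual y - mehler_dual x) < e" if "dist y x < d" for y
  proof -
    have "0 \<le> FS.nsq (mehler y - mehler x)" by (intro FS.nsq_ge0 FS.V_diff mehler_FSobolev)
    then show ?thesis using d(2)[OF that]
      by (simp add: FS.nrm_def nsq_mehler_dual_diff nsq_mehler_diff dist_real_def mehler_diag)
  qed
  then show ?thesis using d(1) by blast
qed

text \<open>The first integral is represented by a superposition of kernels, and the second by the
  inverse transform of such a superposition, since \<open>FS_inner_inv\<close> passes the transform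
  on to g.\<close>

lemma FS_synthesis:
  assumes u: "continuous_on {-R1..R1} u" and v: "continuous_on {-R2..R2} v"
  shows "\<exists>s\<in>FSobolev. \<forall>g\<in>FSobolev. FS_inner s g =
    (LINT x:{-R1..R1}|lborel. u x * cnj (g x) * of_real (1 + x\<^sup>2))
    + (LINT x:{-R2..R2}|lborel. v x * cnj (fourier g x) * of_real (1 + x\<^sup>2))"
proof -
  \<comment> \<open>The cutoff and the weight 1 + x^2 go into the coefficient, as
    \<open>mehler_superposition\<close> integrates against plain Lebesgue measure.\<close>
  define c where "c R w x = indicator {-R..R} x *\<^sub>R (w x * of_real (1 + x\<^sup>2) :: complex)" for R and w :: "real \<Rightarrow> complex" and x :: real
  have ci: "integrable lborel (c R w)" if "continuous_on {-R..R} w" for R w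
    unfolding c_def using that by (intro borel_integrable_compact continuous_intros) auto
  have c0: "c R w x = 0" if "R < \<bar>x\<bar>" for R w x
    using that by (auto simp: c_def indicator_def)
  define a where "a = (\<lambda>t. LINT x|lborel. c R1 u x * mehler x t)"
  define b where "b = (\<lambda>t. LINT x|lborel. c R2 v x * mehler x t)"
  have A: "a \<in> FSobolev" "\<And>g. g \<in> FSobolev \<Longrightarrow> FS_inner a g = (LINT x|lborel. c R1 u x * cnj (g x))"
    unfolding a_def by (rule mehler_superposition[where R = R1, OF ci[OF u]]; (rule c0)?; assumption?)+
  have B: "b \<in> FSobolev" "\<And>g. g \<in> FSobolev \<Longrightarrow> FS_inner b g = (LINT x|lborel. c R2 v x * cnj (g x))"
    unfolding b_def by (rule mehler_superposition[where R = R2, OF ci[OF v]]; (rule c0)?; assumption?)+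
  have b': "inv_fourier b \<in> FSobolev" by (rule inv_fourier_FSobolev[OF B(1)])
  have "FS_inner (a + inv_fourier b) g = (LINT x:{-R1..R1}|lborel. u x * cnj (g x) * of_real (1 + x\<^sup>2))
    + (LINT x:{-R2..R2}|lborel. v x * cnj (fourier g x) * of_real (1 + x\<^sup>2))" if g: "g \<in> FSobolev" for g
  proof -
    have e: "c R w x * z = indicator {-R..R} x *\<^sub>R (w x * z * of_real (1 + x\<^sup>2))" for R w x z
      unfolding c_def scaleR_conv_of_real by (simp only: mult_ac)
    have "FS_inner (a + inv_fourier b) g = FS_inner a g + FS_inner b (fourier g)"
      by (simp only: FS.ip_add[OF A(1) b' g] FS_inner_inv[OF B(1) g])
    also have "\<dots> = (LINT x|lborel. c R1 u x * cnj (g x)) + (LINT x|lborel. c R2 v x * cnj (fourier g x))"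
      by (simp only: A(2)[OF g] B(2)[OF fourier_FSobolev[OF g]])
    finally show ?thesis unfolding e set_lebesgue_integral_def .
  qed
  moreover have "a + inv_fourier b \<in> FSobolev" by (rule FS.V_add[OF A(1) b'])
  ultimately show ?thesis by blast
qed

text \<open>The definition of \<open>loc_op\<close> prescribes only pairings with kernels. The
  vector s of \<open>FS_synthesis\<close> has these same pairings, and by the reproducing property
  they are its values; so T f = s, which gives membership in the space and the weak form against
  every g.\<close>

lemma loc_op_inner:
  fixes R1 R2 :: real
  assumes f: "f \<in> FSobolev"
  defines "T \<equiv> loc_op {-R1..R1} {-R2..R2}"
  shows "T f \<in> FSobolev"
    and "\<And>g. g \<in> FSobolev \<Longrightarrow> FS_inner (T f) g = (LINT x:{-R1..R1}|lborel. f x * cnj (g x) * of_real (1 + x\<^sup>2))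
    + (LINT x:{-R2..R2}|lborel. fourier f x * cnj (fourier g x) * of_real (1 + x\<^sup>2))"
proof -
  have "continuous_on {-R1..R1} f" "continuous_on {-R2..R2} (fourier f)"
    using FSobolev_continuous[OF f] FSobolev_continuous[OF fourier_FSobolev[OF f]] continuous_on_subset by blast+
  from FS_synthesis[OF this] obtain s where s: "s \<in> FSobolev"
    "\<And>g. g \<in> FSobolev \<Longrightarrow> FS_inner s g = (LINT x:{-R1..R1}|lborel. f x * cnj (g x) * of_real (1 + x\<^sup>2))
    + (LINT x:{-R2..R2}|lborel. fourier f x * cnj (fourier g x) * of_real (1 + x\<^sup>2))" by blast
  have "T f = s"
  proof
    fix t
    have "T f t = FS_inner s (mehler t)" unfolding T_def loc_op_def FS_kernel_eq s(2)[OF mehler_FSobolev] ..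
    then show "T f t = s t" by (simp add: mehler_reproducing[OF s(1)])
  qed
  then show "T f \<in> FSobolev"
    and "\<And>g. g \<in> FSobolev \<Longrightarrow> FS_inner (T f) g = (LINT x:{-R1..R1}|lborel. f x * cnj (g x) * of_real (1 + x\<^sup>2))
    + (LINT x:{-R2..R2}|lborel. fourier f x * cnj (fourier g x) * of_real (1 + x\<^sup>2))"
    using s by simp_all
qed

section \<open>The two windows as one continuous frame\<close>

context
  fixes R1 R2 :: real assumes R: "0 < R1" "0 < R2"
begin

text \<open>Moving \<open>J\<close> past \<open>I\<close> turns the two windows into one compact set carrying a single kernel family.\<close>
definition window_shift :: real where "window_shift = R1 + R2 + 1"
definition windows :: "real set" where "windows = {-R1..R1} \<union> {window_shift - R2..window_shift + R2}"
definition window_weight :: "real \<Rightarrow> real" where "window_weight x = (if x \<le> R1 then 1 + x\<^sup>2 else 1 + (x - window_shift)\<^sup>2)"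
definition window_measure :: "real measure" where "window_measure = restrict_space (density lborel (\<lambda>x. ennreal (window_weight x))) windows"
definition window_kernel :: "real \<Rightarrow> real \<Rightarrow> complex" where "window_kernel x = (if x \<le> R1 then mehler x else mehler_dual (x - window_shift))"

lemma windows_compact: "compact windows" unfolding windows_def by (intro compact_Un) auto

lemma windows_borel[measurable]: "windows \<in> sets borel" unfolding windows_def by simp

lemma windows_cases: "x \<in> windows \<Longrightarrow> (x \<le> R1 \<and> x \<in> {-R1..R1}) \<or> (R1 + 1 \<le> x \<and> x - window_shift \<in> {-R2..R2})"
  by (auto simp: windows_def window_shift_def)

lemma window_weight_measurable[measurable]: "window_weight \<in> borel_measurable borel"
  unfolding window_weight_def[abs_def] by measurable

lemma window_weight_ge_1: "1 \<le> window_weight x" by (simp add: window_weight_def)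

lemma window_weight_bounded: "\<exists>C\<ge>0. \<forall>x\<in>windows. window_weight x \<le> C"
proof (intro exI[of _ "1 + R1\<^sup>2 + R2\<^sup>2"] conjI ballI)
  fix x assume "x \<in> windows"
  then consider "x \<le> R1" "\<bar>x\<bar> \<le> R1" | "\<not> x \<le> R1" "\<bar>x - window_shift\<bar> \<le> R2" using windows_cases[of x] by fastforce
  then show "window_weight x \<le> 1 + R1\<^sup>2 + R2\<^sup>2"
  proof cases
    case 1
    then have "x\<^sup>2 \<le> R1\<^sup>2" by (metis abs_ge_zero power2_abs power_mono)
    then have "1 + x\<^sup>2 \<le> 1 + R1\<^sup>2 + R2\<^sup>2" using zero_le_power2[of R2] by linarith
    then show ?thesis using 1 by (simp add: window_weight_def)
  next
    case 2
    then have "(x - window_shift)\<^sup>2 \<le> R2\<^sup>2" by (metis abs_ge_zero power2_abs power_mono)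
    then have "1 + (x - window_shift)\<^sup>2 \<le> 1 + R1\<^sup>2 + R2\<^sup>2" using zero_le_power2[of R1] by linarith
    then show ?thesis using 2 by (simp add: window_weight_def)
  qed
qed simp

lemma window_measure_space: "space window_measure = windows" unfolding window_measure_def by (simp add: space_restrict_space)

lemma window_measure_sets: "sets window_measure = sets (restrict_space borel windows)"
  unfolding window_measure_def by (rule sets_restrict_space_cong) simp

lemma window_measure_emeasure: "A \<in> sets borel \<Longrightarrow> A \<subseteq> windows \<Longrightarrow> emeasure window_measure A = (\<integral>\<^sup>+x. ennreal (window_weight x) * indicator A x \<partial>lborel)"
  unfolding window_measure_def by (subst emeasure_restrict_space) (auto simp: emeasure_density)

lemma window_measure_finite: "finite_measure window_measure"
proof (rule finite_measureI)
  obtain C where C: "C \<ge> 0" "\<And>x. x \<in> windows \<Longrightarrow> window_weight x \<le> C" using window_weight_bounded by blast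
  have "emeasure window_measure (space window_measure) = (\<integral>\<^sup>+x. ennreal (window_weight x) * indicator windows x \<partial>lborel)" by (simp add: window_measure_space window_measure_emeasure)
  also have "\<dots> \<le> (\<integral>\<^sup>+x. ennreal C * indicator windows x \<partial>lborel)"
    by (intro nn_integral_mono) (auto simp: indicator_def C ennreal_leI)
  also have "\<dots> = ennreal C * emeasure lborel windows" by (simp add: nn_integral_cmult_indicator)
  also have "\<dots> < \<infinity>" using emeasure_compact_finite[OF windows_compact] by (simp add: ennreal_mult_less_top)
  finally show "emeasure window_measure (space window_measure) \<noteq> \<infinity>" by simp
qed

text \<open>Positive radii keep the windows from shrinking to points, so every ball around a point
  of a window meets it in an interval of positive length, and the density is at least 1.\<close>

lemma window_measure_supp: assumes x: "x \<in> windows" and d: "0 < \<delta>" shows "0 < measure window_measure (windows \<inter> ball x \<delta>)"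
proof -
  interpret finite_measure window_measure by (rule window_measure_finite)
  have "\<exists>l u. l < u \<and> {l..u} \<subseteq> windows \<inter> ball x \<delta>"
    using windows_cases[OF x]
  proof
    assume "x \<le> R1 \<and> x \<in> {-R1..R1}"
    \<comment> \<open>Half the radius keeps the closed interval inside the open ball.\<close>
    then have "max (-R1) (x - \<delta>/2) < min R1 (x + \<delta>/2) \<and> {max (-R1) (x - \<delta>/2)..min R1 (x + \<delta>/2)} \<subseteq> windows \<inter> ball x \<delta>"
      using R d by (auto simp: windows_def dist_real_def)
    then show ?thesis by blast
  next
    assume "R1 + 1 \<le> x \<and> x - window_shift \<in> {-R2..R2}"
    then have "max (window_shift-R2) (x - \<delta>/2) < min (window_shift+R2) (x + \<delta>/2) \<and> {max (window_shift-R2) (x - \<delta>/2)..min (window_shift+R2) (x + \<delta>/2)} \<subseteq> windows \<inter> ball x \<delta>"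
      using R d by (auto simp: windows_def dist_real_def)
    then show ?thesis by blast
  qed
  then obtain l u where lu: "l < u" "{l..u} \<subseteq> windows \<inter> ball x \<delta>" by blast
  have le: "indicator {l..u} y \<le> ennreal (window_weight y) * indicator (windows \<inter> ball x \<delta>) y" for y
  proof -
    have "1 \<le> ennreal (window_weight y)" using window_weight_ge_1[of y] by (metis ennreal_1 ennreal_leI)
    then show ?thesis using lu(2) by (auto simp: indicator_def)
  qed
  have "0 < emeasure lborel {l..u}" using lu(1) by simp
  also have "emeasure lborel {l..u} = (\<integral>\<^sup>+x. indicator {l..u} x \<partial>lborel)" by simp
  also have "\<dots> \<le> (\<integral>\<^sup>+y. ennreal (window_weight y) * indicator (windows \<inter> ball x \<delta>) y \<partial>lborel)"
    by (intro nn_integral_mono le)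
  also have "\<dots> = emeasure window_measure (windows \<inter> ball x \<delta>)" by (rule window_measure_emeasure[symmetric]) auto
  finally show ?thesis by (simp add: emeasure_eq_measure)
qed

lemma window_measure_integral:
  fixes f :: "real \<Rightarrow> complex"
  assumes f: "continuous_on windows f"
  shows "(LINT x|window_measure. f x) = (LINT x:{-R1..R1}|lborel. f x * of_real (1 + x\<^sup>2)) + (LINT x:{-R2..R2}|lborel. f (window_shift + x) * of_real (1 + x\<^sup>2))"
proof -
  have m: "(\<lambda>x. indicator windows x *\<^sub>R f x) \<in> borel_measurable lborel"
    using borel_measurable_continuous_on_indicator[OF windows_borel f] by simp
  have c1: "continuous_on {-R1..R1} f" and c2: "continuous_on {window_shift-R2..window_shift+R2} f"
    using f continuous_on_subset by (auto simp: windows_def)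
  have i1: "integrable lborel (\<lambda>x. indicator {-R1..R1} x *\<^sub>R (f x * of_real (1 + x\<^sup>2)))"
    by (intro borel_integrable_compact continuous_intros c1) auto
  have i2: "integrable lborel (\<lambda>x. indicator {window_shift-R2..window_shift+R2} x *\<^sub>R (f x * of_real (1 + (x - window_shift)\<^sup>2)))"
    by (intro borel_integrable_compact continuous_intros c2) auto
  have "(LINT x|window_measure. f x) = (LINT x|density lborel (\<lambda>x. ennreal (window_weight x)). indicator windows x *\<^sub>R f x)"
    unfolding window_measure_def by (subst integral_restrict_space) auto
  also have "\<dots> = (LINT x|lborel. window_weight x *\<^sub>R (indicator windows x *\<^sub>R f x))"
    using window_weight_ge_1 by (intro integral_density m AE_I2) (auto intro: order_trans[of 0 1])
  also have "(\<lambda>x. window_weight x *\<^sub>R (indicator windows x *\<^sub>R f x)) = (\<lambda>x. indicator {-R1..R1} x *\<^sub>R (f x * of_real (1 + x\<^sup>2))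
       + indicator {window_shift-R2..window_shift+R2} x *\<^sub>R (f x * of_real (1 + (x - window_shift)\<^sup>2)))"
    using R by (auto simp: fun_eq_iff windows_def window_weight_def window_shift_def indicator_def scaleR_conv_of_real)
  also have "(LINT x|lborel. \<dots> x) = (LINT x|lborel. indicator {-R1..R1} x *\<^sub>R (f x * of_real (1 + x\<^sup>2)))
      + (LINT x|lborel. indicator {window_shift-R2..window_shift+R2} x *\<^sub>R (f x * of_real (1 + (x - window_shift)\<^sup>2)))"
    using i1 i2 by (rule Bochner_Integration.integral_add)
  also have "(LINT x|lborel. indicator {window_shift-R2..window_shift+R2} x *\<^sub>R (f x * of_real (1 + (x - window_shift)\<^sup>2)))
      = (LINT x|lborel. indicator {-R2..R2} x *\<^sub>R (f (window_shift + x) * of_real (1 + x\<^sup>2)))"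
    by (subst lborel_integral_real_affine[of 1 _ window_shift]) (auto intro!: Bochner_Integration.integral_cong simp: indicator_def)
  finally show ?thesis unfolding set_lebesgue_integral_def .
qed

lemma set_integral_cong': "(\<And>x. x \<in> A \<Longrightarrow> f x = g x) \<Longrightarrow> (LINT x:A|lborel. f x) = (LINT x:A|lborel. g x)"
  for f g :: "real \<Rightarrow> complex"
  unfolding set_lebesgue_integral_def by (intro Bochner_Integration.integral_cong) (auto simp: indicator_def)

lemma window_kernel_FSobolev: "window_kernel x \<in> FSobolev"
  by (simp add: window_kernel_def mehler_FSobolev mehler_dual_FSobolev)

lemma window_kernel_J: "x \<in> {-R2..R2} \<Longrightarrow> window_kernel (window_shift + x) = mehler_dual x"
  by (auto simp: window_kernel_def window_shift_def)

lemma window_kernel_I: "x \<in> {-R1..R1} \<Longrightarrow> window_kernel x = mehler x"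
  by (auto simp: window_kernel_def)

lemma window_kernel_continuous: assumes x: "x \<in> windows" and e: "0 < \<epsilon>"
  shows "\<exists>\<delta>>0. \<forall>y\<in>windows. dist y x < \<delta> \<longrightarrow> FS.nrm (window_kernel y - window_kernel x) < \<epsilon>"
  using windows_cases[OF x]
proof
  assume a: "x \<le> R1 \<and> x \<in> {-R1..R1}"
  obtain d where d: "d > 0" "\<And>y. dist y x < d \<Longrightarrow> FS.nrm (mehler y - mehler x) < \<epsilon>" using mehler_norm_continuous[OF e, of x] by blast
  \<comment> \<open>The windows are at distance 1, so a point y closer to x than 1 lies in the same
    window and the same branch of \<open>window_kernel\<close> applies.\<close>
  have "FS.nrm (window_kernel y - window_kernel x) < \<epsilon>" if "y \<in> windows" "dist y x < min d 1" for y
    using windows_cases[OF that(1)] that(2) a d(2)[of y] by (auto simp: window_kernel_def dist_real_def)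
  then show ?thesis using d(1) by (intro exI[of _ "min d 1"]) auto
next
  assume a: "R1 + 1 \<le> x \<and> x - window_shift \<in> {-R2..R2}"
  obtain d where d: "d > 0" "\<And>y. dist y (x - window_shift) < d \<Longrightarrow> FS.nrm (mehler_dual y - mehler_dual (x - window_shift)) < \<epsilon>"
    using mehler_norm_continuous[OF e, of "x - window_shift"] by blast
  have "FS.nrm (window_kernel y - window_kernel x) < \<epsilon>" if "y \<in> windows" "dist y x < min d 1" for y
    using windows_cases[OF that(1)] that(2) a d(2)[of "y - window_shift"] by (auto simp: window_kernel_def dist_real_def)
  then show ?thesis using d(1) by (intro exI[of _ "min d 1"]) auto
qed

lemma window_kernel_inner_continuous: assumes f: "f \<in> FSobolev" shows "continuous_on windows (\<lambda>x. FS_inner f (window_kernel x))"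
proof -
  have cf: "continuous_on UNIV f" "continuous_on UNIV (fourier f)"
    using FSobolev_continuous[OF f] FSobolev_continuous[OF fourier_FSobolev[OF f]] .
  have "continuous_on {-R1..R1} f" using cf(1) continuous_on_subset by blast
  then have 1: "continuous_on {-R1..R1} (\<lambda>x. FS_inner f (window_kernel x))"
    by (rule continuous_on_eq) (simp add: window_kernel_I mehler_reproducing[OF f])
  have "continuous_on {window_shift-R2..window_shift+R2} (\<lambda>x. fourier f (x - window_shift))"
    by (rule continuous_on_compose2[OF cf(2)]) (auto intro!: continuous_intros)
  then have 2: "continuous_on {window_shift-R2..window_shift+R2} (\<lambda>x. FS_inner f (window_kernel x))"
  proof (rule continuous_on_eq)
    fix x assume "x \<in> {window_shift-R2..window_shift+R2}"
    then have "window_kernel x = mehler_dual (x - window_shift)" by (auto simp: window_kernel_def window_shift_def)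
    then show "fourier f (x - window_shift) = FS_inner f (window_kernel x)" by (simp add: mehler_dual_reproducing[OF f])
  qed
  show ?thesis unfolding windows_def by (rule continuous_on_closed_Un[OF _ _ 1 2]) auto
qed

lemma window_measure_integral_inner:
  assumes u: "continuous_on windows u" and g: "g \<in> FSobolev"
  shows "(LINT x|window_measure. u x * cnj (FS_inner g (window_kernel x))) = (LINT x:{-R1..R1}|lborel. u x * cnj (g x) * of_real (1 + x\<^sup>2))
    + (LINT x:{-R2..R2}|lborel. u (window_shift + x) * cnj (fourier g x) * of_real (1 + x\<^sup>2))"
proof -
  have "continuous_on windows (\<lambda>x. u x * cnj (FS_inner g (window_kernel x)))" by (intro continuous_intros u window_kernel_inner_continuous g)
  note window_measure_integral[OF this]
  also have "(LINT x:{-R1..R1}|lborel. u x * cnj (FS_inner g (window_kernel x)) * of_real (1 + x\<^sup>2))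
    = (LINT x:{-R1..R1}|lborel. u x * cnj (g x) * of_real (1 + x\<^sup>2))"
    by (rule set_integral_cong') (simp only: window_kernel_I mehler_reproducing[OF g])
  also have "(LINT x:{-R2..R2}|lborel. u (window_shift + x) * cnj (FS_inner g (window_kernel (window_shift + x))) * of_real (1 + x\<^sup>2))
    = (LINT x:{-R2..R2}|lborel. u (window_shift + x) * cnj (fourier g x) * of_real (1 + x\<^sup>2))"
    by (rule set_integral_cong') (simp only: window_kernel_J mehler_dual_reproducing[OF g])
  finally show ?thesis .
qed

lemma frame: "compact_frame FSobolev FS_inner window_measure windows window_kernel (loc_op {-R1..R1} {-R2..R2})"
proof (intro compact_frame.intro compact_frame_axioms.intro)
  show "complex_semi_inner FSobolev FS_inner" by (rule FS.complex_semi_inner_axioms)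
  show "finite_measure window_measure" by (rule window_measure_finite)
  show "f = 0" if "f \<in> FSobolev" "FS_inner f f = 0" for f using that by (rule FS_inner_eq_0)
  show "compact windows" "space window_measure = windows" "sets window_measure = sets (restrict_space borel windows)" by (rule windows_compact window_measure_space window_measure_sets)+
  show "0 < measure window_measure (windows \<inter> ball x \<delta>)" if "x \<in> windows" "0 < \<delta>" for x \<delta> using that by (rule window_measure_supp)
  show "window_kernel x \<in> FSobolev" for x by (rule window_kernel_FSobolev)
  show "\<exists>\<delta>>0. \<forall>y\<in>windows. dist y x < \<delta> \<longrightarrow> FS.nrm (window_kernel y - window_kernel x) < \<epsilon>" if "x \<in> windows" "0 < \<epsilon>" for x \<epsilon>
    using that by (rule window_kernel_continuous)
  show "loc_op {-R1..R1} {-R2..R2} f \<in> FSobolev" if "f \<in> FSobolev" for f by (rule loc_op_inner(1)[OF that])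
  show "FS_inner (loc_op {-R1..R1} {-R2..R2} f) g = (LINT x|window_measure. FS_inner f (window_kernel x) * cnj (FS_inner g (window_kernel x)))"
    if f: "f \<in> FSobolev" and g: "g \<in> FSobolev" for f g
  proof -
    have "(LINT x:{-R1..R1}|lborel. f x * cnj (g x) * of_real (1 + x\<^sup>2)) = (LINT x:{-R1..R1}|lborel. FS_inner f (window_kernel x) * cnj (g x) * of_real (1 + x\<^sup>2))"
      by (rule set_integral_cong') (simp only: window_kernel_I mehler_reproducing[OF f])
    moreover have "(LINT x:{-R2..R2}|lborel. fourier f x * cnj (fourier g x) * of_real (1 + x\<^sup>2)) = (LINT x:{-R2..R2}|lborel. FS_inner f (window_kernel (window_shift + x)) * cnj (fourier g x) * of_real (1 + x\<^sup>2))"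
      by (rule set_integral_cong') (simp only: window_kernel_J mehler_dual_reproducing[OF f])
    ultimately show ?thesis
      unfolding loc_op_inner(2)[OF f g] window_measure_integral_inner[OF window_kernel_inner_continuous[OF f] g] by (simp only:)
  qed
  show "\<exists>s\<in>FSobolev. \<forall>g\<in>FSobolev. FS_inner s g = (LINT x|window_measure. u x * cnj (FS_inner g (window_kernel x)))" if u: "continuous_on windows u" for u
  proof -
    have "continuous_on {-R1..R1} u" using u continuous_on_subset by (auto simp: windows_def)
    moreover have "continuous_on {-R2..R2} (\<lambda>x. u (window_shift + x))"
      by (rule continuous_on_compose2[OF u]) (auto intro!: continuous_intros simp: windows_def)
    ultimately show ?thesis using FS_synthesis[of R1 u R2 "\<lambda>x. u (window_shift + x)"] window_measure_integral_inner[OF u] by simp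
  qed
qed

lemma frame_trace: "complex_of_real (LINT x|window_measure. FS.nsq (window_kernel x)) = of_real (diag_trace R1 + diag_trace R2)"
proof -
  interpret F: compact_frame FSobolev FS_inner window_measure windows window_kernel "loc_op {-R1..R1} {-R2..R2}" by (rule frame)
  have c: "continuous_on windows (\<lambda>x. complex_of_real (FS.nsq (window_kernel x)))" by (intro continuous_intros F.cont_nsq_k)
  have r: "(LINT x:{-R..R}|lborel. complex_of_real (kernel_diag x) * of_real (1 + x\<^sup>2)) = of_real (diag_trace R)" for R
    unfolding diag_trace_def set_lebesgue_integral_def integral_complex_of_real[symmetric]
    by (intro Bochner_Integration.integral_cong) (simp_all add: scaleR_conv_of_real mult.commute)
  have "complex_of_real (LINT x|window_measure. FS.nsq (window_kernel x)) = (LINT x|window_measure. complex_of_real (FS.nsq (window_kernel x)))" by simp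
  also have "\<dots> = (LINT x:{-R1..R1}|lborel. of_real (FS.nsq (window_kernel x)) * of_real (1 + x\<^sup>2)) + (LINT x:{-R2..R2}|lborel. of_real (FS.nsq (window_kernel (window_shift + x))) * of_real (1 + x\<^sup>2))"
    by (rule window_measure_integral[OF c])
  also have "(LINT x:{-R1..R1}|lborel. complex_of_real (FS.nsq (window_kernel x)) * of_real (1 + x\<^sup>2)) = of_real (diag_trace R1)"
    unfolding r[symmetric] by (rule set_integral_cong') (simp only: window_kernel_I nsq_mehler)
  also have "(LINT x:{-R2..R2}|lborel. complex_of_real (FS.nsq (window_kernel (window_shift + x))) * of_real (1 + x\<^sup>2)) = of_real (diag_trace R2)"
    unfolding r[symmetric] by (rule set_integral_cong') (simp only: window_kernel_J nsq_mehler_dual)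
  finally show ?thesis by simp
qed

lemma loc_op_spectrum:
  defines "T \<equiv> loc_op {-R1..R1} {-R2..R2}"
  shows "\<mu> \<noteq> 0 \<Longrightarrow> fin_dim (eigenspace T \<mu>)"
    and "((\<lambda>\<mu>. of_nat (multiplicity_of T \<mu>) * \<mu>) has_sum of_real (diag_trace R1 + diag_trace R2)) (eigenvalues T)"
proof -
  interpret F: compact_frame FSobolev FS_inner window_measure windows window_kernel T unfolding T_def by (rule frame)
  have E: "F.espace \<mu> = eigenspace T \<mu>" for \<mu> unfolding F.espace_def eigenspace_def ..
  show "\<mu> \<noteq> 0 \<Longrightarrow> fin_dim (eigenspace T \<mu>)" using F.fin_dim_espace[of \<mu>] unfolding E .
  show "((\<lambda>\<mu>. of_nat (multiplicity_of T \<mu>) * \<mu>) has_sum of_real (diag_trace R1 + diag_trace R2)) (eigenvalues T)"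
    using F.trace_formula unfolding E F.kernel_trace_def frame_trace multiplicity_of_def eigenvalues_def .
qed

end

text \<open>The first two clauses guard the asymptotic one against default values:
  finite-dimensional eigenspaces make \<open>multiplicity_of\<close> the true multiplicity of every
  nonzero eigenvalue, and summability makes the infinite sum a true sum instead of 0.\<close>

theorem theorem8:
  shows "(\<forall>R1>0. \<forall>R2>0.
        (\<forall>\<mu>. \<mu> \<noteq> 0 \<longrightarrow> fin_dim (eigenspace (loc_op {-R1..R1} {-R2..R2}) \<mu>))
        \<and> (\<lambda>\<mu>. of_nat (multiplicity_of (loc_op {-R1..R1} {-R2..R2}) \<mu>) * \<mu>)
            summable_on eigenvalues (loc_op {-R1..R1} {-R2..R2}))
    \<and> (\<lambda>(R1, R2). \<Sum>\<^sub>\<infinity>\<mu>\<in>eigenvalues (loc_op {-R1..R1} {-R2..R2}).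
            of_nat (multiplicity_of (loc_op {-R1..R1} {-R2..R2}) \<mu>) * \<mu>)
         \<sim>[at_top \<times>\<^sub>F at_top]
         (\<lambda>(R1, R2). complex_of_real (pi * R1\<^sup>2 + pi * R2\<^sup>2))"
proof (intro conjI allI impI)
  fix R1 R2 :: real assume R: "0 < R1" "0 < R2"
  show "fin_dim (eigenspace (loc_op {-R1..R1} {-R2..R2}) \<mu>)" if "\<mu> \<noteq> 0" for \<mu>
    by (rule loc_op_spectrum(1)[OF R that])
  show "(\<lambda>\<mu>. of_nat (multiplicity_of (loc_op {-R1..R1} {-R2..R2}) \<mu>) * \<mu>)
            summable_on eigenvalues (loc_op {-R1..R1} {-R2..R2})"
    using loc_op_spectrum(2)[OF R] by (rule has_sum_imp_summable)
next
  have pos: "\<forall>\<^sub>F R in at_top. 0 < (R::real)" by (rule eventually_gt_at_top)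
  \<comment> \<open>The trace identity holds for positive radii; equality on this eventual set
    suffices to transfer the asymptotics.\<close>
  have "\<forall>\<^sub>F p in at_top \<times>\<^sub>F at_top. (0 :: real) < fst p \<and> (0 :: real) < snd p"
    using eventually_prodI[OF pos pos] by simp
  then have "\<forall>\<^sub>F p in at_top \<times>\<^sub>F at_top. (case p of (R1, R2) \<Rightarrow> complex_of_real (diag_trace R1 + diag_trace R2)) =
     (case p of (R1, R2) \<Rightarrow> \<Sum>\<^sub>\<infinity>\<mu>\<in>eigenvalues (loc_op {-R1..R1} {-R2..R2}).
            of_nat (multiplicity_of (loc_op {-R1..R1} {-R2..R2}) \<mu>) * \<mu>)"
  proof eventually_elim
    case (elim p)
    obtain R1 R2 where p: "p = (R1, R2)" by (cases p)
    show ?case using elim infsumI[OF loc_op_spectrum(2)[of R1 R2]] unfolding p by simp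
  qed
  then show "(\<lambda>(R1, R2). \<Sum>\<^sub>\<infinity>\<mu>\<in>eigenvalues (loc_op {-R1..R1} {-R2..R2}).
            of_nat (multiplicity_of (loc_op {-R1..R1} {-R2..R2}) \<mu>) * \<mu>)
         \<sim>[at_top \<times>\<^sub>F at_top]
         (\<lambda>(R1, R2). complex_of_real (pi * R1\<^sup>2 + pi * R2\<^sup>2))"
    by (rule asymp_equiv_transfer[OF diag_trace_sum_asymp _ always_eventually]) simp
qed

end
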